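(* Let $m_1,m_2\in\mathbb N$, $D,L,C>0$ and $\lambda\in(0,1)$. For every $\varepsilon>0$ there is $\sigma_0>\max\{1,L\}$, depending only on $\varepsilon,m_1,m_2,D,L,C,\lambda$, such that the following holds. Let $F(\omega,x)=(g(\omega),f(\omega,x))$ be a skew-product on $\mathbb T^{m_1}\times\mathbb T^{m_2}$ as in the context, where $g$ satisfies (E) with constant $\sigma$ and (D) with constant $D$, $f$ has Lipschitz constant $L$, and the geometric ergodicity assumption (H) holds with constants $C,\lambda$. If $\sigma>\sigma_0$, then there are $\tilde\lambda\in(0,1)$, $\tilde C>0$ and a Borel probability measure $\bar\eta$ on $\mathbb T^{m_2}$ such that, for all $n\in\mathbb N$, $$\left|\int_{\mathbb T^{m_1}\times\mathbb T^{m_2}}\varphi(\pi_2F^n(\omega,x))\,\psi(x)\,d\omega\,dx-\int_{\mathbb T^{m_2}}\varphi\,d\bar\eta\int_{\mathbb T^{m_2}}\psi(x)\,dx\right|\le C_{\varphi,\psi}\,(\tilde C\tilde\lambda^n+\varepsilon)$$ for all $\psi\in L^1(\mathbb T^{m_2};\mathbb R)$ and all Lipschitz $\varphi:\mathbb T^{m_2}\to\mathbb R$, where $C_{\varphi,\psi}>0$ depends on $\varphi,\psi$ but not on $n$ or $\varepsilon$.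
   Context: $\mathbb T=\mathbb R/\mathbb Z$; $|p-q|$ denotes the (flat Euclidean) distance on $\mathbb T^N$ for any $N$. $\pi_2:\mathbb T^{m_1}\times\mathbb T^{m_2}\to\mathbb T^{m_2}$ is the projection on the second factor. $\mathcal M_1(Y)$ is the set of Borel probability measures on $Y$. Base map: $g:\mathbb T^{m_1}\to\mathbb T^{m_1}$ is a $C^2$ local diffeomorphism. There are $d\in\mathbb N$ and a partition $\{I_i\}_{i=1}^d$ of $\mathbb T^{m_1}$, each $I_i$ equal to its interior modulo a null set, such that $g_i=g|_{I_i}:I_i\to\mathbb T^{m_1}$ is invertible (and $C^2$ on the interior of $I_i$), with inverse $h_i$. Conditions: (E) $\sigma>1$ and $\|Dg_\omega v\|\ge\sigma\|v\|$ for all $\omega\in\mathbb T^{m_1}$, $v\in\mathbb R^{m_1}$. (D) $\dfrac{|Dg_{h_i(\omega_1)}|}{|Dg_{h_i(\omega_2)}|}\le e^{D|\omega_1-\omega_2|}$ for all $\omega_1,\omega_2\in\mathbb T^{m_1}$ and all $i$, where $|Dg_\omega|$ is the absolute value of the determinant of the differential. Such a $g$ has a unique absolutely continuous invariant probability measure $\nu_g$, with density $\rho_g$ with respect to Lebesgue measure. Fiber maps: $f:\mathbb T^{m_1}\times\mathbb T^{m_2}\to\mathbb T^{m_2}$ is Lipschitz with Lipschitz constant $L=\sup_{(\omega_1,x_1)\ne(\omega_2,x_2)}\frac{|f(\omega_1,x_1)-f(\omega_2,x_2)|}{|(\omega_1,x_1)-(\omega_2,x_2)|}$, and $f_\omega=f(\omega,\cdot)$.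 Random counterpart: $\mathcal P:\mathcal M_1(\mathbb T^{m_2})\to\mathcal M_1(\mathbb T^{m_2})$, $\mathcal P\mu=\int_{\mathbb T^{m_1}}\rho_g(\omega)\,f_{\omega*}\mu\,d\omega$. (H) $d_{TV}(\mathcal P^n\mu,\mathcal P^n\nu)\le C\lambda^n d_{TV}(\mu,\nu)$ for all $\mu,\nu\in\mathcal M_1(\mathbb T^{m_2})$ and $n\in\mathbb N$, where $d_{TV}(\mu,\nu)=\sup_A|\mu(A)-\nu(A)|$ is the total variation distance. *)

theory Defs
  imports "HOL-Probability.Probability"
begin

section \<open>The flat torus\<close>

quotient_type 'n torus =
  "real ^ 'n" / "\<lambda>x y. \<forall>i. x $ i - y $ i \<in> \<int>"
  morphisms rep_torus to_torus
proof (rule equivpI)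
  show "reflp (\<lambda>x y::real^'n. \<forall>i. x $ i - y $ i \<in> \<int>)"
    by (simp add: reflp_def)
  show "symp (\<lambda>x y::real^'n. \<forall>i. x $ i - y $ i \<in> \<int>)"
  proof (rule sympI, rule allI)
    fix x y :: "real^'n" and i
    assume "\<forall>i. x $ i - y $ i \<in> \<int>"
    then have "- (x $ i - y $ i) \<in> \<int>" by (intro Ints_minus) auto
    then show "y $ i - x $ i \<in> \<int>" by simp
  qed
  show "transp (\<lambda>x y::real^'n. \<forall>i. x $ i - y $ i \<in> \<int>)"
  proof (rule transpI, rule allI)
    fix x y z :: "real^'n" and i
    assume "\<forall>i. x $ i - y $ i \<in> \<int>" "\<forall>i. y $ i - z $ i \<in> \<int>"
    then have "(x $ i - y $ i) + (y $ i - z $ i) \<in> \<int>"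
      by (intro Ints_add) auto
    then show "x $ i - z $ i \<in> \<int>" by simp
  qed
qed

lemma to_torus_eq_iff: "to_torus x = to_torus y \<longleftrightarrow> (\<forall>i. x $ i - y $ i \<in> \<int>)"
  by (rule torus.abs_eq_iff)

lemma to_torus_surj: "\<exists>x. to_torus x = p"
  by (rule exI, rule Quotient3_abs_rep[OF Quotient3_torus])

lemma to_torus_shift:
  assumes "to_torus x = to_torus x'"
  shows "to_torus (y + (x' - x)) = to_torus y"
  using assms[symmetric] unfolding to_torus_eq_iff by simp

instantiation torus :: (finite) metric_space
begin

definition dist_torus :: "'a torus \<Rightarrow> 'a torus \<Rightarrow> real" where
  "dist_torus p q = Inf {dist x y | x y. to_torus x = p \<and> to_torus y = q}"

definition uniformity_torus :: "('a torus \<times> 'a torus) filter" where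
  "uniformity_torus = (INF e\<in>{0<..}. principal {(x, y). dist x y < e})"

definition open_torus :: "'a torus set \<Rightarrow> bool" where
  "open_torus U \<longleftrightarrow> (\<forall>x\<in>U. \<forall>\<^sub>F (x', y) in uniformity. x' = x \<longrightarrow> y \<in> U)"

lemma dist_torus_le: "dist (to_torus x) (to_torus y) \<le> dist x y"
  unfolding dist_torus_def by (rule cInf_lower) (auto intro!: bdd_belowI[of _ 0])

lemma dist_torus_lessD:
  assumes "dist (to_torus x) q < e"
  shows "\<exists>y. to_torus y = q \<and> dist x y < e"
proof -
  have "{dist x' y | x' y. to_torus x' = to_torus x \<and> to_torus y = q} \<noteq> {}"
    using to_torus_surj by blast
  from cInf_lessD[OF this assms[unfolded dist_torus_def]] obtain x' y
    where xy: "to_torus x' = to_torus x" "to_torus y = q" "dist x' y < e"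
    by blast
  have "to_torus (y + (x - x')) = q" using to_torus_shift[OF xy(1)] xy(2) by simp
  moreover have "dist x (y + (x - x')) = dist x' y"
    by (simp add: dist_norm algebra_simps)
  ultimately show ?thesis using xy(3) by auto
qed

instance
proof
  show "uniformity = (INF e\<in>{0<..}. principal {(x::'a torus, y). dist x y < e})"
    by (rule uniformity_torus_def)
  show "open U \<longleftrightarrow> (\<forall>x\<in>U. \<forall>\<^sub>F (x', y) in uniformity. x' = x \<longrightarrow> y \<in> U)"
    for U :: "'a torus set" by (rule open_torus_def)
  have nonneg: "0 \<le> dist p q" for p q :: "'a torus"
  proof -
    obtain x y where "to_torus x = p" "to_torus y = q" using to_torus_surj by metis
    then have "{dist x y | x y. to_torus x = p \<and> to_torus y = q} \<noteq> {}" by blast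
    then show ?thesis unfolding dist_torus_def by (rule cInf_greatest) auto
  qed
  have sym: "dist p q = dist q p" for p q :: "'a torus"
    unfolding dist_torus_def
    by (rule arg_cong[where f=Inf], rule Collect_cong) (use dist_commute in blast)
  show "dist p q = 0 \<longleftrightarrow> p = q" for p q :: "'a torus"
  proof
    assume "p = q"
    obtain x where "to_torus x = p" using to_torus_surj by blast
    then show "dist p q = 0"
      using dist_torus_le[of x x] nonneg[of p q] \<open>p = q\<close> by simp
  next
    assume 0: "dist p q = 0"
    obtain x y where x: "to_torus x = p" and y: "to_torus y = q" using to_torus_surj by blast
    have "x $ i - y $ i \<in> \<int>" for i
    proof -
      have "x $ i - y $ i \<in> closure \<int>"
        unfolding closure_approachable
      proof (intro allI impI)
        fix e :: real assume "e > 0"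
        then obtain z where z: "to_torus z = q" "dist x z < e"
          using dist_torus_lessD[of x q e] 0 x by auto
        have "z $ i - y $ i \<in> \<int>" using z(1) y to_torus_eq_iff by metis
        moreover have "dist (z $ i - y $ i) (x $ i - y $ i) < e"
          using dist_vec_nth_le[of x i z] z(2) by (simp add: dist_real_def)
        ultimately show "\<exists>w\<in>\<int>. dist w (x $ i - y $ i) < e" by blast
      qed
      then show ?thesis by (simp add: closure_closed)
    qed
    then show "p = q" using x y to_torus_eq_iff by metis
  qed
  show "dist p q \<le> dist p r + dist q r" for p q r :: "'a torus"
  proof (rule field_le_epsilon)
    fix e :: real assume e: "e > 0"
    obtain z where z: "to_torus z = r" using to_torus_surj by blast
    obtain x where x: "to_torus x = p" "dist z x < dist p r + e/2"
      using dist_torus_lessD[of z p "dist p r + e/2"] z e sym[of r p] by auto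
    obtain y where y: "to_torus y = q" "dist z y < dist q r + e/2"
      using dist_torus_lessD[of z q "dist q r + e/2"] z e sym[of r q] by auto
    have "dist p q \<le> dist x y" using dist_torus_le x y by metis
    also have "\<dots> \<le> dist z x + dist z y" by (metis dist_commute dist_triangle)
    finally show "dist p q \<le> dist p r + dist q r + e" using x y by simp
  qed
qed

end

lemma to_torus_ball: "to_torus ` ball x e = ball (to_torus x) e"
proof
  show "to_torus ` ball x e \<subseteq> ball (to_torus x) e"
    by (auto intro: le_less_trans[OF dist_torus_le])
  show "ball (to_torus x) e \<subseteq> to_torus ` ball x e"
    using dist_torus_lessD by fastforce
qed

lemma continuous_to_torus: "continuous_on S to_torus"
  unfolding continuous_on_iff by (auto intro: le_less_trans[OF dist_torus_le])

lemma open_to_torus: "open S \<Longrightarrow> open (to_torus ` S)"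
  unfolding open_contains_ball
proof clarify
  fix x assume "\<forall>x\<in>S. \<exists>e>0. ball x e \<subseteq> S" "x \<in> S"
  then obtain e where "e > 0" "ball x e \<subseteq> S" by blast
  then show "\<exists>e>0. ball (to_torus x) e \<subseteq> to_torus ` S"
    by (metis to_torus_ball image_mono)
qed

instance torus :: (finite) second_countable_topology
proof
  obtain B :: "(real^'a) set set" where B: "countable B" "topological_basis B"
    using ex_countable_basis by blast
  have "topological_basis ((`) to_torus ` B)"
  proof (rule topological_basisI)
    show "open U" if "U \<in> (`) to_torus ` B" for U
      using that open_to_torus topological_basis_open[OF B(2)] by blast
  next
    fix O' :: "'a torus set" and p assume O: "open O'" "p \<in> O'"
    obtain x where x: "to_torus x = p" using to_torus_surj by blast
    have "open (to_torus -` O')"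
      using O(1) continuous_to_torus by (rule open_vimage)
    then obtain V where "V \<in> B" "x \<in> V" "V \<subseteq> to_torus -` O'"
      using topological_basisE[OF B(2), of "to_torus -` O'" x] x O(2) by blast
    then have "to_torus ` V \<in> (`) to_torus ` B" "p \<in> to_torus ` V" "to_torus ` V \<subseteq> O'"
      using x by auto
    then show "\<exists>U\<in>(`) to_torus ` B. p \<in> U \<and> U \<subseteq> O'"
      by (intro bexI conjI)
  qed
  then show "\<exists>B::'a torus set set. countable B \<and> open = generate_topology B"
    using countable_image[OF B(1)] topological_basis_imp_subbasis by (intro exI conjI)
qed

definition lebesgue_torus :: "('n::finite) torus measure" where
  "lebesgue_torus =
     distr (restrict_space lborel {x. \<forall>i. 0 \<le> x $ i \<and> x $ i < 1}) borel to_torus"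

lemma sets_lebesgue_torus [simp, measurable_cong]: "sets lebesgue_torus = sets borel"
  by (simp add: lebesgue_torus_def)

lemma space_lebesgue_torus [simp]: "space lebesgue_torus = UNIV"
  by (simp add: lebesgue_torus_def)


section \<open>Differential calculus on the torus\<close>

definition C2_on :: "(real ^ 'n) set \<Rightarrow> (real ^ 'n \<Rightarrow> real ^ 'm) \<Rightarrow> bool" where
  "C2_on S G \<longleftrightarrow>
     (\<exists>(G' :: real ^ 'n \<Rightarrow> (real ^ 'n) \<Rightarrow>\<^sub>L (real ^ 'm))
       (G'' :: real ^ 'n \<Rightarrow> (real ^ 'n) \<Rightarrow>\<^sub>L (real ^ 'n) \<Rightarrow>\<^sub>L (real ^ 'm)).
        (\<forall>x\<in>S. (G has_derivative blinfun_apply (G' x)) (at x)) \<and>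
        (\<forall>x\<in>S. (G' has_derivative blinfun_apply (G'' x)) (at x)) \<and>
        continuous_on S G'')"

text \<open>The local inverses of \<^const>\<open>to_torus\<close> are the charts of the torus, so a representative
  of \<open>g\<close> in charts around \<open>to_torus x\<close> is a map \<open>G\<close> with \<open>to_torus \<circ> G = g \<circ> to_torus\<close>
  near \<open>x\<close>. The set \<open>S\<close> below is meant to be open.\<close>

definition torus_C2_on :: "('n::finite) torus set \<Rightarrow> ('n torus \<Rightarrow> ('m::finite) torus) \<Rightarrow> bool" where
  "torus_C2_on S g \<longleftrightarrow>
     (\<forall>x. to_torus x \<in> S \<longrightarrow>
        (\<exists>N G. open N \<and> x \<in> N \<and> C2_on N G \<and> (\<forall>y\<in>N. g (to_torus y) = to_torus (G y))))"

definition torus_C2_local_diffeo :: "(('n::finite) torus \<Rightarrow> ('m::finite) torus) \<Rightarrow> bool" where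
  "torus_C2_local_diffeo g \<longleftrightarrow>
     (\<forall>\<omega>. \<exists>U V h. open U \<and> \<omega> \<in> U \<and> open V \<and> homeomorphism U V g h \<and>
        torus_C2_on U g \<and> torus_C2_on V h)"

definition has_torus_derivative ::
    "(('n::finite) torus \<Rightarrow> ('m::finite) torus) \<Rightarrow> (real ^ 'n \<Rightarrow> real ^ 'm) \<Rightarrow> 'n torus \<Rightarrow> bool" where
  "has_torus_derivative g A \<omega> \<longleftrightarrow>
     (\<exists>x G. to_torus x = \<omega> \<and> (\<forall>\<^sub>F y in nhds x. g (to_torus y) = to_torus (G y)) \<and>
        (G has_derivative A) (at x))"

definition torus_derivative ::
    "(('n::finite) torus \<Rightarrow> ('m::finite) torus) \<Rightarrow> 'n torus \<Rightarrow> real ^ 'n \<Rightarrow> real ^ 'm" where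
  "torus_derivative g \<omega> = (THE A. has_torus_derivative g A \<omega>)"

definition torus_jacobian :: "(('n::finite) torus \<Rightarrow> 'n torus) \<Rightarrow> 'n torus \<Rightarrow> real" where
  "torus_jacobian g \<omega> = \<bar>det (matrix (torus_derivative g \<omega>))\<bar>"

text \<open>Two representatives near the same point differ by an integer vector that is locally constant,
  so the differential is well defined.\<close>

lemma has_torus_derivative_unique:
  assumes "has_torus_derivative g A \<omega>" "has_torus_derivative g B \<omega>"
  shows "A = B"
proof -
  obtain x G where x: "to_torus x = \<omega>" "\<forall>\<^sub>F y in nhds x. g (to_torus y) = to_torus (G y)"
    "(G has_derivative A) (at x)" using assms(1) unfolding has_torus_derivative_def by blast
  obtain x' G' where x': "to_torus x' = \<omega>" "\<forall>\<^sub>F y in nhds x'. g (to_torus y) = to_torus (G' y)"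
    "(G' has_derivative B) (at x')" using assms(2) unfolding has_torus_derivative_def by blast
  define H where "H y = G' (y + (x' - x))" for y
  have H': "(H has_derivative B) (at x)"
  proof -
    have "((\<lambda>y. y + (x' - x)) has_derivative (\<lambda>h. h)) (at x)"
      by (auto intro!: derivative_eq_intros)
    moreover have "(G' has_derivative B) (at (x + (x' - x)))" using x'(3) by simp
    ultimately have "((\<lambda>y. G' (y + (x' - x))) has_derivative (\<lambda>h. B h)) (at x)"
      by (rule has_derivative_compose)
    then show ?thesis by (simp add: H_def[abs_def])
  qed
  have "filterlim (\<lambda>y. y + (x' - x)) (nhds x') (nhds x)"
  proof -
    have "((\<lambda>y. y + (x' - x)) \<longlongrightarrow> x + (x' - x)) (nhds x)"
      by (intro tendsto_intros filterlim_ident)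
    then show ?thesis by simp
  qed
  from eventually_compose_filterlim[OF x'(2) this]
  have H: "\<forall>\<^sub>F y in nhds x. g (to_torus y) = to_torus (H y)"
    by (rule eventually_mono) (use to_torus_shift[of x x'] x(1) x'(1) in \<open>simp add: H_def\<close>)
  define E where "E y = G y - H y" for y
  have E: "(E has_derivative (\<lambda>h. A h - B h)) (at x)"
    unfolding E_def[abs_def] by (intro has_derivative_diff x(3) H')
  have int: "\<forall>\<^sub>F y in nhds x. \<forall>i. E y $ i \<in> \<int>"
    using x(2) H by eventually_elim (simp add: E_def flip: to_torus_eq_iff)
  have "isCont E x" using E has_derivative_continuous by blast
  then have lim: "(E \<longlongrightarrow> E x) (nhds x)" by (simp add: continuous_at tendsto_at_iff_tendsto_nhds)
  have near: "\<forall>\<^sub>F y in nhds x. dist (E y) (E x) < 1" using tendstoD[OF lim] by simp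
  have "\<forall>\<^sub>F y in nhds x. E y = E x"
    using int near
  proof eventually_elim
    case (elim y)
    have ix: "\<forall>i. E x $ i \<in> \<int>" using int by (rule eventually_nhds_x_imp_x)
    show ?case
    proof (rule vec_eq_iff[THEN iffD2], rule allI)
      fix i
      have "\<bar>E y $ i - E x $ i\<bar> < 1"
        using dist_vec_nth_le[of "E y" i "E x"] elim(2) by (simp add: dist_real_def)
      moreover have "E y $ i - E x $ i \<in> \<int>" using elim(1) ix by auto
      ultimately show "E y $ i = E x $ i"
        using Ints_nonzero_abs_less1 by fastforce
    qed
  qed
  then have "(E has_derivative (\<lambda>h. 0)) (at x)"
  proof -
    have "\<forall>\<^sub>F y in at x. E x = E y"
      using \<open>\<forall>\<^sub>F y in nhds x. E y = E x\<close>
      by (auto simp: eventually_at_filter elim: eventually_mono)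
    with has_derivative_const show ?thesis
      by (rule has_derivative_transform_eventually) auto
  qed
  then have "(\<lambda>h. A h - B h) = (\<lambda>h. 0)" using E has_derivative_unique by blast
  then show ?thesis by (simp add: fun_eq_iff)
qed

lemma torus_derivativeI: "has_torus_derivative g A \<omega> \<Longrightarrow> torus_derivative g \<omega> = A"
  unfolding torus_derivative_def using has_torus_derivative_unique by blast


section \<open>Skew products\<close>

definition expanding_base :: "real \<Rightarrow> real \<Rightarrow> (('n::finite) torus \<Rightarrow> 'n torus) \<Rightarrow> bool" where
  "expanding_base \<sigma> D g \<longleftrightarrow>
     torus_C2_local_diffeo g \<and>
     1 < \<sigma> \<and> (\<forall>\<omega> v. norm (torus_derivative g \<omega> v) \<ge> \<sigma> * norm v) \<and>
     (\<exists>(d::nat) I.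
        (\<Union>i<d. I i) = UNIV \<and> disjoint_family_on I {..<d} \<and>
        (\<forall>i<d.
           (AE \<omega> in lebesgue_torus. \<omega> \<in> I i \<longleftrightarrow> \<omega> \<in> interior (I i)) \<and>
           bij_betw g (I i) UNIV \<and> torus_C2_on (interior (I i)) g \<and>
           (\<forall>\<omega>\<^sub>1 \<omega>\<^sub>2. torus_jacobian g (inv_into (I i) g \<omega>\<^sub>1) / torus_jacobian g (inv_into (I i) g \<omega>\<^sub>2)
              \<le> exp (D * dist \<omega>\<^sub>1 \<omega>\<^sub>2))))"

definition acip_density :: "(('n::finite) torus \<Rightarrow> 'n torus) \<Rightarrow> ('n torus \<Rightarrow> real) \<Rightarrow> bool" where
  "acip_density g \<rho> \<longleftrightarrow>
     \<rho> \<in> borel_measurable borel \<and> (\<forall>\<omega>. 0 \<le> \<rho> \<omega>) \<and>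
     prob_space (density lebesgue_torus (\<lambda>\<omega>. ennreal (\<rho> \<omega>))) \<and>
     distr (density lebesgue_torus (\<lambda>\<omega>. ennreal (\<rho> \<omega>))) borel g =
       density lebesgue_torus (\<lambda>\<omega>. ennreal (\<rho> \<omega>))"

definition lipschitz_map :: "('a::metric_space \<Rightarrow> 'b::metric_space) \<Rightarrow> bool" where
  "lipschitz_map f \<longleftrightarrow> (\<exists>B. B-lipschitz_on UNIV f)"

definition lipschitz_const :: "('a::metric_space \<Rightarrow> 'b::metric_space) \<Rightarrow> real" where
  "lipschitz_const f = (SUP (p, q) \<in> {(p, q). p \<noteq> q}. dist (f p) (f q) / dist p q)"

definition borel_probs :: "('a::topological_space) measure set" where
  "borel_probs = {\<mu>. prob_space \<mu> \<and> sets \<mu> = sets borel}"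

definition tv_dist :: "('a::topological_space) measure \<Rightarrow> 'a measure \<Rightarrow> real" where
  "tv_dist \<mu> \<nu> = (SUP A \<in> sets borel. \<bar>measure \<mu> A - measure \<nu> A\<bar>)"

definition random_op ::
    "(('n::finite) torus \<Rightarrow> real) \<Rightarrow> ('n torus \<times> ('m::finite) torus \<Rightarrow> 'm torus)
      \<Rightarrow> 'm torus measure \<Rightarrow> 'm torus measure" where
  "random_op \<rho> f \<mu> =
     Giry_Monad.bind (density lebesgue_torus (\<lambda>\<omega>. ennreal (\<rho> \<omega>))) (\<lambda>\<omega>. distr \<mu> borel (\<lambda>x. f (\<omega>, x)))"

lemma emeasure_random_op:
  fixes f :: "('n::finite) torus \<times> ('m::finite) torus \<Rightarrow> 'm torus"
  assumes f: "continuous_on UNIV f" and \<rho>: "\<rho> \<in> borel_measurable borel"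
    and \<mu>: "\<mu> \<in> borel_probs" and A: "A \<in> sets borel"
  shows "emeasure (random_op \<rho> f \<mu>) A =
    (\<integral>\<^sup>+\<omega>. ennreal (\<rho> \<omega>) * emeasure \<mu> ((\<lambda>x. f (\<omega>, x)) -` A) \<partial>lebesgue_torus)"
proof -
  have [measurable_cong]: "sets \<mu> = sets borel" and "prob_space \<mu>"
    using \<mu> by (auto simp: borel_probs_def)
  have space: "space \<mu> = UNIV" using sets_eq_imp_space_eq[OF \<open>sets \<mu> = sets borel\<close>] by simp
  note [measurable] = \<rho> A
  let ?N = "density lebesgue_torus (\<lambda>\<omega>. ennreal (\<rho> \<omega>))"
  have fm [measurable]: "f \<in> borel \<Otimes>\<^sub>M borel \<rightarrow>\<^sub>M borel"
    using borel_measurable_continuous_onI[OF f] by (simp add: borel_prod)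
  have \<mu>': "\<mu> \<in> space (subprob_algebra borel)"
    using \<open>prob_space \<mu>\<close> \<open>sets \<mu> = sets borel\<close>
    by (simp add: space_subprob_algebra prob_space_imp_subprob_space)
  have K: "(\<lambda>\<omega>. distr \<mu> borel (\<lambda>x. f (\<omega>, x))) \<in> borel \<rightarrow>\<^sub>M subprob_algebra borel"
    by (rule measurable_distr2[where M=borel]) (use fm \<mu>' in \<open>auto simp: case_prod_eta\<close>)
  then have K': "(\<lambda>\<omega>. distr \<mu> borel (\<lambda>x. f (\<omega>, x))) \<in> ?N \<rightarrow>\<^sub>M subprob_algebra borel"
    by (simp cong: measurable_cong_sets)
  have Km: "(\<lambda>\<omega>. emeasure (distr \<mu> borel (\<lambda>x. f (\<omega>, x))) A) \<in> borel_measurable lebesgue_torus"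
    using measurable_compose[OF K measurable_emeasure_subprob_algebra[OF A]]
    by (simp cong: measurable_cong_sets)
  have "emeasure (random_op \<rho> f \<mu>) A = (\<integral>\<^sup>+\<omega>. emeasure (distr \<mu> borel (\<lambda>x. f (\<omega>, x))) A \<partial>?N)"
    unfolding random_op_def by (rule emeasure_bind[OF _ K' A]) simp
  also have "\<dots> = (\<integral>\<^sup>+\<omega>. ennreal (\<rho> \<omega>) * emeasure (distr \<mu> borel (\<lambda>x. f (\<omega>, x))) A \<partial>lebesgue_torus)"
    by (rule nn_integral_density) (use Km in auto)
  also have "\<dots> = (\<integral>\<^sup>+\<omega>. ennreal (\<rho> \<omega>) * emeasure \<mu> ((\<lambda>x. f (\<omega>, x)) -` A) \<partial>lebesgue_torus)"
    by (intro nn_integral_cong arg_cong2[where f="(*)"] refl, subst emeasure_distr) (auto simp: space)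
  finally show ?thesis .
qed

text \<open>Including \<open>n = 0\<close> would only exclude the constants \<open>C < 1\<close>.\<close>

definition geometrically_ergodic ::
    "real \<Rightarrow> real \<Rightarrow> (('n::finite) torus \<Rightarrow> real) \<Rightarrow> ('n torus \<times> ('m::finite) torus \<Rightarrow> 'm torus) \<Rightarrow> bool" where
  "geometrically_ergodic C lam \<rho> f \<longleftrightarrow>
     (\<forall>\<mu>\<in>borel_probs. \<forall>\<nu>\<in>borel_probs. \<forall>n\<ge>1.
        tv_dist ((random_op \<rho> f ^^ n) \<mu>) ((random_op \<rho> f ^^ n) \<nu>) \<le> C * lam ^ n * tv_dist \<mu> \<nu>)"

definition skew_product :: "('a \<Rightarrow> 'a) \<Rightarrow> ('a \<times> 'b \<Rightarrow> 'b) \<Rightarrow> 'a \<times> 'b \<Rightarrow> 'a \<times> 'b" where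
  "skew_product g f = (\<lambda>(\<omega>, x). (g \<omega>, f (\<omega>, x)))"

end

theory Submission
  imports Defs
begin

text \<open>
  Let the skew product \<open>F\<close> start from Lebesgue measure on the base times a point mass in the fiber. Disintegrated
  over the base, the image under \<open>F\<^sup>k\<close> is a sum over the preimages of the base point under \<open>g\<^sup>k\<close>. By expansion,
  distortion and the Lipschitz bound on \<open>f\<close>, its logarithm, tested against log-Lipschitz functions of the fiber
  coordinate, is a Lipschitz function of the base point with a constant that does not depend on \<open>k\<close>.
  Hence smearing the base coordinate over a scale \<open>r\<close> before each application of \<open>F\<close> changes the integral of an
  observable by little, provided the number \<open>M\<close> of smeared steps is fixed before \<open>r\<close>.

  The smeared dynamics is a Markov chain. If \<open>\<sigma>\<close> is large compared with \<open>1 / r\<close>, the transfer operator of \<open>g\<close> maps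
  the smearing density to a density that dominates \<open>c \<rho>\<close>, where \<open>c > 0\<close> depends only on \<open>D\<close> and the dimension.
  So \<open>N + 1\<close> steps of the chain contain, with weight \<open>c\<^sup>N\<^sup>+\<^sup>1\<close>, \<open>N\<close> steps of the random counterpart, and geometric
  ergodicity makes them contract oscillations by a factor that does not depend on \<open>r\<close> or \<open>\<sigma>\<close>. One fixes first \<open>N\<close>,
  then \<open>M\<close>, then \<open>r\<close>, then \<open>\<sigma>\<^sub>0\<close>. The limit law \<open>\<eta>\<close> is the law of the fiber coordinate after \<open>M\<close> steps of \<open>F\<close>; it need
  not be close to a stationary measure of the random counterpart, because the chain that drives the fiber is not i.i.d.
\<close>

section \<open>The torus and its Lebesgue measure\<close>

text \<open>The number of branches of \<open>g\<close> is not bounded in terms of the given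
  constants, and (D) controls only ratios of Jacobians. Regularity is therefore measured
  multiplicatively, by \<open>loglip\<close>: such bounds compare sums over preimages term by term,
  however many terms there are. The transfer operator turns a constant \<open>A\<close> into
  \<open>D + A / \<sigma>\<close>, so for \<open>\<sigma> \<ge> 2\<close> everything settles near
  \<open>2 * D\<close>; this is the origin of \<open>2 * D\<close>, \<open>3 * D\<close> and
  \<open>5 * D\<close>. The smear alters only the base point that is fed to \<open>g\<close>, while
  the fiber still moves by the unsmeared point. Observables along the chain are controlled in the
  fiber variable only, and this choice lets their base variable be frozen when the two dynamics are
  compared. Each smeared step multiplies the fiber constant by \<open>L\<close>, which may exceed 1,
  and adds an error that does not decay with \<open>n\<close>. Hence \<open>M\<close> precedes
  \<open>r\<close>, and \<epsilon> survives in the conclusion. The exponential term covers only the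
  finitely many times before \<open>M\<close>; the contraction rate is spent on the choice of
  \<open>M\<close>.\<close>

lemma to_torus_cube_surj: "\<exists>x. to_torus x = p \<and> (\<forall>i. 0 \<le> x $ i \<and> x $ i < 1)"
proof -
  obtain y where y: "to_torus y = p" using to_torus_surj by blast
  define x where "x = (\<chi> i. frac (y $ i))"
  have "to_torus x = to_torus y"
    unfolding to_torus_eq_iff x_def by (auto simp: frac_def)
  then show ?thesis using y by (intro exI[of _ x]) (auto simp: x_def frac_lt_1)
qed

text \<open>Crude, since only a bound independent of \<open>g\<close> matters: it turns a
  log-Lipschitz constant into a bound on ratios over the whole torus, and is the origin of the
  factors \<open>CARD('n)\<close> in the exponents.\<close>

lemma dist_torus_le_card:
  fixes p q :: "('n::finite) torus"
  shows "dist p q \<le> real CARD('n)"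
proof -
  obtain x where x: "to_torus x = p" "\<And>i. 0 \<le> x $ i \<and> x $ i < 1" using to_torus_cube_surj by blast
  obtain y where y: "to_torus y = q" "\<And>i. 0 \<le> y $ i \<and> y $ i < 1" using to_torus_cube_surj by blast
  have "dist p q \<le> dist x y" using dist_torus_le x y by metis
  also have "\<dots> \<le> (\<Sum>i\<in>UNIV. \<bar>(x - y) $ i\<bar>)" unfolding dist_norm by (rule norm_le_l1_cart)
  also have "\<dots> \<le> (\<Sum>i\<in>(UNIV::'n set). 1)"
    by (rule sum_mono) (use x(2) y(2) in \<open>smt (verit) vector_minus_component\<close>)
  finally show ?thesis by simp
qed

lemma compact_torus_UNIV: "compact (UNIV :: ('n::finite) torus set)"
proof -
  have "UNIV = to_torus ` cbox (0::real^'n) 1"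
  proof (rule set_eqI, rule iffI[OF _ UNIV_I])
    fix p :: "'n torus"
    obtain x where "to_torus x = p" "\<forall>i. 0 \<le> x $ i \<and> x $ i < 1" using to_torus_cube_surj by blast
    then show "p \<in> to_torus ` cbox 0 1"
      by (intro image_eqI[of _ _ x]) (auto simp: mem_box_cart less_eq_real_def)
  qed
  then show ?thesis
    by (metis compact_continuous_image[OF continuous_to_torus compact_cbox])
qed

lemma to_torus_eq_small:
  assumes "to_torus x = to_torus y" "dist x y < 1"
  shows "x = y"
proof (rule vec_eq_iff[THEN iffD2], rule allI)
  fix i
  have "\<bar>x $ i - y $ i\<bar> < 1"
    using dist_vec_nth_le[of x i y] assms(2) by (simp add: dist_real_def)
  moreover have "x $ i - y $ i \<in> \<int>" using assms(1) to_torus_eq_iff by blast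
  ultimately show "x $ i = y $ i" using Ints_nonzero_abs_less1 by fastforce
qed

lemma inj_on_to_torus_ball: "e \<le> 1/2 \<Longrightarrow> inj_on to_torus (ball x e)"
  by (intro inj_onI to_torus_eq_small)
     (auto intro: le_less_trans[OF dist_triangle2[of _ _ x]] simp: dist_commute)

text \<open>A lift of the second point that is closer to \<open>x\<close> than \<open>y\<close>
  would lie at distance below 1 from \<open>y\<close>, and two lifts of one point that close
  coincide. This is why chart radii are kept at 1/4.\<close>

lemma dist_to_torus_eq:
  assumes "dist x y < 1/2"
  shows "dist (to_torus x) (to_torus y) = dist x y"
proof (rule antisym[OF dist_torus_le field_le_epsilon])
  fix e :: real assume e: "e > 0"
  define e' where "e' = min e (1/2 - dist x y)"
  have e': "e' > 0" "e' \<le> e" "dist x y + e' \<le> 1/2" using e assms unfolding e'_def by linarith+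
  then obtain z where z: "to_torus z = to_torus y" "dist x z < dist (to_torus x) (to_torus y) + e'"
    using dist_torus_lessD[of x "to_torus y" "dist (to_torus x) (to_torus y) + e'"] by auto
  have "dist z y < 1"
    using z(2) e'(3) dist_torus_le[of x y] assms dist_triangle3[of z y x] by linarith
  then have "z = y" using to_torus_eq_small z by blast
  then show "dist x y \<le> dist (to_torus x) (to_torus y) + e" using z e' by simp
qed

lemma measurable_to_torus [measurable]: "to_torus \<in> borel_measurable borel"
  using continuous_to_torus borel_measurable_continuous_onI by blast

lemma unit_cube_borel [measurable]: "{x::real^'n. \<forall>i. 0 \<le> x $ i \<and> x $ i < 1} \<in> sets borel"
  by measurable

lemma nn_integral_lebesgue_torus:
  assumes [measurable]: "w \<in> borel_measurable borel"
  shows "(\<integral>\<^sup>+\<omega>. w \<omega> \<partial>(lebesgue_torus :: ('n::finite) torus measure)) =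
    (\<integral>\<^sup>+x. w (to_torus x) * indicator {x. \<forall>i. 0 \<le> x $ i \<and> x $ i < 1} x \<partial>lborel)"
proof -
  have "(\<integral>\<^sup>+\<omega>. w \<omega> \<partial>(lebesgue_torus :: ('n::finite) torus measure)) =
    (\<integral>\<^sup>+x. w (to_torus x) \<partial>restrict_space lborel {x. \<forall>i. 0 \<le> x $ i \<and> x $ i < 1})"
    unfolding lebesgue_torus_def
    by (rule nn_integral_distr) (auto intro!: measurable_restrict_space1)
  also have "\<dots> = (\<integral>\<^sup>+x. w (to_torus x) * indicator {x. \<forall>i. 0 \<le> x $ i \<and> x $ i < 1} x \<partial>lborel)"
    by (rule nn_integral_restrict_space) auto
  finally show ?thesis .
qed

lemma prob_space_lebesgue_torus: "prob_space (lebesgue_torus :: ('n::finite) torus measure)"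
proof
  let ?C = "{x::real^'n. \<forall>i. 0 \<le> x $ i \<and> x $ i < 1}"
  have bx: "box 0 1 \<subseteq> ?C" "?C \<subseteq> cbox 0 1" by (auto simp: mem_box_cart less_eq_real_def)
  have 1: "emeasure lborel (cbox 0 (1::real^'n)) = 1"
    by (subst emeasure_lborel_cbox)
       (auto simp: Basis_vec_def inner_axis intro!: prod.neutral)
  have 2: "emeasure lborel (box 0 (1::real^'n)) = 1"
    by (subst emeasure_lborel_box)
       (auto simp: Basis_vec_def inner_axis intro!: prod.neutral)
  have "emeasure lborel ?C = 1"
    by (rule antisym) (use emeasure_mono[OF bx(1), of lborel] emeasure_mono[OF bx(2), of lborel] 1 2 in auto)
  then show "emeasure (lebesgue_torus :: 'n torus measure) (space lebesgue_torus) = 1"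
    using nn_integral_lebesgue_torus[of "\<lambda>_::'n torus. 1"] by simp
qed

interpretation leb_torus: prob_space "lebesgue_torus :: ('n::finite) torus measure"
  by (rule prob_space_lebesgue_torus)

lemma open_torus_emeasure_pos:
  fixes U :: "('n::finite) torus set"
  assumes "open U" "U \<noteq> {}"
  shows "emeasure lebesgue_torus U > 0"
proof -
  note [measurable] = borel_open[OF assms(1)]
  obtain p where p: "p \<in> U" using assms by blast
  obtain x where x: "to_torus x = p" "\<And>i. 0 \<le> x $ i \<and> x $ i < 1" using to_torus_cube_surj by blast
  let ?V = "to_torus -` U \<inter> box 0 (1::real^'n)"
  have o: "open (to_torus -` U)" using assms(1) continuous_to_torus by (rule open_vimage)
  \<comment> \<open>The representative may lie on a face of the half-open cube, so a point of the
    open cube has to be found near it.\<close>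
  have "x \<in> closure (box 0 (1::real^'n))"
  proof -
    have "box 0 (1::real^'n) \<noteq> {}" by (auto simp: interval_ne_empty_cart)
    then have "closure (box 0 (1::real^'n)) = cbox 0 1" by (rule closure_box)
    then show ?thesis using x(2) by (auto simp: mem_box_cart intro: less_imp_le)
  qed
  then have "?V \<noteq> {}" using o x(1) p by (auto simp: closure_iff_nhds_not_empty)
  moreover have "open ?V" using o by auto
  ultimately have "?V \<notin> null_sets lborel" using open_not_negligible
    by (metis negligible_iff_null_sets null_sets_completionI)
  then have "0 < emeasure lborel ?V" using \<open>open ?V\<close>
    by (auto simp: null_sets_def zero_less_iff_neq_zero)
  also have "\<dots> = (\<integral>\<^sup>+x. indicator ?V x \<partial>lborel)"
    using \<open>open ?V\<close> by simp
  also have "\<dots> \<le> (\<integral>\<^sup>+x. indicator U (to_torus x) * indicator {x. \<forall>i. 0 \<le> x $ i \<and> x $ i < 1} x \<partial>lborel)"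
    by (intro nn_integral_mono) (auto simp: indicator_def mem_box_cart less_imp_le)
  also have "\<dots> = emeasure lebesgue_torus U"
    by (subst nn_integral_lebesgue_torus[symmetric]) auto
  finally show ?thesis .
qed

lemma AE_torus_imp_dense:
  fixes U :: "('n::finite) torus set"
  assumes "AE \<omega> in lebesgue_torus. \<omega> \<in> S" "open U" "U \<noteq> {}"
  shows "U \<inter> S \<noteq> {}"
proof
  assume "U \<inter> S = {}"
  then have "AE \<omega> in lebesgue_torus. \<omega> \<notin> U" using assms(1) by (auto elim!: eventually_mono)
  then have "emeasure lebesgue_torus U = 0"
    using assms(2) by (subst (asm) AE_iff_measurable[OF _ refl]) auto
  then show False using open_torus_emeasure_pos[OF assms(2,3)] by simp
qed

text \<open>The chart domain \<open>S\<close> may straddle several unit cells. Summing over the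
  lattice \<open>Z\<close> of integer vectors cuts it into cells, Tonelli and translation invariance
  move the pieces back to the unit cube, and injectivity on \<open>S\<close> says that no point of
  the cube is hit twice.\<close>

lemma nn_integral_torus_inj:
  fixes S :: "(real^'n::finite) set" and w :: "'n torus \<Rightarrow> ennreal"
  assumes S [measurable]: "S \<in> sets borel" and inj: "inj_on to_torus S"
    and T [measurable]: "to_torus ` S \<in> sets borel"
    and w [measurable]: "w \<in> borel_measurable borel"
  shows "(\<integral>\<^sup>+\<omega>. w \<omega> * indicator (to_torus ` S) \<omega> \<partial>lebesgue_torus) =
    (\<integral>\<^sup>+x. w (to_torus x) * indicator S x \<partial>lborel)"
proof -
  let ?C = "{x::real^'n. \<forall>i. 0 \<le> x $ i \<and> x $ i < 1}"
  define Z where "Z = {k::real^'n. \<forall>i. k $ i \<in> \<int>}"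
  have "countable Z"
  proof -
    have "Z \<subseteq> range (\<lambda>h::'n \<Rightarrow> int. \<chi> i. of_int (h i))"
    proof
      fix k assume "k \<in> Z"
      then have "k = (\<chi> i. of_int \<lfloor>k $ i\<rfloor>)" by (auto simp: Z_def vec_eq_iff of_int_floor_cancel[symmetric])
      then show "k \<in> range (\<lambda>h::'n \<Rightarrow> int. \<chi> i. of_int (h i))"
        by (rule range_eqI[of _ _ "\<lambda>i. \<lfloor>k $ i\<rfloor>"])
    qed
    then show ?thesis by (rule countable_subset) simp
  qed
  have shift: "to_torus (x + k) = to_torus x" if "k \<in> Z" for x k
    using that by (simp add: to_torus_eq_iff Z_def)
  have one: "\<exists>!k. k \<in> Z \<and> x - k \<in> ?C" for x :: "real^'n"
  proof (rule ex1I[of _ "\<chi> i. of_int \<lfloor>x $ i\<rfloor>"])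
    show "(\<chi> i. of_int \<lfloor>x $ i\<rfloor>) \<in> Z \<and> x - (\<chi> i. of_int \<lfloor>x $ i\<rfloor>) \<in> ?C"
      by (auto simp: Z_def) linarith
    show "k = (\<chi> i. of_int \<lfloor>x $ i\<rfloor>)" if "k \<in> Z \<and> x - k \<in> ?C" for k
    proof (rule vec_eq_iff[THEN iffD2], rule allI)
      fix i
      have "k $ i \<in> \<int>" "0 \<le> x $ i - k $ i" "x $ i - k $ i < 1" using that by (auto simp: Z_def)
      then have "\<lfloor>x $ i\<rfloor> = \<lfloor>k $ i\<rfloor>" by (auto elim!: Ints_cases) linarith
      then show "k $ i = (\<chi> i. of_int \<lfloor>x $ i\<rfloor>) $ i" using \<open>k $ i \<in> \<int>\<close> by (simp add: of_int_floor_cancel)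
    qed
  qed
  have single: "(\<integral>\<^sup>+k. indicator A k \<partial>count_space Z) = 1" if ex: "\<exists>!k. k \<in> Z \<and> k \<in> A" for A :: "(real^'n) set"
  proof -
    from ex obtain k where k: "k \<in> Z \<and> k \<in> A" and u: "\<forall>l. l \<in> Z \<and> l \<in> A \<longrightarrow> l = k" by (rule ex1E)
    have "(\<integral>\<^sup>+k. indicator A k \<partial>count_space Z) = (\<integral>\<^sup>+l. indicator {k} l \<partial>count_space Z)"
    proof (rule nn_integral_cong)
      fix l assume "l \<in> space (count_space Z)"
      then have "l \<in> A \<longleftrightarrow> l = k" using k u[rule_format, of l] by auto
      then show "indicator A l = (indicator {k} l :: ennreal)" by (simp add: indicator_def)
    qed
    also have "\<dots> = emeasure (count_space Z) {k}" using k by (intro nn_integral_indicator) simp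
    also have "\<dots> = 1" using k by simp
    finally show ?thesis .
  qed
  have sumC: "(\<integral>\<^sup>+k. indicator ?C (x - k) \<partial>count_space Z) = 1" for x
    using single[of "{k. x - k \<in> ?C}"] one[of x] by (simp add: indicator_def)
  have sumS: "(\<integral>\<^sup>+k. indicator S (x + k) \<partial>count_space Z) = indicator (to_torus ` S) (to_torus x)" for x
  proof (cases "to_torus x \<in> to_torus ` S")
    case True
    then obtain y where y: "y \<in> S" "to_torus y = to_torus x" by auto
    have "\<exists>!k. k \<in> Z \<and> x + k \<in> S"
    proof (rule ex1I[of _ "y - x"])
      show "y - x \<in> Z \<and> x + (y - x) \<in> S" using y by (simp add: Z_def to_torus_eq_iff)
      show "k = y - x" if "k \<in> Z \<and> x + k \<in> S" for k
      proof -
        have "x + k = y" using inj_onD[OF inj, of "x + k" y] that y shift by auto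
        then show ?thesis by auto
      qed
    qed
    then show ?thesis using True single[of "{k. x + k \<in> S}"] by (simp add: indicator_def)
  next
    case False
    have "indicator S (x + k) = (0::ennreal)" if "k \<in> Z" for k
      using False shift[OF that, of x] by (auto simp: indicator_def) (metis image_eqI)
    then show ?thesis using False by (simp cong: nn_integral_cong_simp)
  qed
  have "(\<integral>\<^sup>+x. w (to_torus x) * indicator S x \<partial>lborel) =
    (\<integral>\<^sup>+x. (\<integral>\<^sup>+k. w (to_torus x) * indicator S x * indicator ?C (x - k) \<partial>count_space Z) \<partial>lborel)"
    by (subst nn_integral_cmult) (auto simp: sumC)
  also have "\<dots> = (\<integral>\<^sup>+k. (\<integral>\<^sup>+x. w (to_torus x) * indicator S x * indicator ?C (x - k) \<partial>lborel) \<partial>count_space Z)"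
    using \<open>countable Z\<close> by (intro nn_integral_count_space_nn_integral) auto
  also have "\<dots> = (\<integral>\<^sup>+k. (\<integral>\<^sup>+x. w (to_torus x) * indicator S (x + k) * indicator ?C x \<partial>lborel) \<partial>count_space Z)"
  proof (rule nn_integral_cong)
    fix k assume "k \<in> space (count_space Z)"
    then have k: "k \<in> Z" by simp
    have "(\<integral>\<^sup>+x. w (to_torus x) * indicator S x * indicator ?C (x - k) \<partial>lborel) =
      (\<integral>\<^sup>+x. w (to_torus x) * indicator S x * indicator ?C (x - k) \<partial>distr lborel borel ((+) k))"
      by (simp add: lborel_distr_plus)
    also have "\<dots> = (\<integral>\<^sup>+x. w (to_torus (x + k)) * indicator S (x + k) * indicator ?C x \<partial>lborel)"
      by (subst nn_integral_distr) (auto simp: add.commute)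
    finally show "(\<integral>\<^sup>+x. w (to_torus x) * indicator S x * indicator ?C (x - k) \<partial>lborel) =
      (\<integral>\<^sup>+x. w (to_torus x) * indicator S (x + k) * indicator ?C x \<partial>lborel)" using shift[OF k] by simp
  qed
  also have "\<dots> = (\<integral>\<^sup>+x. (\<integral>\<^sup>+k. w (to_torus x) * indicator S (x + k) * indicator ?C x \<partial>count_space Z) \<partial>lborel)"
    using \<open>countable Z\<close> by (intro nn_integral_count_space_nn_integral[symmetric]) auto
  also have "\<dots> = (\<integral>\<^sup>+x. w (to_torus x) * indicator (to_torus ` S) (to_torus x) * indicator ?C x \<partial>lborel)"
    by (subst mult.assoc, subst nn_integral_cmult, simp, subst nn_integral_multc) (auto simp: sumS mult.assoc)
  also have "\<dots> = (\<integral>\<^sup>+\<omega>. w \<omega> * indicator (to_torus ` S) \<omega> \<partial>lebesgue_torus)"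
    by (subst nn_integral_lebesgue_torus) auto
  finally show ?thesis by simp
qed

section \<open>Log-Lipschitz functions\<close>

definition loglip :: "real \<Rightarrow> ('a::metric_space \<Rightarrow> real) \<Rightarrow> bool" where
  "loglip A u \<longleftrightarrow> (\<forall>p. 0 < u p) \<and> (\<forall>p q. u p \<le> exp (A * dist p q) * u q)"

lemma loglip_pos: "loglip A u \<Longrightarrow> 0 < u p"
  by (simp add: loglip_def)

lemma loglipD: "loglip A u \<Longrightarrow> u p \<le> exp (A * dist p q) * u q"
  by (simp add: loglip_def)

lemma loglip_mono:
  assumes "loglip A u" "A \<le> B"
  shows "loglip B u"
  unfolding loglip_def
proof (intro conjI allI)
  fix p q
  show "0 < u p" using assms by (simp add: loglip_def)
  have "u p \<le> exp (A * dist p q) * u q" using assms by (simp add: loglip_def)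
  also have "\<dots> \<le> exp (B * dist p q) * u q"
    using assms by (intro mult_right_mono) (auto simp: loglip_def mult_right_mono less_imp_le)
  finally show "u p \<le> exp (B * dist p q) * u q" .
qed

text \<open>Inverse branches of \<open>g\<close> exist only near a point, so transferred functions
  can at first be compared only locally. Along a lifted segment the local bounds on the logarithm
  add up, by the bisection principle \<open>Bolzano\<close>, and a nearly shortest lift gives the
  torus distance.\<close>

lemma loglip_local_imp_global:
  fixes u :: "('n::finite) torus \<Rightarrow> real"
  assumes pos: "\<And>p. 0 < u p" and A: "0 \<le> A"
    and loc: "\<And>p. \<forall>\<^sub>F q in nhds p. u p \<le> exp (A * dist p q) * u q \<and> u q \<le> exp (A * dist p q) * u p"
  shows "loglip A u"
  unfolding loglip_def
proof (intro conjI allI)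
  fix p q :: "'n torus"
  show "0 < u p" by fact
  have nz: "u p \<noteq> 0" for p using pos[of p] by simp
  have key: "ln (u (to_torus x)) - ln (u (to_torus y)) \<le> A * dist x y" for x y
  proof -
    define c where "c t = x + t *\<^sub>R (y - x)" for t :: real
    define v where "v t = ln (u (to_torus (c t)))" for t
    have dc: "dist (c s) (c t) = \<bar>s - t\<bar> * dist x y" for s t
    proof -
      have "c s - c t = (s - t) *\<^sub>R (y - x)" by (simp add: c_def algebra_simps)
      then show ?thesis by (simp add: dist_norm norm_minus_commute)
    qed
    have "\<bar>v 0 - v 1\<bar> \<le> A * dist x y * (1 - 0)"
    proof (rule Bolzano[of 0 1 "\<lambda>a b. \<bar>v a - v b\<bar> \<le> A * dist x y * (b - a)"])
      show "\<bar>v a - v c\<bar> \<le> A * dist x y * (c - a)"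
        if "\<bar>v a - v b\<bar> \<le> A * dist x y * (b - a)" "\<bar>v b - v c\<bar> \<le> A * dist x y * (c - b)" for a b c
        using that by (simp add: algebra_simps)
    next
      fix t :: real
      have "((\<lambda>s. to_torus (c s)) \<longlongrightarrow> to_torus (c t)) (nhds t)"
        unfolding c_def
        by (rule continuous_on_tendsto_compose[OF continuous_to_torus[of UNIV]])
           (intro tendsto_add tendsto_const tendsto_scaleR filterlim_ident, simp_all)
      from eventually_compose_filterlim[OF loc this]
      obtain d where d: "d > 0" and D: "\<And>s. dist s t < d \<Longrightarrow>
        u (to_torus (c t)) \<le> exp (A * dist (to_torus (c t)) (to_torus (c s))) * u (to_torus (c s)) \<and>
        u (to_torus (c s)) \<le> exp (A * dist (to_torus (c t)) (to_torus (c s))) * u (to_torus (c t))"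
        unfolding eventually_nhds_metric by blast
      have D': "\<bar>v t - v s\<bar> \<le> A * dist x y * \<bar>t - s\<bar>" if "\<bar>s - t\<bar> < d" for s
      proof -
        let ?e = "A * dist (to_torus (c t)) (to_torus (c s))"
        have "ln (u (to_torus (c t))) \<le> ln (exp ?e * u (to_torus (c s)))"
             "ln (u (to_torus (c s))) \<le> ln (exp ?e * u (to_torus (c t)))"
          using D[of s] that pos by (auto simp: dist_real_def)
        then have "\<bar>v t - v s\<bar> \<le> ?e" by (simp add: v_def ln_mult nz)
        also have "\<dots> \<le> A * dist (c t) (c s)" by (intro mult_left_mono dist_torus_le A)
        finally show ?thesis by (simp add: dc algebra_simps)
      qed
      show "\<exists>d>0. \<forall>a b. a \<le> t \<and> t \<le> b \<and> b - a < d \<longrightarrow> \<bar>v a - v b\<bar> \<le> A * dist x y * (b - a)"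
      proof (intro exI[of _ d] conjI allI impI d)
        fix a b assume ab: "a \<le> t \<and> t \<le> b \<and> b - a < d"
        have "\<bar>v a - v b\<bar> \<le> \<bar>v t - v a\<bar> + \<bar>v t - v b\<bar>" by simp
        also have "\<dots> \<le> A * dist x y * \<bar>t - a\<bar> + A * dist x y * \<bar>t - b\<bar>"
          using ab by (intro add_mono D') auto
        also have "\<dots> = A * dist x y * (b - a)" using ab by (simp add: algebra_simps)
        finally show "\<bar>v a - v b\<bar> \<le> A * dist x y * (b - a)" .
      qed
    qed simp
    then show ?thesis by (simp add: v_def c_def)
  qed
  have "ln (u p) - ln (u q) \<le> A * dist p q"
  proof (rule field_le_epsilon)
    fix e :: real assume e: "e > 0"
    obtain x where x: "to_torus x = p" using to_torus_surj by blast
    \<comment> \<open>The denominator \<open>A + 1\<close> is safe for \<open>A = 0\<close>.\<close>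
    obtain y where y: "to_torus y = q" "dist x y < dist p q + e / (A + 1)"
      using dist_torus_lessD[of x q "dist p q + e / (A + 1)"] x e A by auto
    have "ln (u p) - ln (u q) \<le> A * dist x y" using key[of x y] x y by simp
    also have "\<dots> \<le> A * (dist p q + e / (A + 1))" using y(2) A by (intro mult_left_mono) simp_all
    also have "\<dots> \<le> A * dist p q + e" using e A by (simp add: field_simps)
    finally show "ln (u p) - ln (u q) \<le> A * dist p q + e" .
  qed
  then have "ln (u p) \<le> ln (exp (A * dist p q) * u q)" by (simp add: ln_mult nz)
  then show "u p \<le> exp (A * dist p q) * u q" using pos[of p] pos[of q] by (subst (asm) ln_le_cancel_iff) simp_all
qed

section \<open>Change of variables\<close>

text \<open>The change of variables theorem of the library requires a well-ordered index type, so an arbitrary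
  finite index type is replaced by an initial segment of the natural numbers of the same size.\<close>

typedef ('n::finite) index = "{0..<CARD('n)}"
  by (rule exI[of _ 0]) simp

lemma card_index: "CARD('n index) = CARD('n::finite)"
  using type_definition.card[OF type_definition_index[where 'n='n]] by simp

instantiation index :: (finite) wellorder
begin

definition less_eq_index :: "'a index \<Rightarrow> 'a index \<Rightarrow> bool" where
  "less_eq_index x y \<longleftrightarrow> Rep_index x \<le> Rep_index y"

definition less_index :: "'a index \<Rightarrow> 'a index \<Rightarrow> bool" where
  "less_index x y \<longleftrightarrow> Rep_index x < Rep_index y"

instance
proof
  fix P :: "'a index \<Rightarrow> bool" and a
  assume *: "\<And>x. (\<And>y. y < x \<Longrightarrow> P y) \<Longrightarrow> P x"
  show "P a"
    by (induction a rule: measure_induct_rule[of Rep_index]) (use * in \<open>auto simp: less_index_def\<close>)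
qed (auto simp: less_eq_index_def less_index_def Rep_index_inject)

end

instance index :: (finite) finite
proof
  show "finite (UNIV :: 'a index set)"
    using card_index[where 'n='a] by (intro card_ge_0_finite) simp
qed

text \<open>Rows and columns are renamed together; \<open>map_permutation\<close> matches the
  permutations of the two index types and preserves signs.\<close>

lemma det_reindex:
  fixes e :: "'k::finite \<Rightarrow> 'n::finite" and A :: "real^'n^'n"
  assumes e: "bij e"
  shows "det (\<chi> i j. A $ e i $ e j :: real^'k^'k) = det A"
proof -
  have e': "bij_betw e UNIV UNIV" using e .
  have ie: "inj e" "surj e" using e by (auto simp: bij_def)
  let ?m = "map_permutation UNIV e"
  have m: "?m p (e x) = e (p x)" for p x by (rule map_permutation_apply) (use ie in auto)
  have bij: "bij_betw ?m {p. p permutes (UNIV::'k set)} {p. p permutes (UNIV::'n set)}"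
  proof (rule bij_betw_byWitness[where f'="map_permutation UNIV (inv e)"])
    show "\<forall>p\<in>{p. p permutes (UNIV::'k set)}. map_permutation UNIV (inv e) (?m p) = p"
      using ie by (auto intro!: map_permutation_compose_inv[OF e'])
    show "\<forall>p\<in>{p. p permutes (UNIV::'n set)}. ?m (map_permutation UNIV (inv e) p) = p"
      using ie bij_imp_bij_inv[OF e] by (auto intro!: map_permutation_compose_inv simp: surj_f_inv_f)
    show "?m ` {p. p permutes (UNIV::'k set)} \<subseteq> {p. p permutes (UNIV::'n set)}"
      using map_permutation_permutes[OF e'] by auto
    show "map_permutation UNIV (inv e) ` {p. p permutes (UNIV::'n set)} \<subseteq> {p. p permutes (UNIV::'k set)}"
      using map_permutation_permutes[OF bij_imp_bij_inv[OF e]] by auto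
  qed
  have "det A = (\<Sum>p | p permutes (UNIV::'k set). of_int (sign (?m p)) * (\<Prod>i\<in>UNIV. A $ i $ ?m p i))"
    unfolding det_def by (rule sum.reindex_bij_betw[OF bij, symmetric])
  also have "\<dots> = (\<Sum>p | p permutes (UNIV::'k set). of_int (sign p) * (\<Prod>i\<in>UNIV. A $ e i $ e (p i)))"
  proof (rule sum.cong[OF refl])
    fix p :: "'k \<Rightarrow> 'k" assume p: "p \<in> {p. p permutes UNIV}"
    have "sign (?m p) = sign p" by (rule sign_map_permutation) (use p ie in auto)
    moreover have "(\<Prod>i\<in>UNIV. A $ i $ ?m p i) = (\<Prod>i\<in>UNIV. A $ e i $ ?m p (e i))"
      by (rule prod.reindex_bij_betw[OF e', symmetric])
    ultimately show "of_int (sign (?m p)) * (\<Prod>i\<in>UNIV. A $ i $ ?m p i) =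
        of_int (sign p) * (\<Prod>i\<in>UNIV. A $ e i $ e (p i))" by (simp add: m)
  qed
  also have "\<dots> = det (\<chi> i j. A $ e i $ e j :: real^'k^'k)" by (simp add: det_def)
  finally show ?thesis by simp
qed

lemma prod_Basis_cart: "(\<Prod>b\<in>Basis. (x::real^'n) \<bullet> b) = (\<Prod>i\<in>UNIV. x $ i)"
proof -
  have "bij_betw (\<lambda>i. axis i 1) UNIV (Basis :: (real^'n) set)"
    by (auto simp: Basis_vec_def bij_betw_def inj_on_def axis_eq_axis)
  from prod.reindex_bij_betw[OF this, of "\<lambda>b. x \<bullet> b"]
  show ?thesis by (simp add: inner_axis)
qed

lemma lborel_reindex:
  fixes e :: "'k::finite \<Rightarrow> 'n::finite"
  assumes e: "bij e"
  shows "distr lborel borel (\<lambda>x::real^'n. \<chi> j. x $ e j :: real^'k) = lborel"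
proof (rule lborel_eqI[symmetric])
  let ?R = "\<lambda>x::real^'n. \<chi> j. x $ e j :: real^'k"
  have [measurable]: "?R \<in> borel_measurable borel"
    by (intro borel_measurable_continuous_onI continuous_intros)
  show "sets (distr lborel borel ?R) = sets borel" by simp
  fix l u :: "real^'k" assume le: "\<And>b. b \<in> Basis \<Longrightarrow> l \<bullet> b \<le> u \<bullet> b"
  define l' where "l' = (\<chi> i. l $ inv e i)"
  define u' where "u' = (\<chi> i. u $ inv e i)"
  have ie: "inv e (e j) = j" "e (inv e i) = i" for i j
    using e by (auto simp: bij_def surj_f_inv_f)
  have "?R -` box l u = box l' u'"
    by (auto simp: mem_box_cart l'_def u'_def) (metis ie)+
  then have "emeasure (distr lborel borel ?R) (box l u) = emeasure lborel (box l' u')"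
    by (subst emeasure_distr) auto
  also have "\<dots> = ennreal (\<Prod>b\<in>Basis. (u' - l') \<bullet> b)"
  proof (rule emeasure_lborel_box)
    fix b :: "real^'n" assume "b \<in> Basis"
    then obtain i where b: "b = axis i 1" by (auto simp: Basis_vec_def)
    have "l \<bullet> axis (inv e i) 1 \<le> u \<bullet> axis (inv e i) 1" by (rule le) (auto simp: Basis_vec_def)
    then show "l' \<bullet> b \<le> u' \<bullet> b" by (simp add: b inner_axis l'_def u'_def)
  qed
  also have "(\<Prod>b\<in>Basis. (u' - l') \<bullet> b) = (\<Prod>i\<in>UNIV. (u' - l') $ i)"
    by (rule prod_Basis_cart)
  also have "\<dots> = (\<Prod>j\<in>UNIV. (u' - l') $ e j)"
    by (rule prod.reindex_bij_betw[symmetric]) (use e in auto)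
  also have "\<dots> = (\<Prod>j\<in>UNIV. (u - l) $ j)" by (simp add: l'_def u'_def ie)
  also have "\<dots> = (\<Prod>b\<in>Basis. (u - l) \<bullet> b)"
    by (rule prod_Basis_cart[symmetric])
  finally show "emeasure (distr lborel borel ?R) (box l u) = ennreal (\<Prod>b\<in>Basis. (u - l) \<bullet> b)" .
qed

text \<open>Boundedness of the image makes its measure finite, so that the statement on real-valued
  integrals can be read as one on nonnegative integrals.\<close>

lemma emeasure_differentiable_image_wellorder:
  fixes f :: "real^'k::{finite,wellorder} \<Rightarrow> real^'k::_"
  assumes S: "S \<in> sets borel" and fS: "f ` S \<in> sets borel" "bounded (f ` S)"
    and der: "\<And>x. x \<in> S \<Longrightarrow> (f has_derivative f' x) (at x)"
    and inj: "inj_on f S"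
    and meas: "(\<lambda>x. \<bar>det (matrix (f' x))\<bar> * indicator S x) \<in> borel_measurable borel"
  shows "emeasure lborel (f ` S) = (\<integral>\<^sup>+x. ennreal (\<bar>det (matrix (f' x))\<bar> * indicator S x) \<partial>lborel)"
proof -
  have fin: "emeasure lborel (f ` S) < \<infinity>" using emeasure_bounded_finite[OF fS(2)] by (simp add: top.not_eq_extremum)
  have lm: "f ` S \<in> lmeasurable" by (rule bounded_set_imp_lmeasurable[OF fS(2)]) (use fS(1) in simp)
  have "((\<lambda>x. \<bar>det (matrix (f' x))\<bar>) has_integral measure lebesgue (f ` S)) S"
    using has_measure_differentiable_image[of S f f' "measure lebesgue (f ` S)"] S der inj lm
    by (auto intro: has_derivative_at_withinI)
  then have "((\<lambda>x. if x \<in> S then \<bar>det (matrix (f' x))\<bar> else 0) has_integral measure lebesgue (f ` S)) UNIV"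
    by (simp add: has_integral_restrict_UNIV)
  moreover have "(\<lambda>x. if x \<in> S then \<bar>det (matrix (f' x))\<bar> else 0) = (\<lambda>x. \<bar>det (matrix (f' x))\<bar> * indicator S x)"
    by (auto simp: indicator_def)
  ultimately have "((\<lambda>x. \<bar>det (matrix (f' x))\<bar> * indicator S x) has_integral measure lebesgue (f ` S)) UNIV"
    by simp
  from nn_integral_has_integral_lborel[OF meas _ this]
  have "(\<integral>\<^sup>+x. ennreal (\<bar>det (matrix (f' x))\<bar> * indicator S x) \<partial>lborel) = ennreal (measure lebesgue (f ` S))"
    by simp
  also have "\<dots> = ennreal (measure lborel (f ` S))" using fS(1) by simp
  also have "\<dots> = emeasure lborel (f ` S)" using fin by (simp add: emeasure_eq_ennreal_measure)
  finally show ?thesis by simp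
qed

text \<open>Conjugation with the coordinate relabelling \<open>R\<close> reduces this to the
  well-ordered index type: \<open>R\<close> preserves Lebesgue measure, and the conjugated
  derivative has the same determinant.\<close>

lemma emeasure_differentiable_image:
  fixes f :: "real^'n::finite \<Rightarrow> real^'n"
  assumes S [measurable]: "S \<in> sets borel" and fS: "f ` S \<in> sets borel" "bounded (f ` S)"
    and der: "\<And>x. x \<in> S \<Longrightarrow> (f has_derivative f' x) (at x)"
    and inj: "inj_on f S"
    and meas [measurable]: "(\<lambda>x. \<bar>det (matrix (f' x))\<bar> * indicator S x) \<in> borel_measurable borel"
  shows "emeasure lborel (f ` S) = (\<integral>\<^sup>+x. ennreal (\<bar>det (matrix (f' x))\<bar> * indicator S x) \<partial>lborel)"
proof -
  obtain e :: "'n index \<Rightarrow> 'n" where e: "bij e"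
    using finite_same_card_bij[of "UNIV::'n index set" "UNIV::'n set"] card_index by auto
  have ie: "inv e (e j) = j" "e (inv e i) = i" for i j
    using e by (auto simp: bij_def surj_f_inv_f)
  define R where "R = (\<lambda>x::real^'n. \<chi> j. x $ e j :: real^('n index))"
  define R' where "R' = (\<lambda>y::real^('n index). \<chi> i. y $ inv e i :: real^'n)"
  have RR: "R (R' y) = y" "R' (R x) = x" for x y by (auto simp: R_def R'_def vec_eq_iff ie)
  have lin: "bounded_linear R" "bounded_linear R'"
    unfolding R_def R'_def by (auto intro!: linear_conv_bounded_linear[THEN iffD1] linearI simp: vec_eq_iff)
  have cR: "continuous_on UNIV R" "continuous_on UNIV R'"
    using lin linear_continuous_on by blast+
  have [measurable]: "R \<in> borel_measurable borel" "R' \<in> borel_measurable borel"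
    using cR borel_measurable_continuous_onI by blast+
  have lR: "distr lborel borel R = lborel" unfolding R_def by (rule lborel_reindex[OF e])
  define h where "h = R \<circ> f \<circ> R'"
  define h' where "h' y = R \<circ> f' (R' y) \<circ> R'" for y
  have img: "R ` A = R' -` A" for A
    by (auto simp: RR) (metis RR(1) imageI)
  have hS: "h ` (R ` S) = R ` (f ` S)" by (auto simp: h_def image_comp RR)
  have det: "det (matrix (h' y)) = det (matrix (f' (R' y)))" for y
  proof -
    have ax: "R' (axis j 1) = axis (e j) 1" for j
      by (auto simp: R'_def vec_eq_iff axis_def ie)
    have "matrix (h' y) = (\<chi> i j. matrix (f' (R' y)) $ e i $ e j)"
      by (auto simp: vec_eq_iff matrix_def h'_def ax) (simp add: R_def)
    then show ?thesis using det_reindex[OF e] by simp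
  qed
  have indR: "indicator (R ` S) y = (indicator S (R' y) :: real)" for y
    by (simp add: img indicator_def)
  have RfS: "R ` (f ` S) \<in> sets borel" unfolding img using fS(1) by (rule measurable_sets_borel[rotated]) measurable
  have RS: "R ` S \<in> sets borel" unfolding img using S by (rule measurable_sets_borel[rotated]) measurable
  have "emeasure lborel (f ` S) = emeasure (distr lborel borel R) (R ` (f ` S))"
    using RfS fS(1) RR by (subst emeasure_distr) (auto simp: inj_vimage_image_eq[OF inj_on_inverseI[where g=R']])
  also have "\<dots> = emeasure lborel (h ` (R ` S))" by (simp add: lR hS)
  also have "\<dots> = (\<integral>\<^sup>+y. ennreal (\<bar>det (matrix (h' y))\<bar> * indicator (R ` S) y) \<partial>lborel)"
  proof (rule emeasure_differentiable_image_wellorder)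
    show "R ` S \<in> sets borel" by fact
    show "h ` R ` S \<in> sets borel" using RfS by (simp add: hS)
    show "bounded (h ` R ` S)" unfolding hS by (rule bounded_linear_image[OF fS(2) lin(1)])
    show "(h has_derivative h' y) (at y)" if "y \<in> R ` S" for y
    proof -
      have "(f has_derivative f' (R' y)) (at (R' y))" using that RR by (intro der) auto
      then show ?thesis unfolding h_def h'_def o_def
        by (intro bounded_linear.has_derivative[OF lin(1)] has_derivative_compose[OF bounded_linear_imp_has_derivative[OF lin(2)]])
    qed
    show "inj_on h (R ` S)"
    proof (rule inj_onI)
      fix y z assume yz: "y \<in> R ` S" "z \<in> R ` S" "h y = h z"
      then obtain a b where ab: "y = R a" "z = R b" "a \<in> S" "b \<in> S" by blast
      from yz(3) have "R (f a) = R (f b)" unfolding h_def ab o_def RR .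
      then have "R' (R (f a)) = R' (R (f b))" by (rule arg_cong)
      then have "f a = f b" unfolding RR .
      then show "y = z" using inj_onD[OF inj _ ab(3,4)] ab by blast
    qed
    show "(\<lambda>y. \<bar>det (matrix (h' y))\<bar> * indicator (R ` S) y) \<in> borel_measurable borel"
      using measurable_compose[OF \<open>R' \<in> borel_measurable borel\<close> meas] by (simp add: det indR)
  qed
  also have "\<dots> = (\<integral>\<^sup>+y. ennreal (\<bar>det (matrix (f' (R' y)))\<bar> * indicator S (R' y)) \<partial>distr lborel borel R)"
    by (simp add: det indR lR)
  also have "\<dots> = (\<integral>\<^sup>+x. ennreal (\<bar>det (matrix (f' x))\<bar> * indicator S x) \<partial>lborel)"
    using measurable_compose[OF \<open>R' \<in> borel_measurable borel\<close> meas]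
    by (subst nn_integral_distr) (auto simp: RR)
  finally show ?thesis .
qed

section \<open>Expanding maps of the torus\<close>

definition C1_on :: "'a::real_normed_vector set \<Rightarrow> ('a \<Rightarrow> real) \<Rightarrow> bool" where
  "C1_on S f \<longleftrightarrow> (\<exists>f' :: 'a \<Rightarrow> 'a \<Rightarrow>\<^sub>L real.
     (\<forall>x\<in>S. (f has_derivative blinfun_apply (f' x)) (at x)) \<and> continuous_on S f')"

lemma C1_on_const: "C1_on S (\<lambda>_. c)"
  unfolding C1_on_def by (rule exI[of _ "\<lambda>_. 0"]) (auto simp: zero_blinfun.rep_eq)

lemma C1_on_add:
  assumes "C1_on S f" "C1_on S g"
  shows "C1_on S (\<lambda>x. f x + g x)"
proof -
  obtain f' g' where *: "\<forall>x\<in>S. (f has_derivative blinfun_apply (f' x)) (at x)" "continuous_on S f'"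
    "\<forall>x\<in>S. (g has_derivative blinfun_apply (g' x)) (at x)" "continuous_on S g'"
    using assms unfolding C1_on_def by blast
  show ?thesis unfolding C1_on_def
    by (rule exI[of _ "\<lambda>x. f' x + g' x"])
       (use * in \<open>auto intro!: continuous_intros has_derivative_add simp: plus_blinfun.rep_eq\<close>)
qed

lemma C1_on_mult:
  assumes "C1_on S f" "C1_on S g"
  shows "C1_on S (\<lambda>x. f x * g x)"
proof -
  obtain f' g' where *: "\<forall>x\<in>S. (f has_derivative blinfun_apply (f' x)) (at x)" "continuous_on S f'"
    "\<forall>x\<in>S. (g has_derivative blinfun_apply (g' x)) (at x)" "continuous_on S g'"
    using assms unfolding C1_on_def by blast
  have c: "continuous_on S f" "continuous_on S g"
    using * by (auto intro!: continuous_at_imp_continuous_on has_derivative_continuous)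
  show ?thesis unfolding C1_on_def
  proof (intro exI[of _ "\<lambda>x. f x *\<^sub>R g' x + g x *\<^sub>R f' x"] conjI ballI)
    fix x assume "x \<in> S"
    with * have "((\<lambda>x. f x * g x) has_derivative (\<lambda>v. f x * g' x v + f' x v * g x)) (at x)"
      by (intro has_derivative_mult) auto
    then show "((\<lambda>x. f x * g x) has_derivative blinfun_apply (f x *\<^sub>R g' x + g x *\<^sub>R f' x)) (at x)"
      by (simp add: plus_blinfun.rep_eq scaleR_blinfun.rep_eq mult.commute)
  qed (use * c in \<open>auto intro!: continuous_intros\<close>)
qed

lemma C1_on_sum: "(\<And>i. i \<in> I \<Longrightarrow> C1_on S (f i)) \<Longrightarrow> C1_on S (\<lambda>x. \<Sum>i\<in>I. f i x)"
  by (induction I rule: infinite_finite_induct) (auto intro: C1_on_const C1_on_add)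

lemma C1_on_prod: "(\<And>i. i \<in> I \<Longrightarrow> C1_on S (f i)) \<Longrightarrow> C1_on S (\<lambda>x. \<Prod>i\<in>I. f i x)"
  by (induction I rule: infinite_finite_induct) (auto intro: C1_on_const C1_on_mult)

text \<open>The determinant is a polynomial in the entries of \<open>G'\<close>. The continuity of
  its gradient is what later carries the distortion bound from a dense set to every point.\<close>

lemma C1_on_det:
  fixes G' :: "real^'n::finite \<Rightarrow> (real^'n) \<Rightarrow>\<^sub>L (real^'n)"
  assumes der: "\<And>x. x \<in> S \<Longrightarrow> (G' has_derivative blinfun_apply (G'' x)) (at x)"
    and cont: "continuous_on S G''"
  shows "C1_on S (\<lambda>x. det (matrix (blinfun_apply (G' x))))"
proof -
  have entry: "C1_on S (\<lambda>x. blinfun_apply (G' x) a $ i)" for a i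
  proof -
    define l where "l = (\<lambda>T :: (real^'n) \<Rightarrow>\<^sub>L (real^'n). blinfun_apply T a $ i)"
    have bl: "bounded_linear l" unfolding l_def
      by (intro bounded_linear_vec_nth[THEN bounded_linear_compose]
          bounded_bilinear.bounded_linear_left[OF bounded_bilinear_blinfun_apply])
    show ?thesis unfolding C1_on_def
    proof (intro exI[of _ "\<lambda>x. Blinfun l o\<^sub>L G'' x"] conjI ballI)
      fix x assume "x \<in> S"
      from bounded_linear.has_derivative[OF bl der[OF this]]
      show "((\<lambda>x. blinfun_apply (G' x) a $ i) has_derivative blinfun_apply (Blinfun l o\<^sub>L G'' x)) (at x)"
        by (simp add: l_def[symmetric] bounded_linear_Blinfun_apply[OF bl] blinfun_compose.rep_eq o_def)
           (simp add: l_def)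
    qed (intro continuous_intros cont)
  qed
  show ?thesis unfolding det_def matrix_def
    by (simp, intro C1_on_sum C1_on_mult C1_on_const C1_on_prod entry)
qed

lemma directional_derivative_tendsto:
  fixes f :: "'a::real_normed_vector \<Rightarrow> 'b::real_normed_vector"
  assumes "(f has_derivative f') (at x)"
  shows "((\<lambda>t. (f (x + t *\<^sub>R v) - f x) /\<^sub>R t) \<longlongrightarrow> f' v) (at (0::real))"
proof -
  have l: "linear f'" using assms has_derivative_linear by blast
  have "((\<lambda>t::real. x + t *\<^sub>R v) has_derivative (\<lambda>t. t *\<^sub>R v)) (at 0)"
    by (auto intro!: derivative_eq_intros)
  from has_derivative_compose[OF this, of f f'] assms
  have "((\<lambda>t. f (x + t *\<^sub>R v)) has_derivative (\<lambda>t. f' (t *\<^sub>R v))) (at 0)" by simp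
  then have "(\<lambda>h. norm (f (x + h *\<^sub>R v) - f x - f' (h *\<^sub>R v)) / norm h) \<midarrow>0\<rightarrow> 0"
    by (simp add: has_derivative_at)
  then have "((\<lambda>h. norm ((f (x + h *\<^sub>R v) - f x) /\<^sub>R h - f' v)) \<longlongrightarrow> 0) (at (0::real))"
  proof (rule Lim_transform_eventually)
    show "\<forall>\<^sub>F h in at (0::real). norm (f (x + h *\<^sub>R v) - f x - f' (h *\<^sub>R v)) / norm h =
        norm ((f (x + h *\<^sub>R v) - f x) /\<^sub>R h - f' v)"
      unfolding eventually_at_filter
    proof (intro always_eventually allI impI)
      fix h :: real assume h: "h \<noteq> 0"
      have "(f (x + h *\<^sub>R v) - f x) /\<^sub>R h - f' v = (f (x + h *\<^sub>R v) - f x - f' (h *\<^sub>R v)) /\<^sub>R h"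
        using h by (simp add: linear_cmul[OF l] scaleR_diff_right)
      then show "norm (f (x + h *\<^sub>R v) - f x - f' (h *\<^sub>R v)) / norm h =
        norm ((f (x + h *\<^sub>R v) - f x) /\<^sub>R h - f' v)" by (simp only: norm_scaleR) (simp add: divide_inverse)
    qed
  qed
  then show ?thesis by (metis Lim_null tendsto_norm_zero_cancel)
qed

section \<open>Charts of an expanding map and distortion of its Jacobian\<close>

locale expanding_torus_map =
  fixes \<sigma> D :: real and g :: "('n::finite) torus \<Rightarrow> 'n torus"
  assumes base: "expanding_base \<sigma> D g" and D_pos: "0 < D"
begin

abbreviation "J \<equiv> torus_jacobian g"

lemma \<sigma>_gt_1: "1 < \<sigma>"
  using base by (simp add: expanding_base_def)

lemma expansion: "\<sigma> * norm v \<le> norm (torus_derivative g \<omega> v)"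
  using base by (simp add: expanding_base_def)

lemma branches:
  obtains d :: nat and I where "(\<Union>i<d. I i) = UNIV" "disjoint_family_on I {..<d}"
    "\<And>i. i < d \<Longrightarrow> AE \<omega> in lebesgue_torus. \<omega> \<in> I i \<longleftrightarrow> \<omega> \<in> interior (I i)"
    "\<And>i. i < d \<Longrightarrow> bij_betw g (I i) UNIV"
    "\<And>i \<omega>\<^sub>1 \<omega>\<^sub>2. i < d \<Longrightarrow> J (inv_into (I i) g \<omega>\<^sub>1) / J (inv_into (I i) g \<omega>\<^sub>2) \<le> exp (D * dist \<omega>\<^sub>1 \<omega>\<^sub>2)"
proof -
  from base obtain d :: nat and I where dI: "(\<Union>i<d. I i) = UNIV" "disjoint_family_on I {..<d}"
    and *: "\<forall>i<d. (AE \<omega> in lebesgue_torus. \<omega> \<in> I i \<longleftrightarrow> \<omega> \<in> interior (I i)) \<and>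
           bij_betw g (I i) UNIV \<and> torus_C2_on (interior (I i)) g \<and>
           (\<forall>\<omega>\<^sub>1 \<omega>\<^sub>2. J (inv_into (I i) g \<omega>\<^sub>1) / J (inv_into (I i) g \<omega>\<^sub>2) \<le> exp (D * dist \<omega>\<^sub>1 \<omega>\<^sub>2))"
    unfolding expanding_base_def by (elim conjE exE) rule
  show ?thesis
    by (rule that[OF dI]) (use * in \<open>simp_all only:\<close>)
qed

lemma torus_C2_on_UNIV: "torus_C2_on UNIV g"
  unfolding torus_C2_on_def
proof (intro allI impI)
  fix x :: "real^'n"
  obtain U where "to_torus x \<in> U" "torus_C2_on U g"
    using base unfolding expanding_base_def torus_C2_local_diffeo_def by blast
  then show "\<exists>N G. open N \<and> x \<in> N \<and> C2_on N G \<and> (\<forall>y\<in>N. g (to_torus y) = to_torus (G y))"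
    unfolding torus_C2_on_def by blast
qed

text \<open>Expansion makes the derivative injective, hence invertible, so the inverse function
  theorem applies. The image is cut down to a ball so that mean value estimates for \<open>H\<close>
  run on a convex set; radii of at most 1/4 make \<open>to_torus\<close> injective and isometric on
  source and image.\<close>

lemma local_chart:
  obtains N s G G' R' H where "open N" "x \<in> N" "N \<subseteq> ball x (1/4)" "0 < s" "s \<le> 1/4"
    "homeomorphism N (ball (G x) s) G H"
    "\<And>y. y \<in> N \<Longrightarrow> g (to_torus y) = to_torus (G y)"
    "\<And>y. y \<in> N \<Longrightarrow> (G has_derivative blinfun_apply (G' y)) (at y)"
    "continuous_on N G'"
    "\<And>y. y \<in> N \<Longrightarrow> torus_derivative g (to_torus y) = blinfun_apply (G' y)"
    "\<And>y. y \<in> N \<Longrightarrow> det (matrix (blinfun_apply (G' y))) \<noteq> 0"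
    "\<And>z. z \<in> ball (G x) s \<Longrightarrow> (H has_derivative inv (blinfun_apply (G' (H z)))) (at z)"
    "\<And>y. y \<in> N \<Longrightarrow> bij (blinfun_apply (G' y))"
    "\<And>y. y \<in> N \<Longrightarrow> ((\<lambda>y. det (matrix (blinfun_apply (G' y)))) has_derivative blinfun_apply (R' y)) (at y)"
    "continuous_on N R'"
proof -
  obtain N0 G where N0: "open N0" "x \<in> N0" "C2_on N0 G" "\<And>y. y \<in> N0 \<Longrightarrow> g (to_torus y) = to_torus (G y)"
    using torus_C2_on_UNIV[unfolded torus_C2_on_def, rule_format, of x] by auto
  then obtain G' G'' where G': "\<And>y. y \<in> N0 \<Longrightarrow> (G has_derivative blinfun_apply (G' y)) (at y)"
    and G'': "\<And>y. y \<in> N0 \<Longrightarrow> (G' has_derivative blinfun_apply (G'' y)) (at y)" "continuous_on N0 G''"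
    unfolding C2_on_def by blast
  have cG': "continuous_on N0 G'"
    using G''(1) by (auto intro!: continuous_at_imp_continuous_on has_derivative_continuous)
  have tder: "torus_derivative g (to_torus y) = blinfun_apply (G' y)" if "y \<in> N0" for y
  proof (rule torus_derivativeI)
    have "\<forall>\<^sub>F z in nhds y. z \<in> N0" using N0(1) that by (rule eventually_nhds_in_open)
    then have "\<forall>\<^sub>F z in nhds y. g (to_torus z) = to_torus (G z)" by eventually_elim (rule N0(4))
    then show "has_torus_derivative g (blinfun_apply (G' y)) (to_torus y)"
      unfolding has_torus_derivative_def using G'[OF that] by blast
  qed
  have bl: "linear (blinfun_apply (G' y))" for y
    using blinfun.bounded_linear_right linear_conv_bounded_linear by blast
  have inj: "inj (blinfun_apply (G' y))" if "y \<in> N0" for y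
  proof (subst linear_injective_0[OF bl], intro allI impI)
    fix v assume "blinfun_apply (G' y) v = 0"
    then have "\<sigma> * norm v \<le> 0" using expansion[of v "to_torus y"] tder[OF that] by simp
    then show "v = 0" using \<sigma>_gt_1 by (simp add: mult_le_0_iff)
  qed
  have bij: "bij (blinfun_apply (G' y))" if "y \<in> N0" for y
    using linear_injective_imp_surjective[OF bl inj[OF that]] inj[OF that] by (simp add: bij_def)
  have det: "det (matrix (blinfun_apply (G' y))) \<noteq> 0" if "y \<in> N0" for y
    using det_nz_iff_inj[OF bl] inj[OF that] by blast
  have "C1_on N0 (\<lambda>y. det (matrix (blinfun_apply (G' y))))"
    by (rule C1_on_det[OF G''])
  then obtain R' where R': "\<And>y. y \<in> N0 \<Longrightarrow> ((\<lambda>y. det (matrix (blinfun_apply (G' y)))) has_derivative blinfun_apply (R' y)) (at y)"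
    "continuous_on N0 R'" unfolding C1_on_def by blast
  define U where "U = N0 \<inter> ball x (1/4)"
  have U: "open U" "x \<in> U" "U \<subseteq> N0" "U \<subseteq> ball x (1/4)" using N0 by (auto simp: U_def)
  obtain h where h: "linear h" "h \<circ> blinfun_apply (G' x) = id"
    using linear_injective_left_inverse[OF bl inj[OF N0(2)]] by blast
  have invf: "Blinfun h o\<^sub>L G' x = id_blinfun"
    using h by (intro blinfun_eqI)
      (simp add: bounded_linear_Blinfun_apply linear_conv_bounded_linear[symmetric] fun_eq_iff)
  have dG: "(G has_derivative blinfun_apply (G' y)) (at y)" if "y \<in> U" for y
    using G' U(3) that by blast
  show ?thesis
  proof (rule inverse_function_theorem[OF U(1) dG continuous_on_subset[OF cG' U(3)] U(2) invf])
  fix U' V H H' assume IFT: "open U'" "U' \<subseteq> U" "x \<in> U'" "open V" "G x \<in> V" "homeomorphism U' V G H"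
    "\<And>y. y \<in> V \<Longrightarrow> (H has_derivative (H' y)) (at y)"
    "\<And>y. y \<in> V \<Longrightarrow> H' y = inv (blinfun_apply (G' (H y)))"
    "\<And>y. y \<in> V \<Longrightarrow> bij (blinfun_apply (G' (H y)))"
  obtain s0 where s0: "s0 > 0" "ball (G x) s0 \<subseteq> V" using IFT(4,5) open_contains_ball by blast
  define s where "s = min s0 (1/4)"
  have s: "0 < s" "s \<le> 1/4" "ball (G x) s \<subseteq> V" using s0 by (auto simp: s_def)
  define N where "N = H ` ball (G x) s"
  have hom: "homeomorphism N (ball (G x) s) G H"
    by (rule homeomorphism_symD, rule homeomorphism_of_subsets[OF homeomorphism_symD[OF IFT(6)] s(3) order_refl])
       (simp add: N_def)
  have NU: "N \<subseteq> U'" using IFT(6) s(3) by (auto simp: N_def homeomorphism_def)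
  have "N = U' \<inter> G -` ball (G x) s"
  proof (intro set_eqI iffI)
    show "y \<in> U' \<inter> G -` ball (G x) s" if "y \<in> N" for y
      using that NU hom by (auto simp: homeomorphism_def)
    show "y \<in> N" if "y \<in> U' \<inter> G -` ball (G x) s" for y
    proof -
      have "H (G y) = y" using IFT(6) that by (auto simp: homeomorphism_def)
      then show ?thesis using that unfolding N_def by (metis IntD2 imageI vimageD)
    qed
  qed
  moreover have "open (U' \<inter> G -` ball (G x) s)"
    using IFT(1,6) by (intro continuous_open_preimage) (auto simp: homeomorphism_def)
  ultimately have oN: "open N" by simp
  have xN: "x \<in> N" using \<open>N = U' \<inter> _\<close> IFT(3) s(1) by simp
  have N: "N \<subseteq> N0" "N \<subseteq> ball x (1/4)" using NU IFT(2) U(3,4) by auto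
  show ?thesis
  proof (rule that[OF oN xN N(2) s(1,2) hom])
    show "continuous_on N G'" "continuous_on N R'" using cG' R'(2) N(1) continuous_on_subset by blast+
    show "(H has_derivative inv (blinfun_apply (G' (H z)))) (at z)" if "z \<in> ball (G x) s" for z
      using IFT(7,8)[of z] that s(3) by auto
    fix y assume "y \<in> N"
    then have y: "y \<in> N0" using N(1) by blast
    show "g (to_torus y) = to_torus (G y)" by (rule N0(4)[OF y])
    show "(G has_derivative blinfun_apply (G' y)) (at y)" by (rule G'[OF y])
    show "torus_derivative g (to_torus y) = blinfun_apply (G' y)" by (rule tder[OF y])
    show "det (matrix (blinfun_apply (G' y))) \<noteq> 0" by (rule det[OF y])
    show "bij (blinfun_apply (G' y))" by (rule bij[OF y])
    show "((\<lambda>y. det (matrix (blinfun_apply (G' y)))) has_derivative blinfun_apply (R' y)) (at y)"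
      by (rule R'(1)[OF y])
  qed
  qed
qed

text \<open>The branches of the partition in the distortion condition may be discontinuous, so the condition only
  controls the gradient of the Jacobian over the interiors of its pieces; these are dense, and \<open>C\<^sup>2\<close> smoothness
  extends the bound to all points.\<close>

lemma jacobian_gradient_dense:
  assumes N: "open N" "\<And>y. y \<in> N \<Longrightarrow> g (to_torus y) = to_torus (G y)"
    and G': "\<And>y. y \<in> N \<Longrightarrow> (G has_derivative G' y) (at y)"
    and J: "\<And>y. y \<in> N \<Longrightarrow> J (to_torus y) = \<bar>R y\<bar>" "\<And>y. y \<in> N \<Longrightarrow> R y \<noteq> 0"
    and R': "\<And>y. y \<in> N \<Longrightarrow> (R has_derivative R' y) (at y)"
    and W: "open W" "W \<subseteq> N" "W \<noteq> {}"
  shows "\<exists>y\<in>W. \<forall>v. \<bar>R' y v\<bar> \<le> D * \<bar>R y\<bar> * norm (G' y v)"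
proof (rule branches)
  fix d :: nat and I assume dI: "(\<Union>i<d. I i) = UNIV" "disjoint_family_on I {..<d}"
    "\<And>i. i < d \<Longrightarrow> AE \<omega> in lebesgue_torus. \<omega> \<in> I i \<longleftrightarrow> \<omega> \<in> interior (I i)"
    "\<And>i. i < d \<Longrightarrow> bij_betw g (I i) UNIV"
    "\<And>i \<omega>\<^sub>1 \<omega>\<^sub>2. i < d \<Longrightarrow> J (inv_into (I i) g \<omega>\<^sub>1) / J (inv_into (I i) g \<omega>\<^sub>2) \<le> exp (D * dist \<omega>\<^sub>1 \<omega>\<^sub>2)"
  \<comment> \<open>Almost every point is interior to its piece, because only finitely many null
    sets are exceptional. A nonempty open set has positive measure, so the image of \<open>W\<close>
    contains such a point.\<close>
  have "AE \<omega> in lebesgue_torus. \<forall>i\<in>{..<d}. \<omega> \<in> I i \<longleftrightarrow> \<omega> \<in> interior (I i)"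
    using dI(3) by (intro AE_finite_allI) auto
  then have "AE \<omega> in lebesgue_torus. \<omega> \<in> (\<Union>i<d. interior (I i))"
  proof eventually_elim
    case (elim \<omega>)
    obtain i where "i < d" "\<omega> \<in> I i" using dI(1) by blast
    then show ?case using elim by auto
  qed
  from AE_torus_imp_dense[OF this open_to_torus[OF W(1)]] W(3)
  obtain y i where y: "y \<in> W" "i < d" "to_torus y \<in> interior (I i)" by auto
  have yN: "y \<in> N" using y W by auto
  have inv: "inv_into (I i) g (g (to_torus z)) = to_torus z" if "to_torus z \<in> I i" for z
    using dI(4)[OF y(2)] that by (simp add: bij_betw_def)
  define M where "M = W \<inter> to_torus -` interior (I i)"
  have M: "open M" "y \<in> M" using y W(1) by (auto simp: M_def intro!: open_Int open_vimage continuous_to_torus)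
  \<comment> \<open>On the interior of one piece \<open>inv_into (I i) g\<close> undoes
    \<open>g\<close>, so the distortion hypothesis compares the Jacobian at any two points of
    \<open>M\<close>.\<close>
  have comp: "\<bar>R a\<bar> \<le> \<bar>R b\<bar> * exp (D * dist (G a) (G b))" if "a \<in> M" "b \<in> M" for a b
  proof -
    have ab: "a \<in> N" "b \<in> N" "to_torus a \<in> I i" "to_torus b \<in> I i"
      using that W(2) interior_subset unfolding M_def by blast+
    have "\<bar>R a\<bar> / \<bar>R b\<bar> \<le> exp (D * dist (g (to_torus a)) (g (to_torus b)))"
      using dI(5)[OF y(2), of "g (to_torus a)" "g (to_torus b)"] ab by (simp add: inv J)
    also have "\<dots> \<le> exp (D * dist (G a) (G b))"
      using D_pos dist_torus_le ab by (simp add: N(2) mult_left_mono)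
    finally show ?thesis using J(2)[OF ab(2)] by (simp add: field_simps)
  qed
  have "\<bar>R' y v\<bar> \<le> D * \<bar>R y\<bar> * norm (G' y v)" for v
  proof (rule tendsto_le[OF trivial_limit_at])
    let ?G = "\<lambda>t. norm ((G (y + t *\<^sub>R v) - G y) /\<^sub>R t)"
    have lim: "((\<lambda>t. y + t *\<^sub>R v) \<longlongrightarrow> y) (at (0::real))"
      by (auto intro!: tendsto_eq_intros)
    have cG: "((\<lambda>t. G (y + t *\<^sub>R v)) \<longlongrightarrow> G y) (at (0::real))"
      using has_derivative_continuous[OF G'[OF yN]] lim isCont_tendsto_compose by blast
    have cR: "((\<lambda>t. R (y + t *\<^sub>R v)) \<longlongrightarrow> R y) (at (0::real))"
      using has_derivative_continuous[OF R'[OF yN]] lim isCont_tendsto_compose by blast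
    show "((\<lambda>t. \<bar>(R (y + t *\<^sub>R v) - R y) /\<^sub>R t\<bar>) \<longlongrightarrow> \<bar>R' y v\<bar>) (at (0::real))"
      by (intro tendsto_rabs directional_derivative_tendsto R' yN)
    have "((\<lambda>t. \<bar>R y\<bar> * (D * ?G t) * exp (D * dist (G (y + t *\<^sub>R v)) (G y))) \<longlongrightarrow>
        \<bar>R y\<bar> * (D * norm (G' y v)) * exp (D * dist (G y) (G y))) (at (0::real))"
      by (intro tendsto_intros directional_derivative_tendsto G' yN cG)
    then show "((\<lambda>t. \<bar>R y\<bar> * (D * ?G t) * exp (D * dist (G (y + t *\<^sub>R v)) (G y))) \<longlongrightarrow>
        D * \<bar>R y\<bar> * norm (G' y v)) (at (0::real))" by (simp add: mult.assoc mult.left_commute)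
    have ev1: "\<forall>\<^sub>F t in at (0::real). y + t *\<^sub>R v \<in> M"
      using topological_tendstoD[OF lim M] .
    \<comment> \<open>Near \<open>y\<close> the determinant keeps its sign, so increments of
      \<open>R\<close> and of its absolute value have the same size.\<close>
    have "\<forall>\<^sub>F t in at (0::real). dist (R (y + t *\<^sub>R v)) (R y) < \<bar>R y\<bar>"
      using J(2)[OF yN] by (intro tendstoD[OF cR]) simp
    then show "\<forall>\<^sub>F t in at (0::real). \<bar>(R (y + t *\<^sub>R v) - R y) /\<^sub>R t\<bar> \<le>
        \<bar>R y\<bar> * (D * ?G t) * exp (D * dist (G (y + t *\<^sub>R v)) (G y))"
      using ev1
    proof eventually_elim
      case (elim t)
      let ?a = "D * dist (G (y + t *\<^sub>R v)) (G y)"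
      have a0: "0 \<le> ?a" using D_pos by simp
      have e1: "exp ?a - 1 \<le> ?a * exp ?a"
      proof -
        have "1 + - ?a \<le> exp (- ?a)" by (rule exp_ge_add_one_self)
        then have "(1 - ?a) * exp ?a \<le> exp (- ?a) * exp ?a" by (intro mult_right_mono) auto
        then show ?thesis by (simp add: exp_minus algebra_simps)
      qed
      have "\<bar>R (y + t *\<^sub>R v) - R y\<bar> = \<bar>\<bar>R (y + t *\<^sub>R v)\<bar> - \<bar>R y\<bar>\<bar>"
        using elim(1) by (auto simp: dist_real_def abs_if split: if_splits)
      also have "\<dots> \<le> \<bar>R y\<bar> * (exp ?a - 1)"
      proof -
        have u: "\<bar>R (y + t *\<^sub>R v)\<bar> \<le> \<bar>R y\<bar> * exp ?a" using comp[OF elim(2) M(2)] .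
        have "\<bar>R y\<bar> * exp (- ?a) \<le> \<bar>R (y + t *\<^sub>R v)\<bar>"
          using comp[OF M(2) elim(2)] by (simp add: exp_minus field_simps dist_commute)
        \<comment> \<open>The inequality \<open>2 - exp a \<le> exp (- a)\<close> gives the
          deviations below and above the common bound \<open>exp a - 1\<close>.\<close>
        moreover have "\<bar>R y\<bar> * (2 - exp ?a) \<le> \<bar>R y\<bar> * exp (- ?a)"
        proof (intro mult_left_mono)
          have "(exp ?a - 1)^2 \<ge> 0" by simp
          then have "2 * exp ?a \<le> exp ?a * exp ?a + 1" by (simp add: power2_eq_square algebra_simps)
          then have "2 * exp ?a * exp (- ?a) \<le> (exp ?a * exp ?a + 1) * exp (- ?a)"
            by (intro mult_right_mono) auto
          then show "2 - exp ?a \<le> exp (- ?a)" by (simp add: exp_minus field_simps)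
        qed simp
        ultimately show ?thesis using u by (intro abs_leI) (simp_all add: algebra_simps)
      qed
      also have "\<dots> \<le> \<bar>R y\<bar> * (?a * exp ?a)" using e1 by (intro mult_left_mono) auto
      finally have "\<bar>R (y + t *\<^sub>R v) - R y\<bar> / \<bar>t\<bar> \<le> \<bar>R y\<bar> * (?a * exp ?a) / \<bar>t\<bar>"
        by (rule divide_right_mono) simp
      then show ?case by (simp add: dist_norm divide_inverse abs_mult mult_ac)
    qed
  qed
  then show ?thesis using y(1) by blast
qed


text \<open>By continuity of both derivatives a violation at \<open>y\<close> would persist on an
  open set, and every nonempty open set contains a point where the bound holds.\<close>

lemma jacobian_gradient:
  fixes R' :: "real^'n \<Rightarrow> (real^'n) \<Rightarrow>\<^sub>L real" and G' :: "real^'n \<Rightarrow> (real^'n) \<Rightarrow>\<^sub>L (real^'n)"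
  assumes N: "open N" "\<And>y. y \<in> N \<Longrightarrow> g (to_torus y) = to_torus (G y)"
    and G': "\<And>y. y \<in> N \<Longrightarrow> (G has_derivative blinfun_apply (G' y)) (at y)" "continuous_on N G'"
    and J: "\<And>y. y \<in> N \<Longrightarrow> J (to_torus y) = \<bar>R y\<bar>" "\<And>y. y \<in> N \<Longrightarrow> R y \<noteq> 0"
    and R': "\<And>y. y \<in> N \<Longrightarrow> (R has_derivative blinfun_apply (R' y)) (at y)" "continuous_on N R'"
    and y: "y \<in> N"
  shows "\<bar>R' y v\<bar> \<le> D * \<bar>R y\<bar> * norm (G' y v)"
proof (rule ccontr)
  assume "\<not> \<bar>R' y v\<bar> \<le> D * \<bar>R y\<bar> * norm (G' y v)"
  define W where "W = N \<inter> (\<lambda>y. \<bar>R' y v\<bar> - D * \<bar>R y\<bar> * norm (G' y v)) -` {0<..}"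
  have "continuous_on N R"
    using R'(1) by (auto intro!: continuous_at_imp_continuous_on has_derivative_continuous)
  then have "open W" unfolding W_def
    by (intro continuous_open_preimage continuous_intros N(1) G'(2) R'(2)) auto
  moreover have "y \<in> W" using \<open>\<not> _\<close> y by (simp add: W_def)
  moreover have "W \<subseteq> N" by (simp add: W_def)
  ultimately have "\<exists>z\<in>W. \<forall>v. \<bar>R' z v\<bar> \<le> D * \<bar>R z\<bar> * norm (G' z v)"
    by (intro jacobian_gradient_dense[OF N G'(1) J R'(1), of W]) auto
  then obtain z where "z \<in> W" "\<bar>R' z v\<bar> \<le> D * \<bar>R z\<bar> * norm (G' z v)" by blast
  then show False by (simp add: W_def)
qed

text \<open>Expansion bounds the derivative of \<open>H\<close> by \<open>1 / \<sigma>\<close>. The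
  gradient of the logarithm of the Jacobian along \<open>H\<close> is \<open>R'\<close> applied to
  the inverse of \<open>G'\<close>, divided by \<open>R\<close>. As \<open>jacobian_gradient\<close>
  measures directions by \<open>norm (G' y v)\<close>, the inverse cancels, and the constant in
  image coordinates is \<open>D\<close> itself.\<close>

lemma local_branch_chart:
  obtains N s G G' H where "open N" "x \<in> N" "N \<subseteq> ball x (1/4)" "0 < s" "s \<le> 1/4"
    "homeomorphism N (ball (G x) s) G H"
    "\<And>y. y \<in> N \<Longrightarrow> g (to_torus y) = to_torus (G y)"
    "\<And>y. y \<in> N \<Longrightarrow> (G has_derivative blinfun_apply (G' y)) (at y)"
    "continuous_on N G'"
    "\<And>y. y \<in> N \<Longrightarrow> J (to_torus y) = \<bar>det (matrix (blinfun_apply (G' y)))\<bar>"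
    "\<And>y. y \<in> N \<Longrightarrow> 0 < J (to_torus y)"
    "\<And>y z. y \<in> ball (G x) s \<Longrightarrow> z \<in> ball (G x) s \<Longrightarrow> dist (H y) (H z) \<le> dist y z / \<sigma>"
    "\<And>y z. y \<in> ball (G x) s \<Longrightarrow> z \<in> ball (G x) s \<Longrightarrow>
       J (to_torus (H y)) \<le> exp (D * dist y z) * J (to_torus (H z))"
proof (rule local_chart[of x])
  fix N s G G' R' H
  assume N: "open N" "x \<in> N" "N \<subseteq> ball x (1/4)" and s: "0 < s" "s \<le> 1/4"
    and hom: "homeomorphism N (ball (G x) s) G H"
    and gG: "\<And>y. y \<in> N \<Longrightarrow> g (to_torus y) = to_torus (G y)"
    and G': "\<And>y. y \<in> N \<Longrightarrow> (G has_derivative blinfun_apply (G' y)) (at y)" "continuous_on N G'"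
    and der: "\<And>y. y \<in> N \<Longrightarrow> torus_derivative g (to_torus y) = blinfun_apply (G' y)"
    and det: "\<And>y. y \<in> N \<Longrightarrow> det (matrix (blinfun_apply (G' y))) \<noteq> 0"
    and H': "\<And>z. z \<in> ball (G x) s \<Longrightarrow> (H has_derivative inv (blinfun_apply (G' (H z)))) (at z)"
    and bij: "\<And>y. y \<in> N \<Longrightarrow> bij (blinfun_apply (G' y))"
    and R': "\<And>y. y \<in> N \<Longrightarrow> ((\<lambda>y. det (matrix (blinfun_apply (G' y)))) has_derivative blinfun_apply (R' y)) (at y)"
      "continuous_on N R'"
  let ?B = "ball (G x) s"
  define R where "R y = det (matrix (blinfun_apply (G' y)))" for y
  have JR: "J (to_torus y) = \<bar>R y\<bar>" if "y \<in> N" for y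
    by (simp add: torus_jacobian_def der[OF that] R_def)
  have Rnz: "R y \<noteq> 0" if "y \<in> N" for y using det[OF that] by (simp add: R_def)
  have R'': "(R has_derivative blinfun_apply (R' y)) (at y)" if "y \<in> N" for y
    using R'(1)[OF that] by (simp add: R_def[abs_def])
  have HN: "H z \<in> N" if "z \<in> ?B" for z using hom that by (auto simp: homeomorphism_def)
  have inv: "blinfun_apply (G' (H z)) (inv (blinfun_apply (G' (H z))) v) = v" if "z \<in> ?B" for z v
    using bij[OF HN[OF that]] by (simp add: bij_def surj_f_inv_f)
  have Hlip: "dist (H y) (H z) \<le> dist y z / \<sigma>" if "y \<in> ?B" "z \<in> ?B" for y z
  proof -
    have "norm (H y - H z) \<le> (1 / \<sigma>) * norm (y - z)"
    proof (rule differentiable_bound[OF convex_ball _ _ that(1) that(2)])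
      show "(H has_derivative inv (blinfun_apply (G' (H w)))) (at w within ?B)" if "w \<in> ?B" for w
        using H'[OF that] by (rule has_derivative_at_withinI)
      show "onorm (inv (blinfun_apply (G' (H w)))) \<le> 1 / \<sigma>" if "w \<in> ?B" for w
      proof (rule onorm_le)
        fix v
        have "\<sigma> * norm (inv (blinfun_apply (G' (H w))) v) \<le> norm v"
          using expansion[of "inv (blinfun_apply (G' (H w))) v" "to_torus (H w)"]
          by (simp add: der[OF HN[OF that]] inv[OF that])
        then show "norm (inv (blinfun_apply (G' (H w))) v) \<le> 1 / \<sigma> * norm v"
          using \<sigma>_gt_1 by (simp add: field_simps)
      qed
    qed
    then show ?thesis by (simp add: dist_norm)
  qed
  have Jlip: "J (to_torus (H y)) \<le> exp (D * dist y z) * J (to_torus (H z))" if yz: "y \<in> ?B" "z \<in> ?B" for y z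
  proof -
    \<comment> \<open>Half the logarithm of the square is the logarithm of the absolute value, in a
      form that can be differentiated without a case split on the sign of the determinant.\<close>
    define q where "q w = ln ((R (H w))\<^sup>2) / 2" for w
    define q' where "q' w v = R' (H w) (inv (blinfun_apply (G' (H w))) v) / R (H w)" for w v
    have q': "(q has_derivative q' w) (at w)" if w: "w \<in> ?B" for w
    proof -
      have nz: "R (H w) \<noteq> 0" using Rnz[OF HN[OF w]] .
      have 1: "((\<lambda>w. R (H w)) has_derivative (\<lambda>v. R' (H w) (inv (blinfun_apply (G' (H w))) v))) (at w)"
        by (rule has_derivative_compose[OF H'[OF w] R''[OF HN[OF w]]])
      have "(q has_derivative (\<lambda>v. (R (H w) * R' (H w) (inv (blinfun_apply (G' (H w))) v) +
          R' (H w) (inv (blinfun_apply (G' (H w))) v) * R (H w)) * inverse (R (H w) * R (H w)) / 2)) (at w)"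
        unfolding q_def[abs_def] power2_eq_square
        by (intro bounded_linear.has_derivative[OF bounded_linear_divide] has_derivative_ln has_derivative_mult 1)
           (use nz in \<open>auto simp: zero_less_mult_iff linorder_neq_iff\<close>)
      moreover have "(\<lambda>v. (R (H w) * R' (H w) (inv (blinfun_apply (G' (H w))) v) +
          R' (H w) (inv (blinfun_apply (G' (H w))) v) * R (H w)) * inverse (R (H w) * R (H w)) / 2) = q' w"
        using nz by (auto simp: q'_def fun_eq_iff field_simps)
      ultimately show ?thesis by simp
    qed
    have "norm (q y - q z) \<le> D * norm (y - z)"
    proof (rule differentiable_bound[OF convex_ball _ _ yz(1) yz(2)])
      show "(q has_derivative q' w) (at w within ?B)" if "w \<in> ?B" for w
        using q'[OF that] by (rule has_derivative_at_withinI)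
      show "onorm (q' w) \<le> D" if w: "w \<in> ?B" for w
      proof (rule onorm_le)
        fix v
        have "\<bar>R' (H w) (inv (blinfun_apply (G' (H w))) v)\<bar> \<le>
            D * \<bar>R (H w)\<bar> * norm (blinfun_apply (G' (H w)) (inv (blinfun_apply (G' (H w))) v))"
          by (rule jacobian_gradient[OF N(1) gG G' JR Rnz R'' R'(2) HN[OF w]])
        then show "norm (q' w v) \<le> D * norm v"
          using Rnz[OF HN[OF w]] by (simp add: q'_def inv[OF w] field_simps)
      qed
    qed
    then have "q y - q z \<le> D * dist y z" by (simp add: dist_norm abs_le_iff)
    moreover have qln: "q w = ln \<bar>R (H w)\<bar>" if "w \<in> ?B" for w
    proof -
      have "ln ((R (H w))\<^sup>2) = ln (\<bar>R (H w)\<bar> ^ 2)" by simp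
      also have "\<dots> = 2 * ln \<bar>R (H w)\<bar>" using Rnz[OF HN[OF that]] by (subst ln_realpow) auto
      finally show ?thesis by (simp add: q_def)
    qed
    ultimately have "ln \<bar>R (H y)\<bar> \<le> D * dist y z + ln \<bar>R (H z)\<bar>" using qln yz by simp
    then have "exp (ln \<bar>R (H y)\<bar>) \<le> exp (D * dist y z + ln \<bar>R (H z)\<bar>)" by simp
    then show ?thesis using Rnz HN yz by (simp add: exp_add JR)
  qed
  show thesis
  proof (rule that[OF N s hom gG G'])
    show "J (to_torus y) = \<bar>det (matrix (blinfun_apply (G' y)))\<bar>" if "y \<in> N" for y
      using JR[OF that] by (simp add: R_def)
    show "0 < J (to_torus y)" if "y \<in> N" for y using JR[OF that] Rnz[OF that] by simp
    show "dist (H y) (H z) \<le> dist y z / \<sigma>" if "y \<in> ?B" "z \<in> ?B" for y z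
      by (rule Hlip[OF that])
    show "J (to_torus (H y)) \<le> exp (D * dist y z) * J (to_torus (H z))" if "y \<in> ?B" "z \<in> ?B" for y z
      by (rule Jlip[OF that])
  qed
qed

end

section \<open>The transfer operator\<close>

text \<open>Both sides integrate \<open>w\<close>, one against Lebesgue measure on \<open>B\<close>,
  the other against the push-forward of the Jacobian density; so it suffices that these two measures
  agree on sets. Extension by 0 outside \<open>N\<close> makes \<open>G0\<close> and
  \<open>r\<close> measurable on the whole space.\<close>

lemma nn_integral_change_of_variables:
  fixes G :: "real^'n::finite \<Rightarrow> real^'n" and G' :: "real^'n \<Rightarrow> (real^'n) \<Rightarrow>\<^sub>L (real^'n)"
  assumes N: "open N" and B [measurable]: "B \<in> sets borel" and bB: "bounded B"
    and img: "G ` N = B" and inj: "inj_on G N"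
    and der: "\<And>y. y \<in> N \<Longrightarrow> (G has_derivative blinfun_apply (G' y)) (at y)"
    and cont: "continuous_on N G'"
    and w [measurable]: "w \<in> borel_measurable borel"
  shows "(\<integral>\<^sup>+z. w z * indicator B z \<partial>lborel) =
    (\<integral>\<^sup>+y. w (G y) * ennreal \<bar>det (matrix (blinfun_apply (G' y)))\<bar> * indicator N y \<partial>lborel)"
proof -
  note [measurable] = borel_open[OF N]
  define G0 where "G0 y = (if y \<in> N then G y else 0)" for y
  define r where "r y = (if y \<in> N then \<bar>det (matrix (blinfun_apply (G' y)))\<bar> else 0)" for y
  have "continuous_on N G"
    using der by (auto intro!: continuous_at_imp_continuous_on has_derivative_continuous)
  then have [measurable]: "G0 \<in> borel_measurable borel"
    unfolding G0_def[abs_def] by (intro borel_measurable_continuous_on_if) auto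
  have "continuous_on N (\<lambda>y. \<bar>det (matrix (blinfun_apply (G' y)))\<bar>)"
    unfolding det_def matrix_def by (simp, intro continuous_intros cont)
  then have [measurable]: "r \<in> borel_measurable borel"
    unfolding r_def[abs_def] by (intro borel_measurable_continuous_on_if) auto
  have "density lborel (indicator B) = distr (density lborel (\<lambda>y. ennreal (r y))) borel G0" (is "?L = ?R")
  proof (rule measure_eqI)
    fix A assume "A \<in> sets ?L"
    then have A [measurable]: "A \<in> sets borel" by simp
    define S where "S = N \<inter> G0 -` A"
    have S [measurable]: "S \<in> sets borel" unfolding S_def using measurable_sets_borel[of G0 borel A] by auto
    have GS: "G ` S = B \<inter> A" using img by (auto simp: S_def G0_def)
    have rS: "r y * indicator S y = \<bar>det (matrix (blinfun_apply (G' y)))\<bar> * indicator S y" for y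
      by (auto simp: r_def S_def indicator_def)
    have "emeasure ?L A = emeasure lborel (G ` S)"
      by (simp add: emeasure_density GS nn_integral_cmult_indicator flip: indicator_inter_arith)
    also have "\<dots> = (\<integral>\<^sup>+y. ennreal (\<bar>det (matrix (blinfun_apply (G' y)))\<bar> * indicator S y) \<partial>lborel)"
    proof (rule emeasure_differentiable_image[OF S])
      show "G ` S \<in> sets borel" "bounded (G ` S)" using GS bB bounded_subset by (auto simp: GS)
      show "(G has_derivative blinfun_apply (G' y)) (at y)" if "y \<in> S" for y
        using that der by (simp add: S_def)
      show "inj_on G S" using inj by (rule inj_on_subset) (simp add: S_def)
      have "(\<lambda>y. r y * indicator S y) \<in> borel_measurable borel" by measurable
      then show "(\<lambda>y. \<bar>det (matrix (blinfun_apply (G' y)))\<bar> * indicator S y) \<in> borel_measurable borel"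
        by (simp add: rS)
    qed
    also have "\<dots> = (\<integral>\<^sup>+y. ennreal (r y) * indicator (G0 -` A) y \<partial>lborel)"
      by (intro nn_integral_cong) (auto simp: r_def S_def indicator_def)
    also have "\<dots> = emeasure ?R A"
      using measurable_sets_borel[of G0 borel A] by (subst emeasure_distr) (auto simp: emeasure_density)
    finally show "emeasure ?L A = emeasure ?R A" .
  qed simp
  then have "(\<integral>\<^sup>+z. w z \<partial>?L) = (\<integral>\<^sup>+z. w z \<partial>?R)" by simp
  moreover have "(\<integral>\<^sup>+z. w z \<partial>?L) = (\<integral>\<^sup>+z. w z * indicator B z \<partial>lborel)"
    by (subst nn_integral_density) (auto simp: mult.commute)
  moreover have "(\<integral>\<^sup>+z. w z \<partial>?R) = (\<integral>\<^sup>+y. ennreal (r y) * w (G0 y) \<partial>lborel)"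
    by (subst nn_integral_distr, simp, simp, subst nn_integral_density) auto
  moreover have "\<dots> = (\<integral>\<^sup>+y. w (G y) * ennreal \<bar>det (matrix (blinfun_apply (G' y)))\<bar> * indicator N y \<partial>lborel)"
    by (intro nn_integral_cong) (auto simp: r_def G0_def indicator_def mult.commute)
  ultimately show ?thesis by simp
qed

lemma continuous_on_torusI:
  fixes f :: "('n::finite) torus \<Rightarrow> 'b::metric_space"
  assumes "\<And>x. isCont (\<lambda>y. f (to_torus y)) x"
  shows "continuous_on UNIV f"
  unfolding continuous_on_iff
proof (intro ballI allI impI)
  fix p :: "'n torus" and e :: real assume e: "0 < e"
  obtain x where x: "to_torus x = p" using to_torus_surj by blast
  obtain d where d: "d > 0" "\<And>y. dist y x < d \<Longrightarrow> dist (f (to_torus y)) (f (to_torus x)) < e"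
    using assms[of x] e unfolding continuous_at by (force simp: LIM_def)
  show "\<exists>d>0. \<forall>q\<in>UNIV. dist q p < d \<longrightarrow> dist (f q) (f p) < e"
  proof (intro exI[of _ d] conjI ballI impI d(1))
    fix q assume "dist q p < d"
    then obtain y where "to_torus y = q" "dist x y < d"
      using dist_torus_lessD[of x q d] x by (auto simp: dist_commute)
    then show "dist (f q) (f p) < e" using d(2)[of y] x by (simp add: dist_commute)
  qed
qed

context expanding_torus_map
begin

definition transfer :: "('n torus \<Rightarrow> real) \<Rightarrow> 'n torus \<Rightarrow> real" where
  "transfer u \<omega> = (\<Sum>p\<in>g -` {\<omega>}. u p / J p)"

text \<open>The extended nonnegative copy of \<open>transfer\<close>, for which countable
  decompositions raise no question of integrability; \<open>ennreal_transfer\<close> leads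
  back.\<close>

definition etransfer :: "('n torus \<Rightarrow> ennreal) \<Rightarrow> 'n torus \<Rightarrow> ennreal" where
  "etransfer v \<omega> = (\<Sum>p\<in>g -` {\<omega>}. v p * ennreal (1 / J p))"

lemma J_pos: "0 < J p"
proof -
  obtain x where x: "to_torus x = p" using to_torus_surj by blast
  show ?thesis by (rule local_branch_chart[of x]) (use x in blast)
qed

lemma continuous_J: "continuous_on UNIV J"
proof (rule continuous_on_torusI)
  fix x :: "real^'n"
  show "isCont (\<lambda>y. J (to_torus y)) x"
  proof (rule local_branch_chart[of x])
    fix N s G G' H
    assume N: "open N" "x \<in> N" and c: "continuous_on N G'"
      and J: "\<And>y. y \<in> N \<Longrightarrow> J (to_torus y) = \<bar>det (matrix (blinfun_apply (G' y)))\<bar>"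
    have "continuous_on N (\<lambda>y. \<bar>det (matrix (blinfun_apply (G' y)))\<bar>)"
      unfolding det_def matrix_def by (simp, intro continuous_intros c)
    then have "continuous_on N (\<lambda>y. J (to_torus y))" using J by (simp cong: continuous_on_cong)
    then show ?thesis using N continuous_on_eq_continuous_at by blast
  qed
qed

lemma continuous_g: "continuous_on UNIV g"
proof (rule continuous_on_torusI)
  fix x :: "real^'n"
  show "isCont (\<lambda>y. g (to_torus y)) x"
  proof (rule local_branch_chart[of x])
    fix N s G G' H
    assume N: "open N" "x \<in> N" and h: "homeomorphism N (ball (G x) s) G H"
      and g: "\<And>y. y \<in> N \<Longrightarrow> g (to_torus y) = to_torus (G y)"
    have "continuous_on N (\<lambda>y. to_torus (G y))"
      using h by (intro continuous_on_compose2[OF continuous_to_torus[of UNIV]]) (auto simp: homeomorphism_def)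
    then have "continuous_on N (\<lambda>y. g (to_torus y))" using g by (simp cong: continuous_on_cong)
    then show ?thesis using N continuous_on_eq_continuous_at by blast
  qed
qed

lemma measurable_J [measurable]: "J \<in> borel_measurable borel"
  using continuous_J by (rule borel_measurable_continuous_onI)

lemma measurable_g [measurable]: "g \<in> borel_measurable borel"
  using continuous_g by (rule borel_measurable_continuous_onI)

text \<open>Each piece of the partition holds exactly one preimage of a point. That the number is
  the same everywhere later replaces a covering-space argument: as many distinct nearby preimages as
  a fiber has elements must be the whole fiber.\<close>

lemma fiber_card: "\<exists>d>0. \<forall>\<omega>. finite (g -` {\<omega>}) \<and> card (g -` {\<omega>}) = d"
proof (rule branches)
  fix d :: nat and I
  assume dI: "(\<Union>i<d. I i) = UNIV" "disjoint_family_on I {..<d}"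
    and bij: "\<And>i. i < d \<Longrightarrow> bij_betw g (I i) UNIV"
  let ?k = "\<lambda>\<omega> i. inv_into (I i) g \<omega>"
  have k: "?k \<omega> i \<in> I i" "g (?k \<omega> i) = \<omega>" if "i < d" for i \<omega>
    using bij[OF that] by (auto simp: bij_betw_def inv_into_into f_inv_into_f)
  have eq: "g -` {\<omega>} = ?k \<omega> ` {..<d}" for \<omega>
  proof (intro set_eqI iffI)
    fix p assume p: "p \<in> g -` {\<omega>}"
    obtain i where i: "i < d" "p \<in> I i" using dI(1) by blast
    then have "?k \<omega> i = p" using bij[OF i(1)] p by (auto simp: bij_betw_def)
    then show "p \<in> ?k \<omega> ` {..<d}" using i by blast
  qed (use k in auto)
  have "inj_on (?k \<omega>) {..<d}" for \<omega>
  proof (rule inj_onI)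
    fix i j assume ij: "i \<in> {..<d}" "j \<in> {..<d}" "?k \<omega> i = ?k \<omega> j"
    then have "?k \<omega> i \<in> I i \<inter> I j" using k(1)[of i \<omega>] k(1)[of j \<omega>] by auto
    then show "i = j" using dI(2) ij(1,2) unfolding disjoint_family_on_def by blast
  qed
  then have "finite (g -` {\<omega>}) \<and> card (g -` {\<omega>}) = d" for \<omega> by (simp add: eq card_image)
  moreover have "d > 0" using dI(1) by (cases d) auto
  ultimately show ?thesis by blast
qed

lemma finite_fiber [simp]: "finite (g -` {\<omega>})"
  using fiber_card by blast

lemma fiber_nonempty: "g -` {\<omega>} \<noteq> {}"
  using fiber_card by (metis card.empty less_irrefl)

lemma local_branch:
  "\<exists>s>0. \<exists>k. \<forall>\<omega>\<in>ball (g p) s. g (k \<omega>) = \<omega> \<and> dist (k \<omega>) p \<le> dist (g p) \<omega> / \<sigma> \<and>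
     J (k \<omega>) \<le> exp (D * dist (g p) \<omega>) * J p \<and> J p \<le> exp (D * dist (g p) \<omega>) * J (k \<omega>)"
proof -
  obtain x where x: "to_torus x = p" using to_torus_surj by blast
  show ?thesis
  proof (rule local_branch_chart[of x])
    fix N s G G' H
    assume N: "open N" "x \<in> N" and s: "0 < s" "s \<le> 1/4"
      and hom: "homeomorphism N (ball (G x) s) G H"
      and g: "\<And>y. y \<in> N \<Longrightarrow> g (to_torus y) = to_torus (G y)"
      and H: "\<And>y z. y \<in> ball (G x) s \<Longrightarrow> z \<in> ball (G x) s \<Longrightarrow> dist (H y) (H z) \<le> dist y z / \<sigma>"
      and J: "\<And>y z. y \<in> ball (G x) s \<Longrightarrow> z \<in> ball (G x) s \<Longrightarrow>
         J (to_torus (H y)) \<le> exp (D * dist y z) * J (to_torus (H z))"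
    have gp: "g p = to_torus (G x)" using g[OF N(2)] x by simp
    have Hx: "H (G x) = x" using hom N(2) by (simp add: homeomorphism_def)
    have "\<exists>q. g q = \<omega> \<and> dist q p \<le> dist (g p) \<omega> / \<sigma> \<and>
       J q \<le> exp (D * dist (g p) \<omega>) * J p \<and> J p \<le> exp (D * dist (g p) \<omega>) * J q" if \<omega>: "\<omega> \<in> ball (g p) s" for \<omega>
    proof -
      obtain z where z: "to_torus z = \<omega>" "dist (G x) z < s"
        using \<omega> dist_torus_lessD[of "G x" \<omega> s] gp by auto
      have d: "dist (g p) \<omega> = dist (G x) z"
        unfolding gp z(1)[symmetric] using z(2) s by (intro dist_to_torus_eq) auto
      have zB: "z \<in> ball (G x) s" "G x \<in> ball (G x) s" using z s by auto
      have HzN: "H z \<in> N" "G (H z) = z" using hom zB by (auto simp: homeomorphism_def)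
      show ?thesis
      proof (intro exI[of _ "to_torus (H z)"] conjI)
        show "g (to_torus (H z)) = \<omega>" using g[OF HzN(1)] HzN(2) z(1) by simp
        have "dist (to_torus (H z)) p \<le> dist (H z) x" unfolding x[symmetric] by (rule dist_torus_le)
        also have "\<dots> \<le> dist z (G x) / \<sigma>" using H[OF zB] Hx by simp
        finally show "dist (to_torus (H z)) p \<le> dist (g p) \<omega> / \<sigma>" by (simp add: d dist_commute[of z])
        show "J (to_torus (H z)) \<le> exp (D * dist (g p) \<omega>) * J p"
          using J[OF zB] Hx x by (simp add: d dist_commute[of z])
        show "J p \<le> exp (D * dist (g p) \<omega>) * J (to_torus (H z))"
          using J[OF zB(2,1)] Hx x by (simp add: d)
      qed
    qed
    then show ?thesis using s(1) by (intro exI[of _ s] conjI) (assumption, metis)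
  qed
qed

text \<open>Every preimage \<open>p\<close> of a point continues to a preimage
  \<open>k p \<omega>\<close> of a nearby point \<omega>. The Jacobian contributes \<open>D\<close>,
  and \<open>u\<close> contributes \<open>A / \<sigma>\<close>, because the preimages are at least
  \<sigma> times closer than their images. The comparison is term by term, which keeps the constant
  free of the number of branches.\<close>

lemma transfer_loglip:
  assumes u: "loglip A u" and A: "0 \<le> A"
  shows "loglip (D + A / \<sigma>) (transfer u)"
proof (rule loglip_local_imp_global)
  have up: "0 < u p" for p using u by (rule loglip_pos)
  show "0 < transfer u \<omega>" for \<omega>
    unfolding transfer_def using fiber_nonempty up J_pos by (intro sum_pos) auto
  show "0 \<le> D + A / \<sigma>" using D_pos A \<sigma>_gt_1 by simp
  fix \<omega>0
  let ?P = "g -` {\<omega>0}"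
  obtain s k where sk: "\<And>p. 0 < s p" "\<And>p \<omega>. \<omega> \<in> ball (g p) (s p) \<Longrightarrow> g (k p \<omega>) = \<omega> \<and> dist (k p \<omega>) p \<le> dist (g p) \<omega> / \<sigma> \<and>
     J (k p \<omega>) \<le> exp (D * dist (g p) \<omega>) * J p \<and> J p \<le> exp (D * dist (g p) \<omega>) * J (k p \<omega>)"
    using local_branch by metis
  have "\<exists>\<delta>>0. \<forall>p\<in>?P. \<forall>q\<in>?P. p \<noteq> q \<longrightarrow> \<delta> \<le> dist p q"
  proof -
    have "\<exists>\<delta>>0. \<forall>q\<in>?P. p \<noteq> q \<longrightarrow> \<delta> \<le> dist p q" for p
      using finite_set_avoid[OF finite_fiber[of \<omega>0], of p] by metis
    then obtain \<delta> where \<delta>: "\<And>p. 0 < \<delta> p" "\<And>p q. q \<in> ?P \<Longrightarrow> p \<noteq> q \<Longrightarrow> \<delta> p \<le> dist p q" by metis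
    show ?thesis
    proof (intro exI[of _ "Min (\<delta> ` ?P)"] conjI ballI impI)
      show "0 < Min (\<delta> ` ?P)" using \<delta>(1) fiber_nonempty by (subst Min_gr_iff) auto
      fix p q assume pq: "p \<in> ?P" "q \<in> ?P" "p \<noteq> q"
      have "Min (\<delta> ` ?P) \<le> \<delta> p" using pq(1) by (intro Min_le) auto
      also have "\<dots> \<le> dist p q" using pq by (intro \<delta>(2))
      finally show "Min (\<delta> ` ?P) \<le> dist p q" .
    qed
  qed
  then obtain \<delta> where \<delta>: "\<delta> > 0" "\<And>p q. p \<in> ?P \<Longrightarrow> q \<in> ?P \<Longrightarrow> p \<noteq> q \<Longrightarrow> \<delta> \<le> dist p q" by blast
  \<comment> \<open>Below every \<open>s p\<close> all continuations exist, and below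
    \<open>\<delta> / 2\<close> the continuations of different preimages cannot meet.\<close>
  define r where "r = min (Min (s ` ?P)) (\<delta> / 2)"
  have r: "r > 0" "\<And>p. p \<in> ?P \<Longrightarrow> r \<le> s p" "r \<le> \<delta> / 2"
    using sk(1) \<delta>(1) fiber_nonempty by (auto simp: r_def Min_gr_iff intro: min.coboundedI1 Min_le)
  have main: "transfer u \<omega>0 \<le> exp ((D + A / \<sigma>) * dist \<omega>0 \<omega>) * transfer u \<omega> \<and>
      transfer u \<omega> \<le> exp ((D + A / \<sigma>) * dist \<omega>0 \<omega>) * transfer u \<omega>0" if \<omega>: "dist \<omega>0 \<omega> < r" for \<omega>
  proof -
    let ?e = "exp ((D + A / \<sigma>) * dist \<omega>0 \<omega>)"
    have k: "g (k p \<omega>) = \<omega>" "dist (k p \<omega>) p \<le> dist \<omega>0 \<omega> / \<sigma>"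
      "J (k p \<omega>) \<le> exp (D * dist \<omega>0 \<omega>) * J p" "J p \<le> exp (D * dist \<omega>0 \<omega>) * J (k p \<omega>)" if "p \<in> ?P" for p
      using sk(2)[of \<omega> p] r(2)[OF that] \<omega> that by auto
    have small: "dist \<omega>0 \<omega> / \<sigma> < \<delta> / 2"
    proof -
      have "dist \<omega>0 \<omega> / \<sigma> \<le> dist \<omega>0 \<omega> / 1" using \<sigma>_gt_1 by (intro divide_left_mono) auto
      also have "\<dots> < \<delta> / 2" using \<omega> r(3) by simp
      finally show ?thesis .
    qed
    have inj: "inj_on (\<lambda>p. k p \<omega>) ?P"
    proof (rule inj_onI, rule ccontr)
      fix p q assume pq: "p \<in> ?P" "q \<in> ?P" "k p \<omega> = k q \<omega>" "p \<noteq> q"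
      have "dist p q \<le> dist (k p \<omega>) p + dist (k q \<omega>) q" using dist_triangle3[of p q "k p \<omega>"] pq(3) by simp
      also have "\<dots> < \<delta>" using k(2)[OF pq(1)] k(2)[OF pq(2)] small by linarith
      finally show False using \<delta>(2)[OF pq(1,2,4)] by simp
    qed
    obtain d where d: "\<And>\<omega>. finite (g -` {\<omega>}) \<and> card (g -` {\<omega>}) = d" using fiber_card by blast
    \<comment> \<open>Injectivity together with the constant fiber size shows that no preimage is
      missed.\<close>
    have img: "(\<lambda>p. k p \<omega>) ` ?P = g -` {\<omega>}"
      by (rule card_subset_eq) (use d k(1) in \<open>auto simp: card_image[OF inj]\<close>)
    have eq: "transfer u \<omega> = (\<Sum>p\<in>?P. u (k p \<omega>) / J (k p \<omega>))"
      unfolding transfer_def img[symmetric] by (subst sum.reindex[OF inj]) simp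
    have ul: "exp (A * dist (k p \<omega>) p) \<le> exp (A / \<sigma> * dist \<omega>0 \<omega>)" if "p \<in> ?P" for p
      using mult_left_mono[OF k(2)[OF that] A] by simp
    have "u p / J p \<le> ?e * (u (k p \<omega>) / J (k p \<omega>))" if p: "p \<in> ?P" for p
    proof -
      have "u p \<le> exp (A * dist p (k p \<omega>)) * u (k p \<omega>)" using u by (rule loglipD)
      also have "\<dots> \<le> exp (A / \<sigma> * dist \<omega>0 \<omega>) * u (k p \<omega>)"
        using ul[OF p] up[of "k p \<omega>"] by (intro mult_right_mono) (auto simp: dist_commute)
      finally have "u p * J (k p \<omega>) \<le> (exp (A / \<sigma> * dist \<omega>0 \<omega>) * u (k p \<omega>)) * (exp (D * dist \<omega>0 \<omega>) * J p)"
        using k(3)[OF p] up[of p] J_pos up[of "k p \<omega>"] by (intro mult_mono) (auto simp: less_imp_le)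
      also have "\<dots> = ?e * u (k p \<omega>) * J p" by (simp add: distrib_right exp_add)
      finally show ?thesis using J_pos[of p] J_pos[of "k p \<omega>"] by (simp add: field_simps)
    qed
    moreover have "u (k p \<omega>) / J (k p \<omega>) \<le> ?e * (u p / J p)" if p: "p \<in> ?P" for p
    proof -
      have "u (k p \<omega>) \<le> exp (A * dist (k p \<omega>) p) * u p" using u by (rule loglipD)
      also have "\<dots> \<le> exp (A / \<sigma> * dist \<omega>0 \<omega>) * u p"
        using ul[OF p] up[of p] by (intro mult_right_mono) auto
      finally have "u (k p \<omega>) * J p \<le> (exp (A / \<sigma> * dist \<omega>0 \<omega>) * u p) * (exp (D * dist \<omega>0 \<omega>) * J (k p \<omega>))"
        using k(4)[OF p] up[of p] J_pos up[of "k p \<omega>"] by (intro mult_mono) (auto simp: less_imp_le)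
      also have "\<dots> = ?e * u p * J (k p \<omega>)" by (simp add: distrib_right exp_add)
      finally show ?thesis using J_pos[of p] J_pos[of "k p \<omega>"] by (simp add: field_simps)
    qed
    ultimately show ?thesis unfolding eq by (auto simp: transfer_def sum_distrib_left intro!: sum_mono)
  qed
  have "\<forall>\<^sub>F \<omega> in nhds \<omega>0. dist \<omega>0 \<omega> < r"
    using r(1) unfolding eventually_nhds_metric by (auto simp: dist_commute)
  then show "\<forall>\<^sub>F \<omega> in nhds \<omega>0. transfer u \<omega>0 \<le> exp ((D + A / \<sigma>) * dist \<omega>0 \<omega>) * transfer u \<omega> \<and>
      transfer u \<omega> \<le> exp ((D + A / \<sigma>) * dist \<omega>0 \<omega>) * transfer u \<omega>0"
    by eventually_elim (rule main)
qed

text \<open>Inside a chart at most one preimage of a point falls into \<open>E\<close>, so the sum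
  has a single term and the identity is the change of variables for one branch. The explicit form of
  that term also yields measurability, which is not visible in a sum over an abstract fiber.\<close>

lemma etransfer_local:
  "\<exists>W. open W \<and> p \<in> W \<and> (\<forall>E\<in>sets borel. \<forall>v\<in>borel_measurable borel. E \<subseteq> W \<longrightarrow>
     etransfer (\<lambda>q. v q * indicator E q) \<in> borel_measurable borel \<and>
     (\<integral>\<^sup>+\<omega>. etransfer (\<lambda>q. v q * indicator E q) \<omega> \<partial>lebesgue_torus) =
     (\<integral>\<^sup>+\<omega>. v \<omega> * indicator E \<omega> \<partial>lebesgue_torus))"
proof -
  obtain x where x: "to_torus x = p" using to_torus_surj by blast
  show ?thesis
  proof (rule local_branch_chart[of x])
    fix N s G G' H
    assume N: "open N" "x \<in> N" "N \<subseteq> ball x (1/4)" and s: "0 < s" "s \<le> 1/4"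
      and hom: "homeomorphism N (ball (G x) s) G H"
      and g: "\<And>y. y \<in> N \<Longrightarrow> g (to_torus y) = to_torus (G y)"
      and G': "\<And>y. y \<in> N \<Longrightarrow> (G has_derivative blinfun_apply (G' y)) (at y)" "continuous_on N G'"
      and J: "\<And>y. y \<in> N \<Longrightarrow> J (to_torus y) = \<bar>det (matrix (blinfun_apply (G' y)))\<bar>"
    let ?B = "ball (G x) s"
    define W where "W = to_torus ` N"
    define O' where "O' = to_torus ` ?B"
    define l where "l = inv_into ?B to_torus"
    define k where "k \<omega> = (if \<omega> \<in> O' then to_torus (H (l \<omega>)) else p)" for \<omega>
    note [measurable] = borel_open[OF N(1)]
    have oW: "open W" "open O'" unfolding W_def O'_def using N(1) open_to_torus by blast+
    note [measurable] = borel_open[OF oW(1)] borel_open[OF oW(2)]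
    have injN: "inj_on to_torus N"
      by (rule inj_on_subset[OF inj_on_to_torus_ball N(3)]) simp
    have injB: "inj_on to_torus ?B"
      by (rule inj_on_to_torus_ball) (use s in simp)
    have HN: "H z \<in> N" "G (H z) = z" if "z \<in> ?B" for z using hom that by (auto simp: homeomorphism_def)
    have GN: "G y \<in> ?B" "H (G y) = y" if "y \<in> N" for y using hom that by (auto simp: homeomorphism_def)
    have l: "l (to_torus z) = z" if "z \<in> ?B" for z using that injB by (simp add: l_def)
    have kz: "k (to_torus z) = to_torus (H z)" if "z \<in> ?B" for z
      using l[OF that] that by (auto simp: k_def O'_def)
    have lB: "l \<omega> \<in> ?B" "to_torus (l \<omega>) = \<omega>" if "\<omega> \<in> O'" for \<omega>
      using inv_into_into[of \<omega> to_torus ?B] f_inv_into_f[of \<omega> to_torus ?B] that unfolding l_def O'_def by auto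
    have liso: "dist (l a) (l b) = dist a b" if "a \<in> O'" "b \<in> O'" for a b
    proof -
      have "dist (l a) (l b) < 1/2"
        using lB(1)[OF that(1)] lB(1)[OF that(2)] s dist_triangle3[of "l a" "l b" "G x"]
        by (auto simp: dist_commute)
      from dist_to_torus_eq[OF this] show ?thesis using lB(2) that by simp
    qed
    have cl: "continuous_on O' l"
      unfolding continuous_on_iff using liso by (metis)
    have "continuous_on O' (\<lambda>\<omega>. to_torus (H (l \<omega>)))"
      using hom lB(1)
      by (intro continuous_on_compose2[OF continuous_to_torus[of UNIV]] continuous_on_compose2[OF _ cl, of ?B H])
         (auto simp: homeomorphism_def)
    then have [measurable]: "k \<in> borel_measurable borel"
      unfolding k_def[abs_def] by (intro borel_measurable_continuous_on_if) auto
    have fib: "g -` {to_torus z} \<inter> W = {to_torus (H z)}" if z: "z \<in> ?B" for z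
    proof (intro set_eqI iffI)
      fix q assume "q \<in> g -` {to_torus z} \<inter> W"
      then obtain y where y: "y \<in> N" "q = to_torus y" "g q = to_torus z" by (auto simp: W_def)
      then have "G y = z" using inj_onD[OF injB _ GN(1)[OF y(1)] z] g[OF y(1)] by simp
      then show "q \<in> {to_torus (H z)}" using GN(2)[OF y(1)] y(2) by auto
    qed (use HN[OF z] g in \<open>auto simp: W_def\<close>)
    have fib0: "g -` {\<omega>} \<inter> W = {}" if "\<omega> \<notin> O'" for \<omega>
      using that GN(1) by (auto simp: W_def O'_def g)
    show ?thesis
    proof (intro exI[of _ W] conjI ballI impI)
      show "open W" "p \<in> W" using oW(1) N(2) x by (auto simp: W_def)
      fix E :: "'n torus set" and v :: "'n torus \<Rightarrow> ennreal"
      assume E [measurable]: "E \<in> sets borel" and v [measurable]: "v \<in> borel_measurable borel" and EW: "E \<subseteq> W"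
      let ?v = "\<lambda>q. v q * indicator E q"
      let ?w = "\<lambda>q. ?v q * ennreal (1 / J q)"
      have et: "etransfer ?v \<omega> = (\<Sum>q\<in>g -` {\<omega>} \<inter> W. ?w q)" for \<omega>
        unfolding etransfer_def using EW
        by (intro sum.mono_neutral_right) (auto simp: indicator_def)
      have eq: "etransfer ?v \<omega> = ?w (k \<omega>) * indicator O' \<omega>" for \<omega>
      proof (cases "\<omega> \<in> O'")
        case True
        then obtain z where z: "z \<in> ?B" "\<omega> = to_torus z" by (auto simp: O'_def)
        show ?thesis using True unfolding et z(2) fib[OF z(1)] kz[OF z(1)] by simp
      qed (simp add: et fib0)
      show "etransfer ?v \<in> borel_measurable borel"
        unfolding eq[abs_def] by measurable
      let ?H = "\<lambda>z. ?w (k (to_torus z))"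
      have "(\<integral>\<^sup>+\<omega>. etransfer ?v \<omega> \<partial>lebesgue_torus) = (\<integral>\<^sup>+z. ?H z * indicator ?B z \<partial>lborel)"
        unfolding eq O'_def
        by (rule nn_integral_torus_inj[OF _ injB]) (use oW(2) in \<open>auto simp: O'_def\<close>)
      also have "\<dots> = (\<integral>\<^sup>+y. ?H (G y) * ennreal \<bar>det (matrix (blinfun_apply (G' y)))\<bar> * indicator N y \<partial>lborel)"
        by (rule nn_integral_change_of_variables[OF N(1) _ _ _ _ G'])
           (use hom GN in \<open>auto simp: homeomorphism_def intro!: inj_on_inverseI[where g=H]\<close>)
      also have "\<dots> = (\<integral>\<^sup>+y. ?v (to_torus y) * indicator N y \<partial>lborel)"
      proof (rule nn_integral_cong)
        fix y
        show "?H (G y) * ennreal \<bar>det (matrix (blinfun_apply (G' y)))\<bar> * indicator N y =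
          ?v (to_torus y) * indicator N y"
        proof (cases "y \<in> N")
          case True
          have "ennreal (1 / J (to_torus y)) * ennreal (J (to_torus y)) = 1"
            using J_pos[of "to_torus y"] by (simp add: ennreal_mult[symmetric])
          then show ?thesis using kz[OF GN(1)[OF True]] GN(2)[OF True] J[OF True, symmetric]
            by (simp add: mult.assoc)
        qed simp
      qed
      also have "\<dots> = (\<integral>\<^sup>+\<omega>. ?v \<omega> * indicator (to_torus ` N) \<omega> \<partial>lebesgue_torus)"
        by (rule nn_integral_torus_inj[OF _ injN, symmetric]) (use oW(1) in \<open>auto simp: W_def\<close>)
      also have "\<dots> = (\<integral>\<^sup>+\<omega>. ?v \<omega> \<partial>lebesgue_torus)"
        using EW by (intro nn_integral_cong) (auto simp: W_def[symmetric] indicator_def)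
      finally show "(\<integral>\<^sup>+\<omega>. etransfer ?v \<omega> \<partial>lebesgue_torus) = (\<integral>\<^sup>+\<omega>. ?v \<omega> \<partial>lebesgue_torus)" .
    qed
  qed
qed

text \<open>A countable subcover by charts is made disjoint, \<open>v\<close> is split accordingly,
  and the local identities are summed.\<close>

lemma etransfer:
  assumes v [measurable]: "v \<in> borel_measurable borel"
  shows "etransfer v \<in> borel_measurable borel"
    and "(\<integral>\<^sup>+\<omega>. etransfer v \<omega> \<partial>lebesgue_torus) = (\<integral>\<^sup>+\<omega>. v \<omega> \<partial>lebesgue_torus)"
proof -
  define P where "P W \<longleftrightarrow> open W \<and> (\<forall>E\<in>sets borel. E \<subseteq> W \<longrightarrow>
     etransfer (\<lambda>q. v q * indicator E q) \<in> borel_measurable borel \<and>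
     (\<integral>\<^sup>+\<omega>. etransfer (\<lambda>q. v q * indicator E q) \<omega> \<partial>lebesgue_torus) =
     (\<integral>\<^sup>+\<omega>. v \<omega> * indicator E \<omega> \<partial>lebesgue_torus))" for W
  have ex: "\<exists>W. P W \<and> p \<in> W" for p
    using etransfer_local[of p] v unfolding P_def by metis
  obtain F where F: "F \<subseteq> Collect P" "countable F" "\<Union>F = \<Union>(Collect P)"
    using Lindelof[of "Collect P"] by (auto simp: P_def)
  have "\<Union>F = UNIV" using F(3) ex by auto
  then have "F \<noteq> {}" by auto
  define W where "W n = from_nat_into F n" for n
  have W: "P (W n)" for n using F(1) from_nat_into[OF \<open>F \<noteq> {}\<close>] by (auto simp: W_def)
  have UW: "(\<Union>n. W n) = UNIV"
    using \<open>\<Union>F = UNIV\<close> range_from_nat_into[OF \<open>F \<noteq> {}\<close> F(2)] by (simp add: W_def[abs_def])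
  define E where "E = disjointed W"
  have [measurable]: "E n \<in> sets borel" for n
  proof -
    have "range W \<subseteq> sets borel" using W by (auto simp: P_def)
    from sets.range_disjointed_sets[OF this] show ?thesis by (auto simp: E_def)
  qed
  have EW: "E n \<subseteq> W n" for n unfolding E_def by (rule disjointed_subset)
  have sum1: "(\<Sum>n. indicator (E n) q) = (1::ennreal)" for q
    using suminf_indicator[OF disjoint_family_disjointed[of W], of q] UW
    by (simp add: E_def UN_disjointed_eq)
  have eq: "etransfer v \<omega> = (\<Sum>n. etransfer (\<lambda>q. v q * indicator (E n) q) \<omega>)" for \<omega>
  proof -
    have "(\<Sum>n. etransfer (\<lambda>q. v q * indicator (E n) q) \<omega>) =
      (\<Sum>q\<in>g -` {\<omega>}. \<Sum>n. v q * indicator (E n) q * ennreal (1 / J q))"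
      unfolding etransfer_def by (rule suminf_sum) auto
    also have "\<dots> = etransfer v \<omega>"
      unfolding etransfer_def by (intro sum.cong refl) (simp add: ennreal_suminf_multc ennreal_suminf_cmult sum1)
    finally show ?thesis by simp
  qed
  have m: "etransfer (\<lambda>q. v q * indicator (E n) q) \<in> borel_measurable borel" for n
    using W[of n] EW[of n] by (simp add: P_def)
  then show "etransfer v \<in> borel_measurable borel"
    unfolding eq[abs_def] by measurable
  have "(\<integral>\<^sup>+\<omega>. etransfer v \<omega> \<partial>lebesgue_torus) =
      (\<Sum>n. \<integral>\<^sup>+\<omega>. etransfer (\<lambda>q. v q * indicator (E n) q) \<omega> \<partial>lebesgue_torus)"
    unfolding eq using m by (intro nn_integral_suminf) (simp cong: measurable_cong_sets)
  also have "\<dots> = (\<Sum>n. \<integral>\<^sup>+\<omega>. v \<omega> * indicator (E n) \<omega> \<partial>lebesgue_torus)"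
  proof (intro arg_cong[where f=suminf] ext)
    fix n
    show "(\<integral>\<^sup>+\<omega>. etransfer (\<lambda>q. v q * indicator (E n) q) \<omega> \<partial>lebesgue_torus) =
      (\<integral>\<^sup>+\<omega>. v \<omega> * indicator (E n) \<omega> \<partial>lebesgue_torus)"
      using W[of n] EW[of n] by (simp add: P_def)
  qed
  also have "\<dots> = (\<integral>\<^sup>+\<omega>. (\<Sum>n. v \<omega> * indicator (E n) \<omega>) \<partial>lebesgue_torus)"
    by (rule nn_integral_suminf[symmetric]) simp
  also have "\<dots> = (\<integral>\<^sup>+\<omega>. v \<omega> \<partial>lebesgue_torus)" by (simp add: sum1)
  finally show "(\<integral>\<^sup>+\<omega>. etransfer v \<omega> \<partial>lebesgue_torus) = (\<integral>\<^sup>+\<omega>. v \<omega> \<partial>lebesgue_torus)" .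
qed

lemma transfer_nonneg: "(\<And>p. 0 \<le> u p) \<Longrightarrow> 0 \<le> transfer u \<omega>"
  unfolding transfer_def using J_pos by (intro sum_nonneg) (auto simp: less_imp_le)

lemma ennreal_transfer:
  assumes "\<And>p. 0 \<le> u p"
  shows "ennreal (transfer u \<omega>) = etransfer (\<lambda>p. ennreal (u p)) \<omega>"
  unfolding transfer_def etransfer_def using assms J_pos
  by (subst sum_ennreal[symmetric])
     (auto simp: ennreal_mult[symmetric] less_imp_le intro!: sum.cong)

lemma transfer_measurable:
  assumes [measurable]: "u \<in> borel_measurable borel" and "\<And>p. 0 \<le> u p"
  shows "transfer u \<in> borel_measurable borel"
proof -
  have "(\<lambda>\<omega>. enn2real (etransfer (\<lambda>p. ennreal (u p)) \<omega>)) \<in> borel_measurable borel"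
    using etransfer(1)[of "\<lambda>p. ennreal (u p)"] by measurable
  then show ?thesis
    using transfer_nonneg[OF assms(2)] by (simp add: ennreal_transfer[OF assms(2), symmetric])
qed

lemma nn_integral_transfer:
  assumes [measurable]: "u \<in> borel_measurable borel" and "\<And>p. 0 \<le> u p"
  shows "(\<integral>\<^sup>+\<omega>. ennreal (transfer u \<omega>) \<partial>lebesgue_torus) = (\<integral>\<^sup>+\<omega>. ennreal (u \<omega>) \<partial>lebesgue_torus)"
  unfolding ennreal_transfer[OF assms(2)] by (rule etransfer(2)) simp

lemma integral_transfer:
  assumes [measurable]: "u \<in> borel_measurable borel" and "\<And>p. 0 \<le> u p"
  shows "(\<integral>\<omega>. transfer u \<omega> \<partial>lebesgue_torus) = (\<integral>\<omega>. u \<omega> \<partial>lebesgue_torus)"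
proof -
  have [measurable]: "transfer u \<in> borel_measurable lebesgue_torus"
    using transfer_measurable[OF assms] by (simp cong: measurable_cong_sets)
  show ?thesis
    using assms(2) transfer_nonneg[of u]
    by (subst (1 2) integral_eq_nn_integral) (auto simp: nn_integral_transfer[OF assms])
qed

text \<open>Combined with \<open>integral_transfer\<close>, this is the duality between the transfer
  operator and composition with \<open>g\<close>.\<close>

lemma transfer_mult_comp: "transfer (\<lambda>p. u p * v (g p)) \<omega> = transfer u \<omega> * v \<omega>"
  unfolding transfer_def by (auto simp: sum_distrib_right intro!: sum.cong)

end

section \<open>The invariant density is bounded\<close>

text \<open>Completeness is what \<open>inner_regular\<close> asks for, besides second
  countability.\<close>

instance torus :: (finite) complete_space
proof
  fix X :: "nat \<Rightarrow> 'a torus" assume "Cauchy X"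
  then show "convergent X"
    using compact_imp_complete[OF compact_torus_UNIV] unfolding complete_def convergent_def by blast
qed

lemma loglip_continuous:
  assumes u: "loglip A u"
  shows "continuous_on UNIV u"
proof -
  have "isCont u p" for p
  proof -
    have d: "((\<lambda>q. dist p q) \<longlongrightarrow> dist p p) (at p)" by (intro tendsto_intros)
    have "(u \<longlongrightarrow> u p) (at p)"
    proof (rule tendsto_sandwich)
      show "\<forall>\<^sub>F q in at p. exp (- (A * dist p q)) * u p \<le> u q"
        using loglipD[OF u] by (intro always_eventually allI) (auto simp: exp_minus field_simps)
      show "\<forall>\<^sub>F q in at p. u q \<le> exp (A * dist p q) * u p"
        using loglipD[OF u] by (intro always_eventually allI) (metis dist_commute)
      show "((\<lambda>q. exp (- (A * dist p q)) * u p) \<longlongrightarrow> u p) (at p)"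
        using tendsto_mult_right[OF tendsto_exp[OF tendsto_minus[OF tendsto_mult_left[OF d, of A]]], of "u p"] by simp
      show "((\<lambda>q. exp (A * dist p q) * u p) \<longlongrightarrow> u p) (at p)"
        using tendsto_mult_right[OF tendsto_exp[OF tendsto_mult_left[OF d, of A]], of "u p"] by simp
    qed
    then show ?thesis by (simp add: continuous_at)
  qed
  then show ?thesis by (simp add: continuous_at_imp_continuous_on)
qed

lemma loglip_measurable: "loglip A u \<Longrightarrow> u \<in> borel_measurable borel"
  by (rule borel_measurable_continuous_onI[OF loglip_continuous])

lemma integrable_torus_bounded:
  fixes u :: "('n::finite) torus \<Rightarrow> real"
  assumes "u \<in> borel_measurable borel" "\<And>x. \<bar>u x\<bar> \<le> B"
  shows "integrable lebesgue_torus u"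
  using assms by (intro leb_torus.integrable_const_bound[of _ B])
    (auto cong: measurable_cong_sets)

lemma loglip_le:
  fixes u :: "('n::finite) torus \<Rightarrow> real"
  assumes "loglip A u" "0 \<le> A"
  shows "u p \<le> exp (A * real CARD('n)) * u q"
proof -
  have "u p \<le> exp (A * dist p q) * u q" using assms(1) by (rule loglipD)
  also have "\<dots> \<le> exp (A * real CARD('n)) * u q"
    using assms dist_torus_le_card[of p q] loglip_pos[OF assms(1), of q]
    by (intro mult_right_mono) (auto simp: mult_left_mono)
  finally show ?thesis .
qed

lemma integrable_loglip:
  fixes u :: "('n::finite) torus \<Rightarrow> real"
  assumes "loglip A u" "0 \<le> A"
  shows "integrable lebesgue_torus u"
proof (rule integrable_torus_bounded[OF loglip_measurable[OF assms(1)]])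
  show "\<bar>u x\<bar> \<le> exp (A * real CARD('n)) * u undefined" for x
    using loglip_le[OF assms, of x] loglip_pos[OF assms(1), of x] by simp
qed

text \<open>A Harnack inequality: all values are comparable with each other, hence each is
  comparable with the mean.\<close>

lemma loglip_integral_bounds:
  fixes u :: "('n::finite) torus \<Rightarrow> real"
  assumes "loglip A u" "0 \<le> A"
  shows "u p \<le> exp (A * real CARD('n)) * (\<integral>\<omega>. u \<omega> \<partial>lebesgue_torus)"
    and "exp (- (A * real CARD('n))) * (\<integral>\<omega>. u \<omega> \<partial>lebesgue_torus) \<le> u p"
proof -
  note i = integrable_loglip[OF assms]
  have "(\<integral>\<omega>. u p \<partial>(lebesgue_torus::'n torus measure)) \<le> (\<integral>\<omega>. exp (A * real CARD('n)) * u \<omega> \<partial>lebesgue_torus)"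
    by (intro integral_mono integrable_mult_right i loglip_le[OF assms]) simp
  then show "u p \<le> exp (A * real CARD('n)) * (\<integral>\<omega>. u \<omega> \<partial>lebesgue_torus)"
    by (simp add: leb_torus.prob_space[simplified])
  have "(\<integral>\<omega>. exp (- (A * real CARD('n))) * u \<omega> \<partial>lebesgue_torus) \<le> (\<integral>\<omega>. u p \<partial>(lebesgue_torus::'n torus measure))"
    using loglip_le[OF assms, of _ p]
    by (intro integral_mono integrable_mult_right i) (auto simp: exp_minus field_simps)
  then show "exp (- (A * real CARD('n))) * (\<integral>\<omega>. u \<omega> \<partial>lebesgue_torus) \<le> u p"
    by (simp add: leb_torus.prob_space[simplified])
qed

section \<open>Density of Lipschitz and log-Lipschitz functions among the integrable ones\<close>

lemma integrable_lipschitz_torus: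
  fixes u :: "('n::finite) torus \<Rightarrow> real"
  assumes "B-lipschitz_on UNIV u"
  shows "integrable lebesgue_torus u"
proof -
  have c: "continuous_on UNIV u" using lipschitz_on_continuous_on[OF assms] .
  have "bounded (u ` UNIV)" using compact_imp_bounded[OF compact_continuous_image[OF c compact_torus_UNIV]] .
  then obtain K where "\<And>x. \<bar>u x\<bar> \<le> K" unfolding bounded_iff by auto
  then show ?thesis using borel_measurable_continuous_onI[OF c] by (intro integrable_torus_bounded)
qed

text \<open>For an indicator, inner regularity gives a compact \<open>K\<close> inside the set, and
  the tents \<open>1 - n * infdist x K\<close>, cut off at 0, converge to the indicator of
  \<open>K\<close>. Sums and dominated limits follow by splitting the error.\<close>

lemma lipschitz_dense_L1:
  fixes f :: "('n::finite) torus \<Rightarrow> real"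
  assumes "integrable lebesgue_torus f" "0 < e"
  shows "\<exists>v B. B-lipschitz_on UNIV v \<and> (\<integral>x. \<bar>f x - v x\<bar> \<partial>lebesgue_torus) \<le> e"
  using assms
proof (induction f arbitrary: e rule: integrable_induct)
  case (base A c)
  let ?M = "lebesgue_torus :: 'n torus measure"
  have A [measurable]: "A \<in> sets borel" using base(1) by simp
  define e' where "e' = e / (2 * (\<bar>c\<bar> + 1))"
  have e': "e' > 0" using base(3) by (simp add: e'_def)
  have "emeasure ?M A = (SUP K\<in>{K. K \<subseteq> A \<and> compact K}. emeasure ?M K)"
    by (rule inner_regular) (auto simp: A)
  then have "\<exists>K. K \<subseteq> A \<and> compact K \<and> measure ?M A - e' < measure ?M K"
  proof (cases "measure ?M A < e'")
    case True then show ?thesis by (intro exI[of _ "{}"]) auto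
  next
    case False
    have "ennreal (measure ?M A - e') < emeasure ?M A"
      unfolding leb_torus.emeasure_eq_measure using e' False
      by (subst ennreal_less_iff) auto
    also note \<open>emeasure ?M A = _\<close>
    finally have "ennreal (measure ?M A - e') < (SUP K\<in>{K. K \<subseteq> A \<and> compact K}. emeasure ?M K)" .
    then obtain K where "K \<subseteq> A" "compact K" "ennreal (measure ?M A - e') < emeasure ?M K"
      by (auto simp: less_SUP_iff)
    then show ?thesis using False
      by (intro exI[of _ K]) (auto simp: leb_torus.emeasure_eq_measure ennreal_less_iff)
  qed
  then obtain K where K: "K \<subseteq> A" "compact K" "measure ?M A - e' < measure ?M K" by blast
  have clK: "closed K" using K(2) by (rule compact_imp_closed)
  have [measurable]: "K \<in> sets borel" using clK by simp
  show ?case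
  \<comment> \<open>\<open>infdist\<close> to the empty set is 0 by convention, so the tents would
    be constantly 1. In that case the set itself has measure below \<open>e'\<close>, and the zero
    function approximates its indicator.\<close>
  proof (cases "K = {}")
    case True
    have "(\<integral>x. \<bar>indicat_real A x *\<^sub>R c - 0\<bar> \<partial>?M) = (\<integral>x. indicat_real A x * \<bar>c\<bar> \<partial>?M)"
      by (intro Bochner_Integration.integral_cong) (auto simp: indicator_def)
    also have "\<dots> = measure ?M A * \<bar>c\<bar>" by simp
    also have "\<dots> \<le> e' * \<bar>c\<bar>" using K True by (intro mult_right_mono) auto
    also have "\<dots> \<le> e" using base(3) by (simp add: e'_def field_simps)
    finally show ?thesis by (intro exI[of _ "\<lambda>_. 0"] exI[of _ 0]) (auto intro: lipschitz_on_constant)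
  next
    case ne: False
    define v where "v n x = max 0 (1 - real n * infdist x K)" for n x
    have vl: "(real n)-lipschitz_on UNIV (v n)" for n
    proof (rule lipschitz_onI)
      fix x y :: "'n torus"
      have "\<bar>infdist x K - infdist y K\<bar> \<le> dist x y" using infdist_triangle_abs by blast
      then have "real n * \<bar>infdist x K - infdist y K\<bar> \<le> real n * dist x y" by (intro mult_left_mono) auto
      then have "\<bar>real n * infdist x K - real n * infdist y K\<bar> \<le> real n * dist x y"
        by (simp add: abs_mult right_diff_distrib[symmetric])
      then show "dist (v n x) (v n y) \<le> real n * dist x y" unfolding v_def dist_real_def by (auto simp: max_def)
    qed simp
    have [measurable]: "v n \<in> borel_measurable borel" for n
      using lipschitz_on_continuous_on[OF vl] by (rule borel_measurable_continuous_onI)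
    have v01: "0 \<le> v n x" "v n x \<le> 1" for n x by (auto simp: v_def infdist_nonneg)
    have "(\<lambda>n. \<integral>x. \<bar>indicat_real K x - v n x\<bar> \<partial>?M) \<longlonglongrightarrow> (\<integral>x. 0 \<partial>?M)"
    proof (rule integral_dominated_convergence[where w="\<lambda>_. 2"])
      show "AE x in ?M. (\<lambda>n. \<bar>indicat_real K x - v n x\<bar>) \<longlonglongrightarrow> 0"
      proof (rule AE_I2)
        fix x
        show "(\<lambda>n. \<bar>indicat_real K x - v n x\<bar>) \<longlonglongrightarrow> 0"
        proof (cases "x \<in> K")
          case True then show ?thesis by (simp add: v_def)
        next
          case False
          then have "infdist x K > 0" using clK ne by (metis in_closed_iff_infdist_zero infdist_nonneg less_eq_real_def)
          then obtain n0 where "1 < real n0 * infdist x K" using reals_Archimedean3 by blast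
          then have "\<forall>n\<ge>n0. v n x = 0"
            unfolding v_def by (auto simp: max_def) (smt (verit) infdist_nonneg mult_right_mono of_nat_le_iff)
          then have "\<forall>\<^sub>F n in sequentially. \<bar>indicat_real K x - v n x\<bar> = 0"
            using False unfolding eventually_sequentially by auto
          then show ?thesis by (rule tendsto_eventually)
        qed
      qed
      show "AE x in ?M. norm \<bar>indicat_real K x - v n x\<bar> \<le> 2" for n
      proof (rule AE_I2)
        show "norm \<bar>indicat_real K x - v n x\<bar> \<le> 2" for x
          using v01[of n x] by (cases "x \<in> K") auto
      qed
    qed (auto cong: measurable_cong_sets)
    then have "\<forall>\<^sub>F n in sequentially. (\<integral>x. \<bar>indicat_real K x - v n x\<bar> \<partial>?M) < e'"
      using e' by (intro order_tendstoD) auto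
    then obtain n where n: "(\<integral>x. \<bar>indicat_real K x - v n x\<bar> \<partial>?M) < e'"
      by (auto dest!: eventually_happens'[OF sequentially_bot])
    have "(\<integral>x. \<bar>indicat_real A x *\<^sub>R c - c * v n x\<bar> \<partial>?M) \<le>
        (\<integral>x. \<bar>c\<bar> * (indicat_real (A - K) x + \<bar>indicat_real K x - v n x\<bar>) \<partial>?M)"
    proof (rule integral_mono)
      show "integrable ?M (\<lambda>x. \<bar>indicat_real A x *\<^sub>R c - c * v n x\<bar>)"
        using v01[of n] by (intro integrable_abs Bochner_Integration.integrable_diff integrable_torus_bounded[of _ "\<bar>c\<bar>"])
          (auto simp: indicator_def abs_mult mult_left_le)
      show "integrable ?M (\<lambda>x. \<bar>c\<bar> * (indicat_real (A - K) x + \<bar>indicat_real K x - v n x\<bar>))"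
        using v01[of n] by (intro integrable_mult_right integrable_abs Bochner_Integration.integrable_diff
          Bochner_Integration.integrable_add integrable_torus_bounded[of _ 1]) (auto simp: indicator_def)
      fix x
      have "\<bar>indicat_real A x *\<^sub>R c - c * v n x\<bar> = \<bar>c\<bar> * \<bar>indicat_real A x - v n x\<bar>"
        by (simp add: abs_mult[symmetric] algebra_simps)
      also have "\<dots> \<le> \<bar>c\<bar> * (indicat_real (A - K) x + \<bar>indicat_real K x - v n x\<bar>)"
        using K(1) by (intro mult_left_mono) (auto simp: indicator_def)
      finally show "\<bar>indicat_real A x *\<^sub>R c - c * v n x\<bar> \<le> \<bar>c\<bar> * (indicat_real (A - K) x + \<bar>indicat_real K x - v n x\<bar>)" .
    qed
    also have "\<dots> = \<bar>c\<bar> * (measure ?M (A - K) + (\<integral>x. \<bar>indicat_real K x - v n x\<bar> \<partial>?M))"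
      using v01[of n] by (subst integral_mult_right_zero, subst Bochner_Integration.integral_add)
        (auto simp: indicator_def intro!: integrable_torus_bounded[of _ 1] integrable_abs Bochner_Integration.integrable_diff)
    also have "\<dots> \<le> \<bar>c\<bar> * (e' + e')"
      using n K leb_torus.finite_measure_Diff[of A K] by (intro mult_left_mono add_mono) auto
    also have "\<dots> \<le> (\<bar>c\<bar> + 1) * (e' + e')" using e' by (intro mult_right_mono) auto
    also have "\<dots> = e" by (simp add: e'_def divide_simps)
    finally show ?thesis
      using lipschitz_on_cmult_real[OF vl[of n], of c] by blast
  qed
next
  case (add f g)
  obtain v B where v: "B-lipschitz_on UNIV v" "(\<integral>x. \<bar>f x - v x\<bar> \<partial>lebesgue_torus) \<le> e / 2"
    using add(3)[of "e/2"] add(5) by auto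
  obtain w B' where w: "B'-lipschitz_on UNIV w" "(\<integral>x. \<bar>g x - w x\<bar> \<partial>lebesgue_torus) \<le> e / 2"
    using add(4)[of "e/2"] add(5) by auto
  have "(\<integral>x. \<bar>f x + g x - (v x + w x)\<bar> \<partial>lebesgue_torus) \<le> (\<integral>x. \<bar>f x - v x\<bar> + \<bar>g x - w x\<bar> \<partial>lebesgue_torus)"
    using add(1,2) integrable_lipschitz_torus[OF v(1)] integrable_lipschitz_torus[OF w(1)] by (intro integral_mono) auto
  also have "\<dots> = (\<integral>x. \<bar>f x - v x\<bar> \<partial>lebesgue_torus) + (\<integral>x. \<bar>g x - w x\<bar> \<partial>lebesgue_torus)"
    using add(1,2) integrable_lipschitz_torus[OF v(1)] integrable_lipschitz_torus[OF w(1)] by (intro Bochner_Integration.integral_add) auto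
  also have "\<dots> \<le> e" using v w by simp
  finally show ?case using lipschitz_on_add[OF v(1) w(1)] by blast
next
  case (lim f s)
  have "(\<lambda>i. \<integral>x. \<bar>f x - s i x\<bar> \<partial>lebesgue_torus) \<longlonglongrightarrow> (\<integral>x. 0 \<partial>(lebesgue_torus :: 'n torus measure))"
  proof (rule integral_dominated_convergence[where w="\<lambda>x. 3 * \<bar>f x\<bar>"])
    show "AE x in lebesgue_torus. (\<lambda>i. \<bar>f x - s i x\<bar>) \<longlonglongrightarrow> 0"
    proof (rule AE_I2)
      fix x :: "'n torus"
      have "(\<lambda>i. \<bar>f x - s i x\<bar>) \<longlonglongrightarrow> \<bar>f x - f x\<bar>" using lim(2)[of x] by (intro tendsto_intros) auto
      then show "(\<lambda>i. \<bar>f x - s i x\<bar>) \<longlonglongrightarrow> 0" by simp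
    qed
    show "AE x in lebesgue_torus. norm \<bar>f x - s i x\<bar> \<le> 3 * \<bar>f x\<bar>" for i
      using lim(3) by (intro AE_I2) (smt (verit) real_norm_def abs_ge_zero)
  qed (use lim(1,4) in auto)
  then have "\<forall>\<^sub>F i in sequentially. (\<integral>x. \<bar>f x - s i x\<bar> \<partial>lebesgue_torus) < e / 2"
    using lim(6) by (intro order_tendstoD) auto
  then obtain i where i: "(\<integral>x. \<bar>f x - s i x\<bar> \<partial>lebesgue_torus) < e / 2"
    by (auto dest!: eventually_happens'[OF sequentially_bot])
  obtain v B where v: "B-lipschitz_on UNIV v" "(\<integral>x. \<bar>s i x - v x\<bar> \<partial>lebesgue_torus) \<le> e / 2"
    using lim(5)[of "e/2" i] lim(6) by auto
  have iv: "integrable lebesgue_torus v" using v(1) by (rule integrable_lipschitz_torus)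
  have "(\<integral>x. \<bar>f x - v x\<bar> \<partial>lebesgue_torus) \<le> (\<integral>x. \<bar>f x - s i x\<bar> + \<bar>s i x - v x\<bar> \<partial>lebesgue_torus)"
    using lim(1,4) iv by (intro integral_mono) auto
  also have "\<dots> = (\<integral>x. \<bar>f x - s i x\<bar> \<partial>lebesgue_torus) + (\<integral>x. \<bar>s i x - v x\<bar> \<partial>lebesgue_torus)"
    using lim(1,4) iv by (intro Bochner_Integration.integral_add) auto
  also have "\<dots> \<le> e" using i v by simp
  finally show ?case using v(1) by blast
qed

text \<open>Taking the absolute value of a Lipschitz approximation does no harm because
  \<open>f\<close> is nonnegative, and adding \<open>e / 2\<close> keeps it away from 0, which
  bounds the Lipschitz constant of its logarithm.\<close>

lemma loglip_dense_L1:
  fixes f :: "('n::finite) torus \<Rightarrow> real"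
  assumes f: "integrable lebesgue_torus f" "\<And>x. 0 \<le> f x" and e: "0 < e"
  shows "\<exists>u A. 0 \<le> A \<and> loglip A u \<and> (\<integral>x. \<bar>f x - u x\<bar> \<partial>lebesgue_torus) \<le> e"
proof -
  obtain v B where v: "B-lipschitz_on UNIV v" "(\<integral>x. \<bar>f x - v x\<bar> \<partial>lebesgue_torus) \<le> e / 2"
    using lipschitz_dense_L1[OF f(1), of "e/2"] e by auto
  have B: "0 \<le> B" using v(1) by (rule lipschitz_on_nonneg)
  define u where "u x = \<bar>v x\<bar> + e / 2" for x
  have ll: "loglip (2 * B / e) u"
    unfolding loglip_def
  proof (intro conjI allI)
    fix p q
    show "0 < u p" using e by (simp add: u_def add_nonneg_pos)
    have "\<bar>v p - v q\<bar> \<le> B * dist p q" using lipschitz_onD[OF v(1), of p q] by (simp add: dist_real_def)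
    then have "u p \<le> u q + B * dist p q" by (simp add: u_def)
    also have "\<dots> \<le> u q + u q * (2 * B / e * dist p q)"
    proof -
      have "(e / 2) * (2 * B / e * dist p q) \<le> u q * (2 * B / e * dist p q)"
        using B e by (intro mult_right_mono) (auto simp: u_def)
      then show ?thesis using e by simp
    qed
    also have "\<dots> = (1 + 2 * B / e * dist p q) * u q" by (simp add: algebra_simps)
    also have "\<dots> \<le> exp (2 * B / e * dist p q) * u q"
      using exp_ge_add_one_self e by (intro mult_right_mono) (auto simp: u_def)
    finally show "u p \<le> exp (2 * B / e * dist p q) * u q" .
  qed
  have iu: "integrable lebesgue_torus u" using B e by (intro integrable_loglip[OF ll]) simp
  have iv: "integrable lebesgue_torus v" using v(1) by (rule integrable_lipschitz_torus)
  have "(\<integral>x. \<bar>f x - u x\<bar> \<partial>lebesgue_torus) \<le> (\<integral>x. \<bar>f x - v x\<bar> + e / 2 \<partial>lebesgue_torus)"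
  proof (rule integral_mono)
    show "integrable lebesgue_torus (\<lambda>x. \<bar>f x - u x\<bar>)" "integrable lebesgue_torus (\<lambda>x. \<bar>f x - v x\<bar> + e / 2)"
      using f(1) iu iv by auto
    show "\<bar>f x - u x\<bar> \<le> \<bar>f x - v x\<bar> + e / 2" for x
      using f(2)[of x] e unfolding u_def by (auto simp: abs_if split: if_splits)
  qed
  also have "\<dots> = (\<integral>x. \<bar>f x - v x\<bar> \<partial>lebesgue_torus) + e / 2"
    using f iv by (subst Bochner_Integration.integral_add) (auto simp: leb_torus.prob_space[simplified])
  also have "\<dots> \<le> e" using v by simp
  finally show ?thesis using ll B e by (intro exI[of _ u] exI[of _ "2 * B / e"]) auto
qed

section \<open>Iterates of the transfer operator and the invariant density\<close>

context expanding_torus_map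
begin

lemma transfer_pow:
  assumes "u \<in> borel_measurable borel" "\<And>p. 0 \<le> u p"
    and v [measurable]: "v \<in> borel_measurable borel" and "\<And>p. 0 \<le> v p"
  shows "(\<integral>\<omega>. (transfer ^^ k) u \<omega> * v \<omega> \<partial>lebesgue_torus) = (\<integral>\<omega>. u \<omega> * v ((g ^^ k) \<omega>) \<partial>lebesgue_torus)"
  using assms(1,2)
proof (induction k arbitrary: u)
  case (Suc k)
  note [measurable] = Suc.prems(1)
  have gk [measurable]: "g ^^ k \<in> borel_measurable borel" by (induction k) (auto intro: measurable_comp)
  have "(\<integral>\<omega>. (transfer ^^ Suc k) u \<omega> * v \<omega> \<partial>lebesgue_torus) =
      (\<integral>\<omega>. (transfer ^^ k) (transfer u) \<omega> * v \<omega> \<partial>lebesgue_torus)"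
    by (simp add: funpow_swap1)
  also have "\<dots> = (\<integral>\<omega>. transfer u \<omega> * v ((g ^^ k) \<omega>) \<partial>lebesgue_torus)"
    by (rule Suc.IH) (use transfer_measurable transfer_nonneg Suc.prems in auto)
  also have "\<dots> = (\<integral>\<omega>. transfer (\<lambda>p. u p * v ((g ^^ k) (g p))) \<omega> \<partial>lebesgue_torus)"
    by (simp add: transfer_mult_comp[where v="\<lambda>\<omega>. v ((g ^^ k) \<omega>)"])
  also have "\<dots> = (\<integral>\<omega>. u \<omega> * v ((g ^^ k) (g \<omega>)) \<partial>lebesgue_torus)"
    using Suc.prems assms(4) by (intro integral_transfer) auto
  finally show ?case by (simp add: funpow_swap1)
qed simp

text \<open>For \<sigma> at least 2 a constant \<open>A\<close> becomes at most
  \<open>D + A / 2\<close>. The fixed point of this recursion is \<open>2 * D\<close>, and the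
  excess over it is halved at each step.\<close>

lemma transfer_pow_loglip:
  assumes "loglip A u" "0 \<le> A" "2 \<le> \<sigma>"
  shows "loglip (2 * D + A / 2 ^ k) ((transfer ^^ k) u)"
proof (induction k)
  case 0
  show ?case using assms D_pos by (auto intro: loglip_mono)
next
  case (Suc k)
  have "loglip (D + (2 * D + A / 2 ^ k) / \<sigma>) (transfer ((transfer ^^ k) u))"
    using D_pos assms(2) by (intro transfer_loglip Suc) auto
  moreover have "D + (2 * D + A / 2 ^ k) / \<sigma> \<le> D + (2 * D + A / 2 ^ k) / 2"
    using D_pos assms by (intro add_left_mono divide_left_mono) auto
  ultimately show ?case by (auto elim!: loglip_mono simp: field_simps)
qed

text \<open>The density is approximated in \<open>L\<^sup>1\<close> by log-Lipschitz functions, which the iterates of the transfer operator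
  push into a fixed log-Lipschitz class.\<close>

lemma acip_density_le:
  assumes \<rho>: "acip_density g \<rho>" and "2 \<le> \<sigma>"
  shows "AE \<omega> in lebesgue_torus. \<rho> \<omega> \<le> exp (3 * D * real CARD('n))"
proof -
  let ?M = "lebesgue_torus :: 'n torus measure"
  let ?N = "density ?M (\<lambda>\<omega>. ennreal (\<rho> \<omega>))"
  let ?B = "exp (3 * D * real CARD('n))"
  have [measurable]: "\<rho> \<in> borel_measurable borel" and \<rho>0: "\<And>\<omega>. 0 \<le> \<rho> \<omega>"
    and pN: "prob_space ?N" and inv: "distr ?N borel g = ?N"
    using \<rho> by (auto simp: acip_density_def)
  have one: "(\<integral>\<^sup>+\<omega>. ennreal (\<rho> \<omega>) \<partial>?M) = 1"
    using prob_space.emeasure_space_1[OF pN] by (simp add: emeasure_density)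
  have i\<rho>: "integrable ?M \<rho>"
    using one \<rho>0 by (intro integrableI_nonneg) (auto cong: measurable_cong_sets)
  have int1: "(\<integral>\<omega>. \<rho> \<omega> \<partial>?M) = 1"
    using one \<rho>0 by (subst integral_eq_nn_integral) (auto cong: measurable_cong_sets)
  have gk [measurable]: "g ^^ k \<in> borel_measurable borel" for k by (induction k) (auto intro: measurable_comp)
  have em: "emeasure ?N ((g ^^ k) -` A) = emeasure ?N A" if A [measurable]: "A \<in> sets borel" for A k
  proof (induction k)
    case (Suc k)
    have m: "(g ^^ k) -` A \<in> sets borel" using measurable_sets_borel[OF gk A] .
    have "emeasure ?N ((g ^^ Suc k) -` A) = emeasure ?N (g -` ((g ^^ k) -` A))"
      by (simp add: vimage_def funpow_swap1)
    also have "\<dots> = emeasure (distr ?N borel g) ((g ^^ k) -` A)" using m by (subst emeasure_distr) auto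
    finally show ?case by (simp only: Suc inv)
  qed simp
  have int: "(\<integral>\<omega>. \<rho> \<omega> * indicator A \<omega> \<partial>?M) = measure ?N A" if A [measurable]: "A \<in> sets borel" for A
    using \<rho>0 by (subst integral_eq_nn_integral)
      (auto simp: measure_def emeasure_density ennreal_mult' ennreal_indicator cong: measurable_cong_sets)
  have bound: "(\<integral>\<omega>. \<rho> \<omega> * indicator A \<omega> \<partial>?M) \<le> ?B * measure ?M A" if A [measurable]: "A \<in> sets borel" for A
  proof (rule field_le_epsilon)
    fix e :: real assume e: "0 < e"
    \<comment> \<open>The error \<open>e'\<close> enters twice: through the mass of
      \<open>u\<close>, multiplied by the bound, and through the distance between
      \<open>\<rho>\<close> and \<open>u\<close> itself.\<close>
    define e' where "e' = e / (?B + 1)"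
    have "0 < ?B" by simp
    then have e': "0 < e'" using e by (simp add: e'_def add_pos_pos)
    obtain u \<Lambda> where u: "0 \<le> \<Lambda>" "loglip \<Lambda> u" "(\<integral>x. \<bar>\<rho> x - u x\<bar> \<partial>?M) \<le> e'"
      using loglip_dense_L1[OF i\<rho> \<rho>0 e'] by blast
    have um [measurable]: "u \<in> borel_measurable borel" using u(2) by (rule loglip_measurable)
    have u0: "0 \<le> u p" for p using loglip_pos[OF u(2)] by (rule less_imp_le)
    have iu: "integrable ?M u" using integrable_loglip[OF u(2,1)] .
    \<comment> \<open>After \<open>k\<close> transfers the initial constant contributes at most
      \<open>D\<close>, which together with \<open>2 * D\<close> gives \<open>3 * D\<close>.\<close>
    obtain k where k: "\<Lambda> / D < 2 ^ k" using real_arch_pow[of 2 "\<Lambda> / D"] by auto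
    then have "\<Lambda> / 2 ^ k \<le> D" using D_pos by (simp add: field_simps)
    then have ll: "loglip (3 * D) ((transfer ^^ k) u)"
      by (intro loglip_mono[OF transfer_pow_loglip[OF u(2,1) assms(2), of k]]) simp
    have ik: "integrable ?M ((transfer ^^ k) u)" using D_pos by (intro integrable_loglip[OF ll]) simp
    have Uk: "(\<integral>\<omega>. (transfer ^^ k) u \<omega> \<partial>?M) = (\<integral>\<omega>. u \<omega> \<partial>?M)"
      using transfer_pow[OF um u0, of "\<lambda>_. 1" k] by simp
    have iA: "integrable ?M (\<lambda>\<omega>. f \<omega> * indicator ((g ^^ k) -` A) \<omega>)" if "integrable ?M f" for f :: "'n torus \<Rightarrow> real"
      using measurable_sets_borel[OF gk[of k] A] that by (intro integrable_real_mult_indicator) auto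
    \<comment> \<open>Invariance pulls \<open>A\<close> back by \<open>k\<close> steps. The
      approximation of \<rho> by \<open>u\<close> is then paid once, and duality pushes
      \<open>u\<close> forward by \<open>k\<close> transfers.\<close>
    have "(\<integral>\<omega>. \<rho> \<omega> * indicator A \<omega> \<partial>?M) = (\<integral>\<omega>. \<rho> \<omega> * indicator ((g ^^ k) -` A) \<omega> \<partial>?M)"
      using measurable_sets_borel[OF gk[of k] A] by (simp add: int em[OF A] measure_def)
    also have "\<dots> \<le> (\<integral>\<omega>. u \<omega> * indicator ((g ^^ k) -` A) \<omega> + \<bar>\<rho> \<omega> - u \<omega>\<bar> \<partial>?M)"
    proof (rule integral_mono)
      show "integrable ?M (\<lambda>\<omega>. \<rho> \<omega> * indicator ((g ^^ k) -` A) \<omega>)" by (rule iA[OF i\<rho>])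
      show "integrable ?M (\<lambda>\<omega>. u \<omega> * indicator ((g ^^ k) -` A) \<omega> + \<bar>\<rho> \<omega> - u \<omega>\<bar>)"
        using iA[OF iu] i\<rho> iu by auto
    qed (auto simp: indicator_def)
    also have "\<dots> = (\<integral>\<omega>. u \<omega> * indicator ((g ^^ k) -` A) \<omega> \<partial>?M) + (\<integral>\<omega>. \<bar>\<rho> \<omega> - u \<omega>\<bar> \<partial>?M)"
      using iA[OF iu] i\<rho> iu by (intro Bochner_Integration.integral_add) auto
    also have "(\<integral>\<omega>. u \<omega> * indicator ((g ^^ k) -` A) \<omega> \<partial>?M) = (\<integral>\<omega>. (transfer ^^ k) u \<omega> * indicator A \<omega> \<partial>?M)"
      using transfer_pow[OF um u0, of "indicator A" k] by (simp add: indicator_def)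
    also have "\<dots> \<le> (\<integral>\<omega>. (?B * (\<integral>\<omega>. u \<omega> \<partial>?M)) * indicator A \<omega> \<partial>?M)"
    proof (rule integral_mono)
      show "integrable ?M (\<lambda>\<omega>. (transfer ^^ k) u \<omega> * indicator A \<omega>)"
        using ik by (intro integrable_real_mult_indicator) auto
      show "integrable ?M (\<lambda>\<omega>. (?B * (\<integral>\<omega>. u \<omega> \<partial>?M)) * indicator A \<omega>)"
        by (intro integrable_real_mult_indicator) auto
      show "(transfer ^^ k) u \<omega> * indicator A \<omega> \<le> (?B * (\<integral>\<omega>. u \<omega> \<partial>?M)) * indicator A \<omega>" for \<omega>
        using loglip_integral_bounds(1)[OF ll, of \<omega>] D_pos by (intro mult_right_mono) (auto simp: Uk)
    qed
    also have "\<dots> = ?B * (\<integral>\<omega>. u \<omega> \<partial>?M) * measure ?M A" by simp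
    also have "\<dots> \<le> ?B * (1 + e') * measure ?M A"
    proof (intro mult_right_mono mult_left_mono)
      have "(\<integral>\<omega>. u \<omega> \<partial>?M) \<le> (\<integral>\<omega>. \<rho> \<omega> + \<bar>\<rho> \<omega> - u \<omega>\<bar> \<partial>?M)"
        using iu i\<rho> by (intro integral_mono) auto
      also have "\<dots> = 1 + (\<integral>\<omega>. \<bar>\<rho> \<omega> - u \<omega>\<bar> \<partial>?M)"
        using iu i\<rho> by (subst Bochner_Integration.integral_add) (auto simp: int1)
      finally show "(\<integral>\<omega>. u \<omega> \<partial>?M) \<le> 1 + e'" using u(3) by simp
    qed auto
    finally have "(\<integral>\<omega>. \<rho> \<omega> * indicator A \<omega> \<partial>?M) \<le> ?B * (1 + e') * measure ?M A + e'" using u(3) by simp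
    also have "\<dots> \<le> ?B * measure ?M A + ?B * e' + e'"
      using e' by (simp add: algebra_simps mult_left_le)
    also have "?B * e' + e' = (?B + 1) * e'" by (simp add: algebra_simps)
    then have "?B * measure ?M A + ?B * e' + e' = ?B * measure ?M A + e"
      unfolding e'_def using \<open>0 < ?B\<close> by simp
    finally show "(\<integral>\<omega>. \<rho> \<omega> * indicator A \<omega> \<partial>?M) \<le> ?B * measure ?M A + e" by simp
  qed
  \<comment> \<open>The bound on all Borel sets, applied to the set where the claim fails, shows
    that this set is null.\<close>
  define A where "A = {\<omega>. ?B < \<rho> \<omega>}"
  have A [measurable]: "A \<in> sets borel" unfolding A_def by measurable
  have iA: "integrable ?M (\<lambda>\<omega>. \<rho> \<omega> * indicator A \<omega>)" "integrable ?M (\<lambda>\<omega>. ?B * indicator A \<omega>)"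
    by (intro integrable_real_mult_indicator i\<rho>; simp)+
  have nn: "0 \<le> \<rho> \<omega> * indicator A \<omega> - ?B * indicator A \<omega>" for \<omega> by (auto simp: A_def indicator_def)
  have "(\<integral>\<omega>. \<rho> \<omega> * indicator A \<omega> - ?B * indicator A \<omega> \<partial>?M) = 0"
  proof (rule antisym)
    show "(\<integral>\<omega>. \<rho> \<omega> * indicator A \<omega> - ?B * indicator A \<omega> \<partial>?M) \<le> 0"
      using bound[OF A] iA by (subst Bochner_Integration.integral_diff) auto
    show "0 \<le> (\<integral>\<omega>. \<rho> \<omega> * indicator A \<omega> - ?B * indicator A \<omega> \<partial>?M)" by (rule Bochner_Integration.integral_nonneg) (rule nn)
  qed
  then have "AE \<omega> in ?M. \<rho> \<omega> * indicator A \<omega> - ?B * indicator A \<omega> = 0"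
    using integral_nonneg_eq_0_iff_AE[OF Bochner_Integration.integrable_diff[OF iA]] nn by simp
  then show ?thesis by eventually_elim (auto simp: A_def indicator_def split: if_splits)
qed

end

section \<open>Disintegration of the images under the skew product\<close>

text \<open>The two lower bounds on \<sigma> are what makes the constant \<open>2 * D + l\<close>
  reproduce itself in \<open>disint_loglip\<close>.\<close>

locale skew_torus = expanding_torus_map \<sigma> D g
  for \<sigma> D :: real and g :: "('n::finite) torus \<Rightarrow> 'n torus" +
  fixes f :: "'n torus \<times> ('m::finite) torus \<Rightarrow> 'm torus" and L :: real
  assumes f_lip: "L-lipschitz_on UNIV f" and \<sigma>_ge_2: "2 \<le> \<sigma>" and \<sigma>_ge_L: "2 * L \<le> \<sigma>"
begin

abbreviation "F \<equiv> skew_product g f"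

lemma L_nonneg: "0 \<le> L"
  using f_lip by (rule lipschitz_on_nonneg)

lemma f_dist_fiber: "dist (f (\<omega>, x)) (f (\<omega>, y)) \<le> L * dist x y"
  using lipschitz_onD[OF f_lip, of "(\<omega>, x)" "(\<omega>, y)"] by (simp add: dist_Pair_Pair)

lemma f_dist_base: "dist (f (\<omega>, x)) (f (\<omega>', x)) \<le> L * dist \<omega> \<omega>'"
  using lipschitz_onD[OF f_lip, of "(\<omega>, x)" "(\<omega>', x)"] by (simp add: dist_Pair_Pair)

lemma measurable_f [measurable]: "f \<in> borel \<Otimes>\<^sub>M borel \<rightarrow>\<^sub>M borel"
  using borel_measurable_continuous_onI[OF lipschitz_on_continuous_on[OF f_lip]] by (simp add: borel_prod)

lemma measurable_F [measurable]: "F \<in> borel \<Otimes>\<^sub>M borel \<rightarrow>\<^sub>M borel \<Otimes>\<^sub>M borel"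
  unfolding skew_product_def by measurable

lemma measurable_F_pow [measurable]: "F ^^ k \<in> borel \<Otimes>\<^sub>M borel \<rightarrow>\<^sub>M borel \<Otimes>\<^sub>M borel"
proof (induction k)
  case (Suc k)
  then show ?case using measurable_comp[OF Suc measurable_F] by (simp add: comp_def)
qed (simp add: id_def)

text \<open>The density at \<open>\<omega>\<close> of the base coordinate, tested against \<open>\<Phi>\<close> in the fiber coordinate, of the
  image under the \<open>k\<close>-th iterate of the skew product of Lebesgue measure on the base times the point mass at \<open>x\<close>.\<close>

primrec disint :: "'m torus \<Rightarrow> nat \<Rightarrow> ('m torus \<Rightarrow> real) \<Rightarrow> 'n torus \<Rightarrow> real" where
  "disint x 0 \<Phi> = (\<lambda>\<omega>. \<Phi> x)"
| "disint x (Suc k) \<Phi> = transfer (\<lambda>p. disint x k (\<lambda>y. \<Phi> (f (p, y))) p)"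

lemma transfer_mono: "(\<And>p. u p \<le> c * v p) \<Longrightarrow> transfer u \<omega> \<le> c * transfer v \<omega>"
  unfolding transfer_def sum_distrib_left
  using J_pos by (intro sum_mono) (simp add: divide_right_mono less_imp_le)

lemma disint_mono: "(\<And>y. \<Phi> y \<le> c * \<Psi> y) \<Longrightarrow> disint x k \<Phi> \<omega> \<le> c * disint x k \<Psi> \<omega>"
  by (induction k arbitrary: \<Phi> \<Psi> \<omega>) (auto intro!: transfer_mono)

lemma disint_nonneg: "(\<And>y. 0 \<le> \<Phi> y) \<Longrightarrow> 0 \<le> disint x k \<Phi> \<omega>"
  by (induction k arbitrary: \<Phi> \<omega>) (auto intro!: transfer_nonneg)

lemma disint_cmult: "disint x k (\<lambda>y. c * \<Phi> y) \<omega> = c * disint x k \<Phi> \<omega>"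
proof (rule antisym)
  show "disint x k (\<lambda>y. c * \<Phi> y) \<omega> \<le> c * disint x k \<Phi> \<omega>" by (rule disint_mono) simp
  show "c * disint x k \<Phi> \<omega> \<le> disint x k (\<lambda>y. c * \<Phi> y) \<omega>"
  proof (induction k arbitrary: \<Phi> \<omega>)
    case (Suc k)
    then show ?case unfolding disint.simps transfer_def sum_distrib_left
      using J_pos by (intro sum_mono) (auto simp: divide_right_mono less_imp_le)
  qed simp
qed

lemma loglip_comp_fiber:
  assumes "loglip l \<Phi>" "0 \<le> l"
  shows "loglip (L * l) (\<lambda>y. \<Phi> (f (\<omega>, y)))"
  unfolding loglip_def
proof (intro conjI allI)
  fix p q
  show "0 < \<Phi> (f (\<omega>, p))" using assms(1) by (rule loglip_pos)
  have "\<Phi> (f (\<omega>, p)) \<le> exp (l * dist (f (\<omega>, p)) (f (\<omega>, q))) * \<Phi> (f (\<omega>, q))"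
    using assms(1) by (rule loglipD)
  also have "\<dots> \<le> exp (L * l * dist p q) * \<Phi> (f (\<omega>, q))"
    using mult_left_mono[OF f_dist_fiber[of \<omega> p q] assms(2)] loglip_pos[OF assms(1), of "f (\<omega>, q)"]
    by (intro mult_right_mono) (auto simp: mult_ac)
  finally show "\<Phi> (f (\<omega>, p)) \<le> exp (L * l * dist p q) * \<Phi> (f (\<omega>, q))" .
qed

lemma loglip_comp_base:
  assumes "loglip l \<Phi>" "0 \<le> l"
  shows "\<Phi> (f (\<omega>, y)) \<le> exp (L * l * dist \<omega> \<omega>') * \<Phi> (f (\<omega>', y))"
proof -
  have "\<Phi> (f (\<omega>, y)) \<le> exp (l * dist (f (\<omega>, y)) (f (\<omega>', y))) * \<Phi> (f (\<omega>', y))"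
    using assms(1) by (rule loglipD)
  also have "\<dots> \<le> exp (L * l * dist \<omega> \<omega>') * \<Phi> (f (\<omega>', y))"
    using mult_left_mono[OF f_dist_base[of \<omega> y \<omega>'] assms(2)] loglip_pos[OF assms(1), of "f (\<omega>', y)"]
    by (intro mult_right_mono) (auto simp: mult_ac)
  finally show ?thesis .
qed

text \<open>In the inductive step the base point \<open>p\<close> enters twice: through the test
  function, which costs \<open>L * l\<close>, and as the argument of the previous disintegration,
  which costs \<open>2 * D + L * l\<close>. The transfer operator divides the total by \<sigma> and
  adds \<open>D\<close>. As \<sigma> is at least 2 and at least \<open>2 * L\<close>, the result is
  again at most \<open>2 * D + l\<close>, whatever \<open>k\<close> is.\<close>

lemma disint_loglip:
  assumes "loglip l \<Phi>" "0 \<le> l"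
  shows "loglip (2 * D + l) (disint x k \<Phi>)"
  using assms
proof (induction k arbitrary: \<Phi> l)
  case 0
  then have "loglip 0 (disint x 0 \<Phi>)" using loglip_pos[OF 0(1)] by (simp add: loglip_def)
  then show ?case by (rule loglip_mono) (use 0 D_pos in simp)
next
  case (Suc k)
  let ?w = "\<lambda>p. disint x k (\<lambda>y. \<Phi> (f (p, y))) p"
  have ll: "loglip (2 * D + L * l) (disint x k (\<lambda>y. \<Phi> (f (p, y))))" for p
    using Suc.prems L_nonneg by (intro Suc.IH loglip_comp_fiber) auto
  have "loglip (2 * D + 2 * L * l) ?w"
    unfolding loglip_def
  proof (intro conjI allI)
    fix p q
    show "0 < ?w p" using ll by (rule loglip_pos)
    have "?w p \<le> exp (L * l * dist p q) * disint x k (\<lambda>y. \<Phi> (f (q, y))) p"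
      by (rule disint_mono) (rule loglip_comp_base[OF Suc.prems])
    also have "\<dots> \<le> exp (L * l * dist p q) * (exp ((2 * D + L * l) * dist p q) * ?w q)"
      using loglipD[OF ll[of q], of p q] by (intro mult_left_mono) auto
    also have "\<dots> = exp ((2 * D + 2 * L * l) * dist p q) * ?w q"
    proof -
      have "exp (L * l * dist p q) * exp ((2 * D + L * l) * dist p q) = exp ((2 * D + 2 * L * l) * dist p q)"
        unfolding mult_exp_exp by (simp add: algebra_simps)
      then show ?thesis by (metis mult.assoc)
    qed
    finally show "?w p \<le> exp ((2 * D + 2 * L * l) * dist p q) * ?w q" .
  qed
  then have "loglip (D + (2 * D + 2 * L * l) / \<sigma>) (transfer ?w)"
    using D_pos L_nonneg Suc.prems by (intro transfer_loglip) auto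
  then have "loglip (2 * D + l) (transfer ?w)"
  proof (rule loglip_mono)
    have "2 * D \<le> D * \<sigma>" using \<sigma>_ge_2 D_pos by simp
    moreover have "2 * L * l \<le> \<sigma> * l" using \<sigma>_ge_L Suc.prems by (intro mult_right_mono) auto
    ultimately have "(2 * D + 2 * L * l) / \<sigma> \<le> D + l" using \<sigma>_gt_1 by (simp add: field_simps)
    then show "D + (2 * D + 2 * L * l) / \<sigma> \<le> 2 * D + l" by simp
  qed
  then show ?case by simp
qed

lemma disint_integral:
  assumes "\<Psi> \<in> borel_measurable (borel \<Otimes>\<^sub>M borel)" "\<And>p. 0 \<le> \<Psi> p"
  shows "(\<lambda>\<omega>. disint x k (\<lambda>y. \<Psi> (\<omega>, y)) \<omega>) \<in> borel_measurable borel"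
    and "(\<integral>\<omega>. disint x k (\<lambda>y. \<Psi> (\<omega>, y)) \<omega> \<partial>lebesgue_torus) = (\<integral>\<omega>. \<Psi> ((F ^^ k) (\<omega>, x)) \<partial>lebesgue_torus)"
proof -
  have "(\<lambda>\<omega>. disint x k (\<lambda>y. \<Psi> (\<omega>, y)) \<omega>) \<in> borel_measurable borel \<and>
    (\<integral>\<omega>. disint x k (\<lambda>y. \<Psi> (\<omega>, y)) \<omega> \<partial>lebesgue_torus) = (\<integral>\<omega>. \<Psi> ((F ^^ k) (\<omega>, x)) \<partial>lebesgue_torus)"
    using assms
  proof (induction k arbitrary: \<Psi>)
    case 0
    note [measurable] = 0(1)
    show ?case by simp
  next
    case (Suc k)
    note [measurable] = Suc.prems(1)
    let ?w = "\<lambda>p. disint x k (\<lambda>y. \<Psi> (F (p, y))) p"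
    have IH: "?w \<in> borel_measurable borel"
      "(\<integral>\<omega>. ?w \<omega> \<partial>lebesgue_torus) = (\<integral>\<omega>. \<Psi> (F ((F ^^ k) (\<omega>, x))) \<partial>lebesgue_torus)"
      using Suc.IH[of "\<lambda>p. \<Psi> (F p)"] Suc.prems(2) by auto
    have w0: "0 \<le> ?w p" for p using Suc.prems(2) by (intro disint_nonneg)
    have eq: "disint x (Suc k) (\<lambda>y. \<Psi> (\<omega>, y)) \<omega> = transfer ?w \<omega>" for \<omega>
      unfolding disint.simps transfer_def by (intro sum.cong) (auto simp: skew_product_def)
    show ?case
      unfolding eq using transfer_measurable[OF IH(1) w0] integral_transfer[OF IH(1) w0] IH(2) by simp
  qed
  then show "(\<lambda>\<omega>. disint x k (\<lambda>y. \<Psi> (\<omega>, y)) \<omega>) \<in> borel_measurable borel"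
    "(\<integral>\<omega>. disint x k (\<lambda>y. \<Psi> (\<omega>, y)) \<omega> \<partial>lebesgue_torus) = (\<integral>\<omega>. \<Psi> ((F ^^ k) (\<omega>, x)) \<partial>lebesgue_torus)"
    by auto
qed

lemma disint_one_le: "disint x k (\<lambda>_. 1) \<omega> \<le> exp (2 * D * real CARD('n))"
proof -
  have ll: "loglip (2 * D + 0) (disint x k (\<lambda>_. 1))" by (rule disint_loglip) (auto simp: loglip_def)
  have "(\<integral>\<omega>. disint x k (\<lambda>_. 1) \<omega> \<partial>lebesgue_torus) = 1"
    using disint_integral(2)[of "\<lambda>_. 1" x k] by (simp add: leb_torus.prob_space[simplified])
  then show ?thesis using loglip_integral_bounds(1)[OF ll, of \<omega>] D_pos by simp
qed

lemma disint_le: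
  assumes "\<And>y. \<Phi> y \<le> T" "0 \<le> T"
  shows "disint x k \<Phi> \<omega> \<le> T * exp (2 * D * real CARD('n))"
proof -
  have "disint x k \<Phi> \<omega> \<le> T * disint x k (\<lambda>_. 1) \<omega>" using assms by (intro disint_mono) simp
  also have "\<dots> \<le> T * exp (2 * D * real CARD('n))" using assms by (intro mult_left_mono disint_one_le)
  finally show ?thesis .
qed

end

section \<open>Smearing the base coordinate\<close>

text \<open>Symmetry makes the kernel integrate to 1 in either variable, so smearing preserves
  Lebesgue measure on the base. Log-Lipschitz regularity forces strict positivity, so the kernel
  cannot vanish beyond distance \<open>r\<close>; the tail bound \<tau> takes the place of a support
  condition.\<close>

locale smoothing_kernel =
  fixes \<kappa> :: "('n::finite) torus \<Rightarrow> 'n torus \<Rightarrow> real" and r \<tau> \<Lambda> :: real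
  assumes kernel_measurable [measurable]: "(\<lambda>(a, b). \<kappa> a b) \<in> borel_measurable (borel \<Otimes>\<^sub>M borel)"
    and kernel_loglip: "loglip \<Lambda> (\<kappa> a)"
    and kernel_sym: "\<kappa> a b = \<kappa> b a"
    and kernel_integral: "(\<integral>b. \<kappa> a b \<partial>lebesgue_torus) = 1"
    and kernel_far: "r \<le> dist a b \<Longrightarrow> \<kappa> a b \<le> \<tau>"
    and \<Lambda>_nonneg: "0 \<le> \<Lambda>" and \<tau>_nonneg: "0 \<le> \<tau>" and r_nonneg: "0 \<le> r"
begin

lemma kernel_pos: "0 < \<kappa> a b"
  using kernel_loglip by (rule loglip_pos)

lemma kernel_le: "\<kappa> a b \<le> exp (\<Lambda> * real CARD('n))"
  using loglip_integral_bounds(1)[OF kernel_loglip \<Lambda>_nonneg, of a b] kernel_integral by simp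

lemma kernel_integrable: "integrable lebesgue_torus (\<kappa> a)"
  using integrable_loglip[OF kernel_loglip \<Lambda>_nonneg] .

lemma kernel_integral': "(\<integral>a. \<kappa> a b \<partial>lebesgue_torus) = 1"
  using kernel_integral[of b] by (simp add: kernel_sym[of _ b])

lemma kernel_integrable': "integrable lebesgue_torus (\<lambda>a. \<kappa> a b)"
  using kernel_integrable[of b] by (simp add: kernel_sym[of _ b])

end

lemma loglip_exp_dist: "0 \<le> l \<Longrightarrow> loglip l (\<lambda>\<omega>. exp (- (l * dist z \<omega>)))"
  unfolding loglip_def
proof (intro conjI allI)
  fix p q :: 'a assume "0 \<le> l"
  then have "l * dist z q \<le> l * (dist p q + dist z p)"
    by (intro mult_left_mono) (metis dist_commute dist_triangle add.commute)
  then have "- (l * dist z p) \<le> l * dist p q + - (l * dist z q)" by (simp add: algebra_simps)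
  then show "exp (- (l * dist z p)) \<le> exp (l * dist p q) * exp (- (l * dist z q))"
    by (simp add: exp_add[symmetric])
qed simp

lemma loglip_cmult: "0 < c \<Longrightarrow> loglip A u \<Longrightarrow> loglip A (\<lambda>p. c * u p)"
  unfolding loglip_def by (auto simp: mult.left_commute)

lemma loglip_sum:
  assumes "finite Z" "Z \<noteq> {}" "\<And>z. z \<in> Z \<Longrightarrow> loglip A (u z)"
  shows "loglip A (\<lambda>p. \<Sum>z\<in>Z. u z p)"
  using assms unfolding loglip_def sum_distrib_left by (auto intro!: sum_pos sum_mono)

lemma loglip_divide:
  assumes u: "loglip A u" and v: "loglip B v"
  shows "loglip (A + B) (\<lambda>p. u p / v p)"
  unfolding loglip_def
proof (intro conjI allI)
  fix p q
  have vp: "0 < v p" "0 < v q" and up: "0 < u p" "0 < u q" using loglip_pos u v by blast+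
  show "0 < u p / v p" using vp up by simp
  have "u p * v q \<le> (exp (A * dist p q) * u q) * (exp (B * dist q p) * v p)"
    using vp up by (intro mult_mono loglipD u v) auto
  also have "\<dots> = exp ((A + B) * dist p q) * u q * v p" by (simp add: distrib_right exp_add dist_commute)
  finally show "u p / v p \<le> exp ((A + B) * dist p q) * (u q / v q)" using vp by (simp add: field_simps)
qed

text \<open>The functions \<open>u z\<close>, for \<open>z\<close> in a finite net, form a partition
  of unity concentrated near the net points, and \<kappa> is built from them so as to be symmetric
  and normalized. If \<open>a\<close> and \<open>b\<close> are at least \<open>r\<close> apart,
  every net point is at least \<open>r / 2\<close> away from one of them, and there its
  \<open>u z\<close> is exponentially small in \<open>l\<close>.\<close>

lemma smoothing_kernel_exists:
  fixes r \<tau> :: real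
  assumes r: "0 < r" and \<tau>: "0 < \<tau>"
  shows "\<exists>(\<kappa> :: ('n::finite) torus \<Rightarrow> 'n torus \<Rightarrow> real) \<Lambda>. smoothing_kernel \<kappa> r \<tau> \<Lambda>"
proof -
  let ?M = "lebesgue_torus :: 'n torus measure"
  \<comment> \<open>With \<open>s = r / 8\<close> the exponents of the far values of
    \<open>u z\<close> and of the lower bound on \<open>I z\<close> combine to
    \<open>- (l * (r / 2 - 2 * s))\<close>, that is \<open>- (l * (r / 4))\<close>.\<close>
  define s where "s = r / 8"
  have s: "0 < s" using r by (simp add: s_def)
  obtain Z :: "'n torus set" where Z: "finite Z" "UNIV \<subseteq> (\<Union>z\<in>Z. ball z s)"
    using compact_torus_UNIV s unfolding compact_eq_totally_bounded by blast
  have Zne: "Z \<noteq> {}" using Z(2) by auto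
  define c where "c = real (card Z)"
  have c: "0 < c" using Z(1) Zne by (simp add: c_def card_gt_0_iff)
  define \<beta> where "\<beta> = Min ((\<lambda>z. measure ?M (ball z s)) ` Z)"
  have "0 < measure ?M (ball z s)" for z
    using open_torus_emeasure_pos[of "ball z s"] s by (simp add: leb_torus.emeasure_eq_measure)
  then have \<beta>: "0 < \<beta>" "\<And>z. z \<in> Z \<Longrightarrow> \<beta> \<le> measure ?M (ball z s)"
    using Z(1) Zne by (auto simp: \<beta>_def)
  \<comment> \<open>Since \<open>l * (r / 4)\<close> will equal \<open>X\<close>, a far value of the
    kernel is at most \<open>\<tau> * X * exp (- X)\<close>, and \<open>X * exp (- X)\<close> is at
    most 1.\<close>
  define X where "X = c * c / (\<tau> * \<beta>)"
  have X: "0 < X" using c \<beta>(1) \<tau> by (simp add: X_def)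
  define l where "l = 4 / r * X"
  have l: "0 \<le> l" "l * (r / 4) = X" using X r by (auto simp: l_def)
  define w where "w z \<omega> = exp (- (l * dist z \<omega>))" for z \<omega> :: "'n torus"
  define S where "S \<omega> = (\<Sum>z\<in>Z. w z \<omega>)" for \<omega>
  define u where "u z \<omega> = w z \<omega> / S \<omega>" for z \<omega>
  define I where "I z = (\<integral>\<omega>. u z \<omega> \<partial>?M)" for z
  have lw: "loglip l (w z)" for z unfolding w_def[abs_def] by (rule loglip_exp_dist[OF l(1)])
  have lS: "loglip l S" unfolding S_def[abs_def] by (rule loglip_sum[OF Z(1) Zne lw])
  have lu: "loglip (2 * l) (u z)" for z
    using loglip_divide[OF lw lS, of z] by (simp add: u_def[abs_def])
  have wp: "0 < w z \<omega>" "w z \<omega> \<le> 1" for z \<omega> using l(1) by (auto simp: w_def)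
  have Sp: "0 < S \<omega>" "S \<omega> \<le> c" for \<omega>
    using loglip_pos[OF lS] sum_bounded_above[of Z "\<lambda>z. w z \<omega>" 1] wp by (auto simp: S_def c_def)
  have Sge: "exp (- (l * s)) \<le> S \<omega>" for \<omega>
  proof -
    have "\<omega> \<in> (\<Union>z\<in>Z. ball z s)" using Z(2) by blast
    then obtain z where z: "z \<in> Z" "dist z \<omega> < s" by auto
    have "exp (- (l * s)) \<le> w z \<omega>" using z(2) l(1) by (simp add: w_def mult_left_mono)
    also have "\<dots> \<le> S \<omega>" unfolding S_def using z(1) Z(1) wp by (intro member_le_sum) (auto simp: less_imp_le)
    finally show ?thesis .
  qed
  have up: "0 < u z \<omega>" for z \<omega> using lu by (rule loglip_pos)
  have usum: "(\<Sum>z\<in>Z. u z \<omega>) = 1" for \<omega>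
    using Sp(1)[of \<omega>] by (simp add: u_def sum_divide_distrib[symmetric] S_def[symmetric])
  have u1: "u z \<omega> \<le> 1" if "z \<in> Z" for z \<omega>
    using member_le_sum[of z Z "\<lambda>z. u z \<omega>"] that Z(1) up usum[of \<omega>] by (auto simp: less_imp_le)
  have ufar: "u z \<omega> \<le> exp (- (l * (r / 2 - s)))" if "r / 2 \<le> dist z \<omega>" for z \<omega>
  proof -
    have "u z \<omega> \<le> exp (- (l * (r / 2))) / exp (- (l * s))"
      unfolding u_def w_def using mult_left_mono[OF that l(1)] Sge[of \<omega>] by (intro frac_le) simp_all
    also have "\<dots> = exp (- (l * (r / 2 - s)))" by (simp add: exp_diff[symmetric] algebra_simps)
    finally show ?thesis .
  qed
  have iu: "integrable ?M (u z)" for z using l(1) by (intro integrable_loglip[OF lu]) simp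
  have Ige: "\<beta> * (exp (- (l * s)) / c) \<le> I z" if z: "z \<in> Z" for z
  proof -
    have "\<beta> * (exp (- (l * s)) / c) \<le> measure ?M (ball z s) * (exp (- (l * s)) / c)"
      using \<beta>(2)[OF z] c by (intro mult_right_mono) auto
    also have "\<dots> = (\<integral>\<omega>. indicator (ball z s) \<omega> * (exp (- (l * s)) / c) \<partial>?M)" by simp
    also have "\<dots> \<le> I z" unfolding I_def
    proof (rule integral_mono[OF _ iu])
      show "integrable ?M (\<lambda>\<omega>. indicator (ball z s) \<omega> * (exp (- (l * s)) / c))"
        by (intro integrable_torus_bounded[of _ "exp (- (l * s)) / c"]) (use c in \<open>auto simp: indicator_def\<close>)
      fix \<omega>
      show "indicator (ball z s) \<omega> * (exp (- (l * s)) / c) \<le> u z \<omega>"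
      proof (cases "\<omega> \<in> ball z s")
        case True
        then have "exp (- (l * s)) \<le> w z \<omega>" using l(1) by (simp add: w_def mult_left_mono)
        then have "exp (- (l * s)) / c \<le> u z \<omega>"
          unfolding u_def using Sp[of \<omega>] wp[of z \<omega>] by (intro frac_le) auto
        then show ?thesis using True by simp
      qed (use up[of z \<omega>] in simp)
    qed
    finally show ?thesis .
  qed
  have Ip: "0 < I z" if "z \<in> Z" for z
    using Ige[OF that] \<beta>(1) c by (smt (verit) divide_pos_pos exp_gt_zero mult_pos_pos)
  define \<kappa> where "\<kappa> a b = (\<Sum>z\<in>Z. u z a / I z * u z b)" for a b
  have "smoothing_kernel \<kappa> r \<tau> (2 * l)"
  proof
    have [measurable]: "u z \<in> borel_measurable borel" for z using lu by (rule loglip_measurable)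
    show "(\<lambda>(a, b). \<kappa> a b) \<in> borel_measurable (borel \<Otimes>\<^sub>M borel)"
      unfolding \<kappa>_def by measurable
    show "loglip (2 * l) (\<kappa> a)" for a
      unfolding \<kappa>_def[abs_def] using Ip up by (intro loglip_sum[OF Z(1) Zne] loglip_cmult lu) simp
    show "\<kappa> a b = \<kappa> b a" for a b unfolding \<kappa>_def by (intro sum.cong) auto
    show "(\<integral>b. \<kappa> a b \<partial>?M) = 1" for a
    proof -
      have "(\<integral>b. \<kappa> a b \<partial>?M) = (\<Sum>z\<in>Z. \<integral>b. u z a / I z * u z b \<partial>?M)"
        unfolding \<kappa>_def by (rule Bochner_Integration.integral_sum) (intro integrable_mult_right iu)
      also have "\<dots> = (\<Sum>z\<in>Z. u z a)"
        by (intro sum.cong refl) (use Ip in \<open>force simp: I_def[symmetric]\<close>)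
      finally show ?thesis using usum by simp
    qed
    show "\<kappa> a b \<le> \<tau>" if far: "r \<le> dist a b" for a b
    proof -
      have "u z a / I z * u z b \<le> exp (- (l * (r / 2 - s))) / (\<beta> * (exp (- (l * s)) / c))" if z: "z \<in> Z" for z
      proof -
        have "r / 2 \<le> dist z a \<or> r / 2 \<le> dist z b"
          using far dist_triangle3[of a b z] by linarith
        then have "u z a * u z b \<le> exp (- (l * (r / 2 - s)))"
        proof
          assume "r / 2 \<le> dist z a"
          from mult_mono[OF ufar[OF this] u1[OF z, of b]] up show ?thesis by (simp add: less_imp_le)
        next
          assume "r / 2 \<le> dist z b"
          from mult_mono[OF u1[OF z, of a] ufar[OF this]] up show ?thesis by (simp add: less_imp_le)
        qed
        then have "(u z a * u z b) / I z \<le> exp (- (l * (r / 2 - s))) / (\<beta> * (exp (- (l * s)) / c))"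
          using Ige[OF z] \<beta>(1) c by (intro frac_le) auto
        then show ?thesis by simp
      qed
      then have "\<kappa> a b \<le> c * (exp (- (l * (r / 2 - s))) / (\<beta> * (exp (- (l * s)) / c)))"
        unfolding \<kappa>_def c_def by (intro sum_bounded_above)
      also have "\<dots> = \<tau> * (X * (exp (- (l * (r / 2 - s))) / exp (- (l * s))))"
        using c \<beta>(1) \<tau> by (simp add: X_def field_simps)
      also have "exp (- (l * (r / 2 - s))) / exp (- (l * s)) = exp (- X)"
      proof -
        have "- (l * (r / 2 - s)) - - (l * s) = - (l * (r / 4))" by (simp add: s_def field_simps)
        then show ?thesis using l(2) by (simp only: exp_diff[symmetric])
      qed
      also have "\<tau> * (X * exp (- X)) \<le> \<tau> * 1"
      proof (intro mult_left_mono)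
        have "X \<le> exp X" using exp_ge_add_one_self[of X] by linarith
        then show "X * exp (- X) \<le> 1" by (simp add: exp_minus field_simps)
      qed (use \<tau> in simp)
      finally show ?thesis by simp
    qed
  qed (use l r \<tau> in auto)
  then show ?thesis by blast
qed

section \<open>One step of the smeared chain and its error\<close>

locale skew_kernel = skew_torus \<sigma> D g f L + smoothing_kernel \<kappa> r \<tau> \<Lambda>
  for \<sigma> D :: real and g :: "('n::finite) torus \<Rightarrow> 'n torus"
    and f :: "'n torus \<times> ('m::finite) torus \<Rightarrow> 'm torus" and L :: real
    and \<kappa> :: "'n torus \<Rightarrow> 'n torus \<Rightarrow> real" and r \<tau> \<Lambda> :: real
begin

text \<open>The action of one smeared step on observables: the base point is resampled from
  \<open>\<kappa> \<omega>\<close> before \<open>g\<close> acts, but the fiber moves by the original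
  point, to \<open>f (\<omega>, y)\<close>.\<close>

definition smoothed_step :: "('n torus \<times> 'm torus \<Rightarrow> real) \<Rightarrow> 'n torus \<times> 'm torus \<Rightarrow> real" where
  "smoothed_step \<Theta> = (\<lambda>(\<omega>, y). \<integral>\<omega>'. \<kappa> \<omega> \<omega>' * \<Theta> (g \<omega>', f (\<omega>, y)) \<partial>lebesgue_torus)"

lemma smoothed_step_measurable:
  assumes [measurable]: "\<Theta> \<in> borel_measurable (borel \<Otimes>\<^sub>M borel)"
  shows "smoothed_step \<Theta> \<in> borel_measurable (borel \<Otimes>\<^sub>M borel)"
proof -
  have "(\<lambda>z. \<integral>\<omega>'. \<kappa> (fst z) \<omega>' * \<Theta> (g \<omega>', f z) \<partial>lebesgue_torus) \<in> borel_measurable (borel \<Otimes>\<^sub>M borel)"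
    by (rule leb_torus.borel_measurable_lebesgue_integral) measurable
  then show ?thesis by (simp add: smoothed_step_def case_prod_beta')
qed

lemma smoothed_step_integrable:
  assumes [measurable]: "\<Theta> \<in> borel_measurable (borel \<Otimes>\<^sub>M borel)" and b: "\<And>p. \<bar>\<Theta> p\<bar> \<le> T"
  shows "integrable lebesgue_torus (\<lambda>\<omega>'. \<kappa> \<omega> \<omega>' * \<Theta> (g \<omega>', y))"
proof (rule integrable_torus_bounded[of _ "exp (\<Lambda> * real CARD('n)) * T"])
  show "(\<lambda>\<omega>'. \<kappa> \<omega> \<omega>' * \<Theta> (g \<omega>', y)) \<in> borel_measurable borel"
    using loglip_measurable[OF kernel_loglip[of \<omega>]] by measurable
  show "\<bar>\<kappa> \<omega> \<omega>' * \<Theta> (g \<omega>', y)\<bar> \<le> exp (\<Lambda> * real CARD('n)) * T" for \<omega>'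
    unfolding abs_mult using kernel_le[of \<omega> \<omega>'] kernel_pos[of \<omega> \<omega>'] b by (intro mult_mono) auto
qed

lemma smoothed_step_bounds:
  assumes m: "\<Theta> \<in> borel_measurable (borel \<Otimes>\<^sub>M borel)" and b: "\<And>p. i \<le> \<Theta> p" "\<And>p. \<Theta> p \<le> s"
  shows "i \<le> smoothed_step \<Theta> p" "smoothed_step \<Theta> p \<le> s"
proof -
  obtain \<omega> y where p: "p = (\<omega>, y)" by (cases p)
  have "\<bar>\<Theta> q\<bar> \<le> max \<bar>i\<bar> \<bar>s\<bar>" for q using b[of q] by (simp add: abs_if max_def)
  note int = smoothed_step_integrable[OF m this, of \<omega> "f (\<omega>, y)"]
  have "(\<integral>\<omega>'. \<kappa> \<omega> \<omega>' * i \<partial>lebesgue_torus) \<le> smoothed_step \<Theta> p"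
    unfolding smoothed_step_def p prod.case using kernel_pos[of \<omega>] b
    by (intro integral_mono int integrable_mult_left kernel_integrable mult_left_mono) (auto simp: less_imp_le)
  then show "i \<le> smoothed_step \<Theta> p" by (simp add: kernel_integral)
  have "smoothed_step \<Theta> p \<le> (\<integral>\<omega>'. \<kappa> \<omega> \<omega>' * s \<partial>lebesgue_torus)"
    unfolding smoothed_step_def p prod.case using kernel_pos[of \<omega>] b
    by (intro integral_mono int integrable_mult_left kernel_integrable mult_left_mono) (auto simp: less_imp_le)
  then show "smoothed_step \<Theta> p \<le> s" by (simp add: kernel_integral)
qed

lemma smoothed_step_loglip:
  assumes m: "\<Theta> \<in> borel_measurable (borel \<Otimes>\<^sub>M borel)" and b: "\<And>p. i \<le> \<Theta> p" "\<And>p. \<Theta> p \<le> s" and i: "0 < i"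
    and ll: "\<And>\<omega>. loglip l (\<lambda>y. \<Theta> (\<omega>, y))" and l: "0 \<le> l"
  shows "loglip (L * l) (\<lambda>y. smoothed_step \<Theta> (\<omega>, y))"
  unfolding loglip_def
proof (intro conjI allI)
  fix x y
  show "0 < smoothed_step \<Theta> (\<omega>, x)" using smoothed_step_bounds(1)[OF m b, of "(\<omega>, x)"] i by simp
  have "\<bar>\<Theta> q\<bar> \<le> s" for q using b[of q] i by (simp add: abs_if)
  note int = smoothed_step_integrable[OF m this, of \<omega>]
  have "smoothed_step \<Theta> (\<omega>, x) \<le> (\<integral>\<omega>'. exp (L * l * dist x y) * (\<kappa> \<omega> \<omega>' * \<Theta> (g \<omega>', f (\<omega>, y))) \<partial>lebesgue_torus)"
    unfolding smoothed_step_def prod.case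
  proof (intro integral_mono int integrable_mult_right)
    fix \<omega>'
    have "\<Theta> (g \<omega>', f (\<omega>, x)) \<le> exp (L * l * dist x y) * \<Theta> (g \<omega>', f (\<omega>, y))"
      using loglipD[OF loglip_comp_fiber[OF ll l]] .
    then show "\<kappa> \<omega> \<omega>' * \<Theta> (g \<omega>', f (\<omega>, x)) \<le> exp (L * l * dist x y) * (\<kappa> \<omega> \<omega>' * \<Theta> (g \<omega>', f (\<omega>, y)))"
      using mult_left_mono[OF _ less_imp_le[OF kernel_pos[of \<omega> \<omega>']]] by (metis mult.left_commute)
  qed
  then show "smoothed_step \<Theta> (\<omega>, x) \<le> exp (L * l * dist x y) * smoothed_step \<Theta> (\<omega>, y)"
    by (simp add: smoothed_step_def)
qed

text \<open>In \<open>A \<omega> \<omega>'\<close> the point fed to \<open>g\<close> is frozen at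
  \<open>\<omega>'\<close>, so fiber regularity of \<open>\<Theta>\<close> suffices to make it
  log-Lipschitz in \<open>\<omega>\<close> with constant \<open>2 * D + 2 * L * l\<close>. The
  deterministic integral is that of \<open>A\<close> on the diagonal; the smeared one averages
  \<open>A\<close> over \<open>\<omega>\<close> with weight \<kappa>. Pairs closer than
  \<open>r\<close> produce the exponential term, the others the tail \<tau>.\<close>

lemma smoothed_step_error:
  assumes m [measurable]: "\<Theta> \<in> borel_measurable (borel \<Otimes>\<^sub>M borel)"
    and b: "\<And>p. 0 < \<Theta> p" "\<And>p. \<Theta> p \<le> T"
    and ll: "\<And>\<omega>. loglip l (\<lambda>y. \<Theta> (\<omega>, y))" and l: "0 \<le> l"
  shows "\<bar>(\<integral>\<omega>. \<Theta> ((F ^^ Suc k) (\<omega>, x)) \<partial>lebesgue_torus) - (\<integral>\<omega>. smoothed_step \<Theta> ((F ^^ k) (\<omega>, x)) \<partial>lebesgue_torus)\<bar>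
    \<le> T * exp (2 * D * real CARD('n)) * (exp ((2 * D + 2 * L * l) * r) - 1 + \<tau>)"
proof -
  let ?M = "lebesgue_torus :: 'n torus measure"
  let ?G = "2 * D + 2 * L * l"
  define B where "B = T * exp (2 * D * real CARD('n))"
  define A where "A \<omega> \<omega>' = disint x k (\<lambda>y. \<Theta> (g \<omega>', f (\<omega>, y))) \<omega>" for \<omega> \<omega>'
  define \<delta> where "\<delta> = B * (exp (?G * r) - 1 + \<tau>)"
  have T: "0 \<le> T" using b[of undefined] by simp
  have G0: "0 \<le> ?G" using D_pos L_nonneg l by simp
  have A0: "0 \<le> A \<omega> \<omega>'" for \<omega> \<omega>' unfolding A_def using b(1) by (intro disint_nonneg) (simp add: less_imp_le)
  have AB: "A \<omega> \<omega>' \<le> B" for \<omega> \<omega>' unfolding A_def B_def using b(2) T by (intro disint_le)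
  have B0: "0 \<le> B" using T by (simp add: B_def)
  have Am: "(\<lambda>\<omega>. A \<omega> \<omega>') \<in> borel_measurable borel" for \<omega>'
    unfolding A_def using disint_integral(1)[of "\<lambda>p. \<Theta> (g \<omega>', f p)" x k] b(1) by (simp add: less_imp_le)
  have Ad: "(\<lambda>\<omega>. A \<omega> \<omega>) \<in> borel_measurable borel"
    unfolding A_def using disint_integral(1)[of "\<lambda>p. \<Theta> (g (fst p), f p)" x k] b(1) by (simp add: less_imp_le)
  have A1: "A \<omega> \<omega>' \<le> exp (?G * dist \<omega> \<omega>') * A \<omega>' \<omega>'" for \<omega> \<omega>'
  proof -
    let ?\<Phi> = "\<lambda>\<omega> y. \<Theta> (g \<omega>', f (\<omega>, y))"
    have lk: "loglip (2 * D + L * l) (disint x k (?\<Phi> \<omega>'))"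
      using L_nonneg l by (intro disint_loglip loglip_comp_fiber ll) auto
    have "A \<omega> \<omega>' \<le> exp (L * l * dist \<omega> \<omega>') * disint x k (?\<Phi> \<omega>') \<omega>"
      unfolding A_def by (rule disint_mono) (rule loglip_comp_base[OF ll l])
    also have "\<dots> \<le> exp (L * l * dist \<omega> \<omega>') * (exp ((2 * D + L * l) * dist \<omega> \<omega>') * A \<omega>' \<omega>')"
      unfolding A_def by (intro mult_left_mono loglipD[OF lk]) simp
    also have "\<dots> = exp (?G * dist \<omega> \<omega>') * A \<omega>' \<omega>'"
    proof -
      have "exp (L * l * dist \<omega> \<omega>') * exp ((2 * D + L * l) * dist \<omega> \<omega>') = exp (?G * dist \<omega> \<omega>')"
        unfolding mult_exp_exp by (simp add: algebra_simps)
      then show ?thesis by (metis mult.assoc)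
    qed
    finally show ?thesis .
  qed
  have A2: "A \<omega>' \<omega>' \<le> exp (?G * dist \<omega> \<omega>') * A \<omega> \<omega>'" for \<omega> \<omega>'
  proof -
    let ?\<Phi> = "\<lambda>\<omega> y. \<Theta> (g \<omega>', f (\<omega>, y))"
    have lk: "loglip (2 * D + L * l) (disint x k (?\<Phi> \<omega>'))"
      using L_nonneg l by (intro disint_loglip loglip_comp_fiber ll) auto
    have "A \<omega>' \<omega>' \<le> exp ((2 * D + L * l) * dist \<omega>' \<omega>) * disint x k (?\<Phi> \<omega>') \<omega>"
      unfolding A_def by (rule loglipD[OF lk])
    also have "\<dots> \<le> exp ((2 * D + L * l) * dist \<omega>' \<omega>) * (exp (L * l * dist \<omega>' \<omega>) * A \<omega> \<omega>')"
      unfolding A_def by (intro mult_left_mono disint_mono loglip_comp_base[OF ll l]) simp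
    also have "\<dots> = exp (?G * dist \<omega> \<omega>') * A \<omega> \<omega>'"
    proof -
      have "exp ((2 * D + L * l) * dist \<omega>' \<omega>) * exp (L * l * dist \<omega>' \<omega>) = exp (?G * dist \<omega> \<omega>')"
        unfolding mult_exp_exp by (simp add: algebra_simps dist_commute)
      then show ?thesis by (metis mult.assoc)
    qed
    finally show ?thesis .
  qed
  have near: "\<kappa> \<omega> \<omega>' * \<bar>A \<omega> \<omega>' - A \<omega>' \<omega>'\<bar> \<le> \<kappa> \<omega> \<omega>' * (B * (exp (?G * r) - 1)) + \<tau> * B" for \<omega> \<omega>'
  proof (cases "r \<le> dist \<omega> \<omega>'")
    case True
    have "\<kappa> \<omega> \<omega>' * \<bar>A \<omega> \<omega>' - A \<omega>' \<omega>'\<bar> \<le> \<tau> * B"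
      using kernel_far[OF True] A0[of \<omega> \<omega>'] AB[of \<omega> \<omega>'] A0[of \<omega>' \<omega>'] AB[of \<omega>' \<omega>'] \<tau>_nonneg
      by (intro mult_mono) auto
    moreover have "0 \<le> \<kappa> \<omega> \<omega>' * (B * (exp (?G * r) - 1))"
      using kernel_pos[of \<omega> \<omega>'] B0 G0 r_nonneg by (intro mult_nonneg_nonneg) auto
    ultimately show ?thesis by linarith
  next
    case False
    let ?e = "exp (?G * dist \<omega> \<omega>')"
    have e: "1 \<le> ?e" "?e \<le> exp (?G * r)" using False G0 by (auto intro!: mult_left_mono)
    have "A \<omega> \<omega>' - A \<omega>' \<omega>' \<le> B * (?e - 1)"
    proof -
      have "A \<omega> \<omega>' - A \<omega>' \<omega>' \<le> A \<omega>' \<omega>' * (?e - 1)" using A1[of \<omega> \<omega>'] by (simp add: algebra_simps)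
      also have "\<dots> \<le> B * (?e - 1)" using AB e by (intro mult_right_mono) auto
      finally show ?thesis .
    qed
    moreover have "A \<omega>' \<omega>' - A \<omega> \<omega>' \<le> B * (?e - 1)"
    proof -
      have "A \<omega>' \<omega>' - A \<omega> \<omega>' \<le> A \<omega> \<omega>' * (?e - 1)" using A2[of \<omega>' \<omega>] by (simp add: algebra_simps)
      also have "\<dots> \<le> B * (?e - 1)" using AB e by (intro mult_right_mono) auto
      finally show ?thesis .
    qed
    ultimately have "\<bar>A \<omega> \<omega>' - A \<omega>' \<omega>'\<bar> \<le> B * (?e - 1)" by simp
    also have "\<dots> \<le> B * (exp (?G * r) - 1)" using e B0 by (intro mult_left_mono) auto
    finally have "\<kappa> \<omega> \<omega>' * \<bar>A \<omega> \<omega>' - A \<omega>' \<omega>'\<bar> \<le> \<kappa> \<omega> \<omega>' * (B * (exp (?G * r) - 1))"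
      using kernel_pos[of \<omega> \<omega>'] by (intro mult_left_mono) auto
    then show ?thesis using \<tau>_nonneg B0 by (simp add: add_increasing2)
  qed
  \<comment> \<open>The average is over the first variable for a fixed second one; its total weight
    is 1 by the symmetry of the kernel.\<close>
  define H where "H \<omega>' = (\<integral>\<omega>. \<kappa> \<omega> \<omega>' * A \<omega> \<omega>' \<partial>?M)" for \<omega>'
  have kA: "integrable ?M (\<lambda>\<omega>. \<kappa> \<omega> \<omega>' * h \<omega>)" if "h \<in> borel_measurable borel" "\<And>\<omega>. \<bar>h \<omega>\<bar> \<le> K" for h K \<omega>'
  proof (rule integrable_torus_bounded[of _ "exp (\<Lambda> * real CARD('n)) * K"])
    show "(\<lambda>\<omega>. \<kappa> \<omega> \<omega>' * h \<omega>) \<in> borel_measurable borel"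
      using that(1) loglip_measurable[OF kernel_loglip[of \<omega>']] by (simp add: kernel_sym[of _ \<omega>'])
    show "\<bar>\<kappa> \<omega> \<omega>' * h \<omega>\<bar> \<le> exp (\<Lambda> * real CARD('n)) * K" for \<omega>
      unfolding abs_mult using kernel_le[of \<omega> \<omega>'] kernel_pos[of \<omega> \<omega>'] that(2) by (intro mult_mono) auto
  qed
  have main: "\<bar>H \<omega>' - A \<omega>' \<omega>'\<bar> \<le> \<delta>" for \<omega>'
  proof -
    have i1: "integrable ?M (\<lambda>\<omega>. \<kappa> \<omega> \<omega>' * A \<omega> \<omega>')" using A0 AB by (intro kA[OF Am, of _ B]) auto
    have i2: "integrable ?M (\<lambda>\<omega>. \<kappa> \<omega> \<omega>' * A \<omega>' \<omega>')" by (intro integrable_mult_left kernel_integrable')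
    have "H \<omega>' - A \<omega>' \<omega>' = (\<integral>\<omega>. \<kappa> \<omega> \<omega>' * A \<omega> \<omega>' - \<kappa> \<omega> \<omega>' * A \<omega>' \<omega>' \<partial>?M)"
      using i1 i2 kernel_integral'[of \<omega>'] by (simp add: H_def)
    also have "\<bar>\<dots>\<bar> \<le> (\<integral>\<omega>. \<bar>\<kappa> \<omega> \<omega>' * A \<omega> \<omega>' - \<kappa> \<omega> \<omega>' * A \<omega>' \<omega>'\<bar> \<partial>?M)" by (rule integral_abs_bound)
    also have "\<dots> \<le> (\<integral>\<omega>. \<kappa> \<omega> \<omega>' * (B * (exp (?G * r) - 1)) + \<tau> * B \<partial>?M)"
    proof (rule integral_mono)
      show "integrable ?M (\<lambda>\<omega>. \<bar>\<kappa> \<omega> \<omega>' * A \<omega> \<omega>' - \<kappa> \<omega> \<omega>' * A \<omega>' \<omega>'\<bar>)" using i1 i2 by auto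
      show "integrable ?M (\<lambda>\<omega>. \<kappa> \<omega> \<omega>' * (B * (exp (?G * r) - 1)) + \<tau> * B)"
        using kernel_integrable'[of \<omega>'] by auto
      show "\<bar>\<kappa> \<omega> \<omega>' * A \<omega> \<omega>' - \<kappa> \<omega> \<omega>' * A \<omega>' \<omega>'\<bar> \<le> \<kappa> \<omega> \<omega>' * (B * (exp (?G * r) - 1)) + \<tau> * B" for \<omega>
        using near[of \<omega> \<omega>'] kernel_pos[of \<omega> \<omega>'] by (simp add: abs_mult right_diff_distrib[symmetric])
    qed
    also have "\<dots> = B * (exp (?G * r) - 1) + \<tau> * B"
      using kernel_integrable'[of \<omega>'] kernel_integral'[of \<omega>']
      by (subst Bochner_Integration.integral_add) (auto simp: leb_torus.prob_space[simplified])
    finally show ?thesis by (simp add: \<delta>_def algebra_simps)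
  qed
  let ?h = "\<lambda>(\<omega>, \<omega>'). \<kappa> (fst ((F ^^ k) (\<omega>, x))) \<omega>' * \<Theta> (g \<omega>', f ((F ^^ k) (\<omega>, x)))"
  interpret P: pair_sigma_finite ?M ?M ..
  interpret PP: prob_space "?M \<Otimes>\<^sub>M ?M" by (rule prob_space_pair) unfold_locales
  have hm [measurable]: "?h \<in> borel_measurable (?M \<Otimes>\<^sub>M ?M)"
    using kernel_measurable by measurable
  have hi: "integrable (?M \<Otimes>\<^sub>M ?M) ?h"
  proof (rule PP.integrable_const_bound[of _ "exp (\<Lambda> * real CARD('n)) * T"])
    show "AE p in ?M \<Otimes>\<^sub>M ?M. norm (?h p) \<le> exp (\<Lambda> * real CARD('n)) * T"
    proof (intro AE_I2)
      fix p :: "'n torus \<times> 'n torus"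
      show "norm (?h p) \<le> exp (\<Lambda> * real CARD('n)) * T"
        using kernel_le kernel_pos b T unfolding case_prod_beta real_norm_def abs_mult
        by (intro mult_mono) (auto simp: abs_of_pos less_imp_le)
    qed
  qed (rule hm)
  have HH: "H \<omega>' = (\<integral>\<omega>. ?h (\<omega>, \<omega>') \<partial>?M)" for \<omega>'
  proof -
    let ?\<Psi> = "\<lambda>p. \<kappa> (fst p) \<omega>' * \<Theta> (g \<omega>', f p)"
    have "?\<Psi> \<in> borel_measurable (borel \<Otimes>\<^sub>M borel)"
      using kernel_measurable by measurable
    then have "(\<integral>\<omega>. disint x k (\<lambda>y. ?\<Psi> (\<omega>, y)) \<omega> \<partial>?M) = (\<integral>\<omega>. ?\<Psi> ((F ^^ k) (\<omega>, x)) \<partial>?M)"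
      using b(1) kernel_pos by (intro disint_integral(2) mult_nonneg_nonneg) (simp_all add: less_imp_le)
    then show ?thesis by (simp add: H_def A_def disint_cmult)
  qed
  have "(\<integral>\<omega>. smoothed_step \<Theta> ((F ^^ k) (\<omega>, x)) \<partial>?M) = (\<integral>\<omega>. \<integral>\<omega>'. ?h (\<omega>, \<omega>') \<partial>?M \<partial>?M)"
    by (simp add: smoothed_step_def case_prod_beta)
  also have "\<dots> = (\<integral>\<omega>'. \<integral>\<omega>. ?h (\<omega>, \<omega>') \<partial>?M \<partial>?M)"
    using P.Fubini_integral[of "\<lambda>\<omega> \<omega>'. ?h (\<omega>, \<omega>')"] hi by simp
  finally have E1: "(\<integral>\<omega>. smoothed_step \<Theta> ((F ^^ k) (\<omega>, x)) \<partial>?M) = (\<integral>\<omega>'. H \<omega>' \<partial>?M)" by (simp add: HH)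
  have E2: "(\<integral>\<omega>. \<Theta> ((F ^^ Suc k) (\<omega>, x)) \<partial>?M) = (\<integral>\<omega>. A \<omega> \<omega> \<partial>?M)"
  proof -
    have "(\<integral>\<omega>. A \<omega> \<omega> \<partial>?M) = (\<integral>\<omega>. disint x k (\<lambda>y. \<Theta> (F (\<omega>, y))) \<omega> \<partial>?M)"
      by (simp add: A_def skew_product_def)
    also have "\<dots> = (\<integral>\<omega>. \<Theta> (F ((F ^^ k) (\<omega>, x))) \<partial>?M)"
      using b(1) by (intro disint_integral(2)[of "\<lambda>p. \<Theta> (F p)"]) (auto simp: less_imp_le)
    finally show ?thesis by simp
  qed
  have iH: "integrable ?M H" unfolding HH[abs_def] using P.integrable_snd[of "\<lambda>\<omega> \<omega>'. ?h (\<omega>, \<omega>')"] hi by simp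
  have iA: "integrable ?M (\<lambda>\<omega>. A \<omega> \<omega>)" using A0 AB by (intro integrable_torus_bounded[OF Ad, of B]) auto
  have "\<bar>(\<integral>\<omega>. A \<omega> \<omega> \<partial>?M) - (\<integral>\<omega>. H \<omega> \<partial>?M)\<bar> = \<bar>\<integral>\<omega>. A \<omega> \<omega> - H \<omega> \<partial>?M\<bar>" using iA iH by simp
  also have "\<dots> \<le> (\<integral>\<omega>. \<bar>A \<omega> \<omega> - H \<omega>\<bar> \<partial>?M)" by (rule integral_abs_bound)
  also have "\<dots> \<le> (\<integral>\<omega>. \<delta> \<partial>?M)" using iA iH main by (intro integral_mono) (auto simp: abs_minus_commute)
  also have "\<dots> = \<delta>" by (simp add: leb_torus.prob_space[simplified])
  finally show ?thesis unfolding E1 E2 by (simp add: \<delta>_def B_def)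
qed

end

section \<open>The random counterpart\<close>

text \<open>By the layer-cake formula the integral of \<open>u\<close> is the integral over
  \<open>t\<close> in \<open>[0, T]\<close> of the measure of \<open>{x. t < u x}\<close>, and at
  each level the two measures differ by at most their total variation distance.\<close>

lemma integral_diff_le_tv_dist:
  assumes \<mu>: "\<mu> \<in> borel_probs" and \<nu>: "\<nu> \<in> borel_probs"
    and u [measurable]: "u \<in> borel_measurable borel" and b: "\<And>x. 0 \<le> u x" "\<And>x. u x \<le> T"
  shows "(\<integral>x. u x \<partial>\<mu>) - (\<integral>x. u x \<partial>\<nu>) \<le> T * tv_dist \<mu> \<nu>"
proof -
  have layer: "(\<integral>x. u x \<partial>m) = (\<integral>t. indicator {0..T} t * measure m {x. t < u x} \<partial>lborel)"
    if m: "m \<in> borel_probs" for m :: "'a measure"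
  proof -
    interpret prob_space m using m by (simp add: borel_probs_def)
    have [measurable_cong]: "sets m = sets borel" using m by (simp add: borel_probs_def)
    have sp: "space m = UNIV" using sets_eq_imp_space_eq[OF \<open>sets m = sets borel\<close>] by simp
    interpret P: pair_sigma_finite m "lborel :: real measure" ..
    have eq: "ennreal (u x) = (\<integral>\<^sup>+t. indicator {0..<u x} t \<partial>lborel)" for x
      using b(1)[of x] by simp
    have "(\<integral>\<^sup>+x. ennreal (u x) \<partial>m) = (\<integral>\<^sup>+x. \<integral>\<^sup>+t. indicator {p. 0 \<le> snd p \<and> snd p < u (fst p)} (x, t) \<partial>lborel \<partial>m)"
      by (intro nn_integral_cong) (simp add: eq indicator_def)
    also have "\<dots> = (\<integral>\<^sup>+t. \<integral>\<^sup>+x. indicator {p. 0 \<le> snd p \<and> snd p < u (fst p)} (x, t) \<partial>m \<partial>lborel)"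
      by (rule P.Fubini'[symmetric]) measurable
    also have "\<dots> = (\<integral>\<^sup>+t. ennreal (indicator {0..T} t * measure m {x. t < u x}) \<partial>lborel)"
    proof (rule nn_integral_cong)
      fix t :: real
      have "(\<integral>\<^sup>+x. indicator {p. 0 \<le> snd p \<and> snd p < u (fst p)} (x, t) \<partial>m) =
          (\<integral>\<^sup>+x. indicator {0..T} t * indicator {x. t < u x} x \<partial>m)"
        using b(2) by (intro nn_integral_cong) (auto simp: indicator_def, meson less_imp_le less_le_trans)
      also have "\<dots> = indicator {0..T} t * emeasure m {x. t < u x}"
        by (subst nn_integral_cmult) (auto simp: sp)
      finally show "(\<integral>\<^sup>+x. indicator {p. 0 \<le> snd p \<and> snd p < u (fst p)} (x, t) \<partial>m) =
          ennreal (indicator {0..T} t * measure m {x. t < u x})"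
        by (simp add: emeasure_eq_measure indicator_def)
    qed
    finally have *: "(\<integral>\<^sup>+x. ennreal (u x) \<partial>m) = (\<integral>\<^sup>+t. ennreal (indicator {0..T} t * measure m {x. t < u x}) \<partial>lborel)" .
    have [measurable]: "(\<lambda>t. measure m {x. t < u x}) \<in> borel_measurable borel"
      by measurable (auto simp: sp)
    show ?thesis
      using b(1) * by (subst (1 2) integral_eq_nn_integral) auto
  qed
  have int: "integrable lborel (\<lambda>t. indicator {0..T} t * measure m {x. t < u x})"
    if m: "m \<in> borel_probs" for m :: "'a measure"
  proof -
    interpret prob_space m using m by (simp add: borel_probs_def)
    have [measurable_cong]: "sets m = sets borel" using m by (simp add: borel_probs_def)
    have sp: "space m = UNIV" using sets_eq_imp_space_eq[OF \<open>sets m = sets borel\<close>] by simp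
    have [measurable]: "(\<lambda>t. measure m {x. t < u x}) \<in> borel_measurable borel"
      by measurable (auto simp: sp)
    show ?thesis
    proof (rule Bochner_Integration.integrable_bound[of lborel "indicat_real {0..T}"])
      show "AE t in lborel. norm (indicator {0..T} t * measure m {x. t < u x}) \<le> norm (indicat_real {0..T} t)"
        by (auto simp: indicator_def)
      show "integrable lborel (indicat_real {0..T})"
        by (rule integrable_real_indicator) (auto simp: emeasure_lborel_Icc_eq)
    qed simp
  qed
  have bdd: "bdd_above ((\<lambda>A. \<bar>measure \<mu> A - measure \<nu> A\<bar>) ` sets borel)"
  proof (rule bdd_aboveI2[of _ _ 1])
    fix A
    have "measure \<mu> A \<le> 1" "measure \<nu> A \<le> 1"
      using \<mu> \<nu> prob_space.prob_le_1 by (auto simp: borel_probs_def)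
    then show "\<bar>measure \<mu> A - measure \<nu> A\<bar> \<le> 1"
      using measure_nonneg[of \<mu> A] measure_nonneg[of \<nu> A] by linarith
  qed
  have tv: "measure \<mu> A - measure \<nu> A \<le> tv_dist \<mu> \<nu>" if "A \<in> sets borel" for A
    using cSUP_upper[OF that bdd] by (simp add: tv_dist_def)
  have T: "0 \<le> T" using b[of undefined] by simp
  have "(\<integral>x. u x \<partial>\<mu>) - (\<integral>x. u x \<partial>\<nu>) =
      (\<integral>t. indicator {0..T} t * measure \<mu> {x. t < u x} - indicator {0..T} t * measure \<nu> {x. t < u x} \<partial>lborel)"
    using int[OF \<mu>] int[OF \<nu>] by (simp add: layer \<mu> \<nu>)
  also have "\<dots> \<le> (\<integral>t. indicator {0..T} t * tv_dist \<mu> \<nu> \<partial>lborel)"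
  proof (rule integral_mono)
    show "integrable lborel (\<lambda>t. indicator {0..T} t * measure \<mu> {x. t < u x} - indicator {0..T} t * measure \<nu> {x. t < u x})"
      using int[OF \<mu>] int[OF \<nu>] by auto
    show "integrable lborel (\<lambda>t. indicator {0..T} t * tv_dist \<mu> \<nu>)"
      by (intro integrable_mult_left integrable_real_indicator) (auto simp: emeasure_lborel_Icc_eq)
    show "indicator {0..T} t * measure \<mu> {x. t < u x} - indicator {0..T} t * measure \<nu> {x. t < u x} \<le>
        indicator {0..T} t * tv_dist \<mu> \<nu>" for t
      using tv[of "{x. t < u x}"] by (simp add: indicator_def)
  qed
  also have "\<dots> = T * tv_dist \<mu> \<nu>" using T by simp
  finally show ?thesis .
qed

lemma tv_dist_le_1:
  assumes "\<mu> \<in> borel_probs" "\<nu> \<in> borel_probs"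
  shows "tv_dist \<mu> \<nu> \<le> 1"
  unfolding tv_dist_def
proof (rule cSUP_least)
  fix A
  have "measure \<mu> A \<le> 1" "measure \<nu> A \<le> 1"
    using assms prob_space.prob_le_1 by (auto simp: borel_probs_def)
  then show "\<bar>measure \<mu> A - measure \<nu> A\<bar> \<le> 1"
    using measure_nonneg[of \<mu> A] measure_nonneg[of \<nu> A] by linarith
qed (use sets.empty_sets in blast)

section \<open>The dual operator on observables\<close>

locale skew_acip = skew_torus \<sigma> D g f L
  for \<sigma> D :: real and g :: "('n::finite) torus \<Rightarrow> 'n torus"
    and f :: "'n torus \<times> ('m::finite) torus \<Rightarrow> 'm torus" and L :: real +
  fixes \<rho> :: "'n torus \<Rightarrow> real"
  assumes \<rho>: "acip_density g \<rho>"
begin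

lemma \<rho>_measurable [measurable]: "\<rho> \<in> borel_measurable borel" and \<rho>_nonneg: "0 \<le> \<rho> \<omega>"
  using \<rho> by (auto simp: acip_density_def)

lemma \<rho>_integrable: "integrable lebesgue_torus \<rho>" and \<rho>_integral: "(\<integral>\<omega>. \<rho> \<omega> \<partial>lebesgue_torus) = 1"
proof -
  have one: "(\<integral>\<^sup>+\<omega>. ennreal (\<rho> \<omega>) \<partial>lebesgue_torus) = 1"
    using \<rho> prob_space.emeasure_space_1[of "density lebesgue_torus (\<lambda>\<omega>. ennreal (\<rho> \<omega>))"]
    by (simp add: acip_density_def emeasure_density)
  show "integrable lebesgue_torus \<rho>"
    using one \<rho>_nonneg by (intro integrableI_nonneg) (auto cong: measurable_cong_sets)
  show "(\<integral>\<omega>. \<rho> \<omega> \<partial>lebesgue_torus) = 1"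
    using one \<rho>_nonneg by (subst integral_eq_nn_integral) (auto cong: measurable_cong_sets)
qed

lemma \<rho>_mult_integrable:
  assumes [measurable]: "v \<in> borel_measurable borel" and b: "\<And>\<omega>. \<bar>v \<omega>\<bar> \<le> T"
  shows "integrable lebesgue_torus (\<lambda>\<omega>. \<rho> \<omega> * v \<omega>)"
proof (rule Bochner_Integration.integrable_bound[of _ "\<lambda>\<omega>. \<rho> \<omega> * T"])
  show "integrable lebesgue_torus (\<lambda>\<omega>. \<rho> \<omega> * T)" using \<rho>_integrable by simp
  show "AE \<omega> in lebesgue_torus. norm (\<rho> \<omega> * v \<omega>) \<le> norm (\<rho> \<omega> * T)"
  proof (rule AE_I2)
    fix \<omega>
    have "\<bar>v \<omega>\<bar> \<le> \<bar>T\<bar>" using b[of \<omega>] by simp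
    then show "norm (\<rho> \<omega> * v \<omega>) \<le> norm (\<rho> \<omega> * T)" by (simp add: abs_mult mult_left_mono)
  qed
qed (simp cong: measurable_cong_sets)

text \<open>The dual of \<open>random_op\<close>, in the sense of
  \<open>random_op_borel_probs\<close>; on this side contraction is a pointwise statement about
  oscillations.\<close>

definition P' :: "('m torus \<Rightarrow> real) \<Rightarrow> 'm torus \<Rightarrow> real" where
  "P' u y = (\<integral>\<omega>. \<rho> \<omega> * u (f (\<omega>, y)) \<partial>lebesgue_torus)"

lemma dual_op_measurable:
  assumes [measurable]: "u \<in> borel_measurable borel"
  shows "P' u \<in> borel_measurable borel"
proof -
  have "(\<lambda>y. \<integral>\<omega>. \<rho> \<omega> * u (f (\<omega>, y)) \<partial>lebesgue_torus) \<in> borel_measurable borel"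
    by (rule leb_torus.borel_measurable_lebesgue_integral) measurable
  then show ?thesis by (simp add: P'_def[abs_def])
qed

text \<open>The third claim lets a lower bound for \<open>T - u\<close> serve as an upper bound for
  \<open>u\<close>.\<close>

lemma dual_op_bounds:
  assumes m [measurable]: "u \<in> borel_measurable borel" and b: "\<And>x. 0 \<le> u x" "\<And>x. u x \<le> T"
  shows "0 \<le> P' u y" "P' u y \<le> T" "P' (\<lambda>x. T - u x) y = T - P' u y"
proof -
  have i: "integrable lebesgue_torus (\<lambda>\<omega>. \<rho> \<omega> * u (f (\<omega>, y)))"
    using b by (intro \<rho>_mult_integrable[of _ T]) auto
  show "0 \<le> P' u y" unfolding P'_def using \<rho>_nonneg b by (intro Bochner_Integration.integral_nonneg) simp
  have "P' u y \<le> (\<integral>\<omega>. \<rho> \<omega> * T \<partial>lebesgue_torus)" unfolding P'_def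
    using \<rho>_nonneg b \<rho>_integrable by (intro integral_mono i mult_left_mono) auto
  then show "P' u y \<le> T" by (simp add: \<rho>_integral)
  show "P' (\<lambda>x. T - u x) y = T - P' u y"
    unfolding P'_def right_diff_distrib using i \<rho>_integrable
    by (subst Bochner_Integration.integral_diff) (auto simp: \<rho>_integral)
qed

lemma dual_op_pow_bounds:
  assumes m: "u \<in> borel_measurable borel" and b: "\<And>x. 0 \<le> u x" "\<And>x. u x \<le> T"
  shows "(P' ^^ n) u \<in> borel_measurable borel" "0 \<le> (P' ^^ n) u y" "(P' ^^ n) u y \<le> T"
    "(P' ^^ n) (\<lambda>x. T - u x) y = T - (P' ^^ n) u y"
proof -
  have *: "(P' ^^ n) u \<in> borel_measurable borel \<and> (\<forall>y. 0 \<le> (P' ^^ n) u y \<and> (P' ^^ n) u y \<le> T \<and>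
    (P' ^^ n) (\<lambda>x. T - u x) y = T - (P' ^^ n) u y)"
  proof (induction n)
    case (Suc n)
    then have eq: "(P' ^^ n) (\<lambda>x. T - u x) = (\<lambda>y. T - (P' ^^ n) u y)" by auto
    show ?case using Suc dual_op_measurable[of "(P' ^^ n) u"] dual_op_bounds[of "(P' ^^ n) u" T]
      by (simp add: eq)
  qed (use m b in auto)
  then show "(P' ^^ n) u \<in> borel_measurable borel" "0 \<le> (P' ^^ n) u y" "(P' ^^ n) u y \<le> T"
    "(P' ^^ n) (\<lambda>x. T - u x) y = T - (P' ^^ n) u y" by auto
qed

lemma random_op_borel_probs:
  assumes \<mu>: "\<mu> \<in> borel_probs"
  shows "random_op \<rho> f \<mu> \<in> borel_probs"
    and "\<lbrakk>u \<in> borel_measurable borel; \<And>x. 0 \<le> u x; \<And>x. u x \<le> T\<rbrakk> \<Longrightarrow>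
      (\<integral>x. u x \<partial>random_op \<rho> f \<mu>) = (\<integral>x. P' u x \<partial>\<mu>)"
proof -
  let ?N = "density lebesgue_torus (\<lambda>\<omega>. ennreal (\<rho> \<omega>))"
  interpret M: prob_space \<mu> using \<mu> by (simp add: borel_probs_def)
  have sm [measurable_cong]: "sets \<mu> = sets borel" using \<mu> by (simp add: borel_probs_def)
  have spm: "space \<mu> = UNIV" using sets_eq_imp_space_eq[OF sm] by simp
  interpret N: prob_space ?N using \<rho> by (simp add: acip_density_def)
  have \<mu>': "\<mu> \<in> space (subprob_algebra borel)"
    using M.prob_space_axioms sm by (simp add: space_subprob_algebra prob_space_imp_subprob_space)
  have K: "(\<lambda>\<omega>. distr \<mu> borel (\<lambda>x. f (\<omega>, x))) \<in> borel \<rightarrow>\<^sub>M subprob_algebra borel"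
    by (rule measurable_distr2[where M=borel]) (use \<mu>' in \<open>auto simp: case_prod_eta\<close>)
  then have K': "(\<lambda>\<omega>. distr \<mu> borel (\<lambda>x. f (\<omega>, x))) \<in> ?N \<rightarrow>\<^sub>M subprob_algebra borel"
    by (simp cong: measurable_cong_sets)
  have sr: "sets (random_op \<rho> f \<mu>) = sets borel"
    unfolding random_op_def by (rule sets_bind) (auto simp: sets_kernel[OF K'])
  have "prob_space (random_op \<rho> f \<mu>)"
    unfolding random_op_def
  proof (rule N.prob_space_bind[OF _ K'])
    show "AE \<omega> in ?N. prob_space (distr \<mu> borel (\<lambda>x. f (\<omega>, x)))"
      by (intro AE_I2 M.prob_space_distr) simp
  qed
  then show "random_op \<rho> f \<mu> \<in> borel_probs" using sr by (simp add: borel_probs_def)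
  assume m [measurable]: "u \<in> borel_measurable borel" and b: "\<And>x. 0 \<le> u x" "\<And>x. u x \<le> T"
  interpret P: pair_sigma_finite lebesgue_torus \<mu> ..
  have "(\<integral>\<^sup>+x. ennreal (u x) \<partial>random_op \<rho> f \<mu>) = (\<integral>\<^sup>+\<omega>. \<integral>\<^sup>+x. ennreal (u x) \<partial>distr \<mu> borel (\<lambda>x. f (\<omega>, x)) \<partial>?N)"
    unfolding random_op_def by (rule nn_integral_bind[OF _ K']) simp
  also have "\<dots> = (\<integral>\<^sup>+\<omega>. \<integral>\<^sup>+x. ennreal (u (f (\<omega>, x))) \<partial>\<mu> \<partial>?N)"
    by (intro nn_integral_cong nn_integral_distr) auto
  also have "\<dots> = (\<integral>\<^sup>+\<omega>. ennreal (\<rho> \<omega>) * (\<integral>\<^sup>+x. ennreal (u (f (\<omega>, x))) \<partial>\<mu>) \<partial>lebesgue_torus)"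
    by (rule nn_integral_density) auto
  also have "\<dots> = (\<integral>\<^sup>+\<omega>. \<integral>\<^sup>+x. ennreal (\<rho> \<omega> * u (f (\<omega>, x))) \<partial>\<mu> \<partial>lebesgue_torus)"
    using \<rho>_nonneg b by (intro nn_integral_cong) (auto simp: ennreal_mult nn_integral_cmult)
  also have "\<dots> = (\<integral>\<^sup>+x. \<integral>\<^sup>+\<omega>. ennreal (\<rho> \<omega> * u (f (\<omega>, x))) \<partial>lebesgue_torus \<partial>\<mu>)"
    by (rule P.Fubini'[symmetric]) measurable
  also have "\<dots> = (\<integral>\<^sup>+x. ennreal (P' u x) \<partial>\<mu>)"
    unfolding P'_def using \<rho>_nonneg b
    by (intro nn_integral_cong nn_integral_eq_integral \<rho>_mult_integrable[of _ T]) auto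
  finally have eq: "(\<integral>\<^sup>+x. ennreal (u x) \<partial>random_op \<rho> f \<mu>) = (\<integral>\<^sup>+x. ennreal (P' u x) \<partial>\<mu>)" .
  show "(\<integral>x. u x \<partial>random_op \<rho> f \<mu>) = (\<integral>x. P' u x \<partial>\<mu>)"
    using dual_op_measurable[OF m] dual_op_bounds(1)[OF m b] b(1) eq sr sm
    by (subst (1 2) integral_eq_nn_integral) (auto cong: measurable_cong_sets)
qed

lemma dual_op_pow_integral:
  assumes "\<mu> \<in> borel_probs" and "u \<in> borel_measurable borel" "\<And>x. 0 \<le> u x" "\<And>x. u x \<le> T"
  shows "(random_op \<rho> f ^^ n) \<mu> \<in> borel_probs \<and> (\<integral>x. u x \<partial>(random_op \<rho> f ^^ n) \<mu>) = (\<integral>x. (P' ^^ n) u x \<partial>\<mu>)"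
  using assms
proof (induction n arbitrary: u)
  case (Suc n)
  have IH: "(random_op \<rho> f ^^ n) \<mu> \<in> borel_probs" using Suc.IH[OF Suc.prems] by simp
  have "(\<integral>x. u x \<partial>random_op \<rho> f ((random_op \<rho> f ^^ n) \<mu>)) = (\<integral>x. P' u x \<partial>(random_op \<rho> f ^^ n) \<mu>)"
    by (rule random_op_borel_probs(2)[OF IH Suc.prems(2-4)])
  also have "\<dots> = (\<integral>x. (P' ^^ n) (P' u) x \<partial>\<mu>)"
    using Suc.IH[OF Suc.prems(1) dual_op_measurable[OF Suc.prems(2)] dual_op_bounds(1,2)[OF Suc.prems(2-4)]] by blast
  finally show ?case using random_op_borel_probs(1)[OF IH] by (simp add: funpow_swap1)
qed simp

text \<open>Ergodicity is applied to two point masses, whose distance is at most 1: integrals of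
  \<open>u\<close> against their images are the values of the dual iterate.\<close>

lemma dual_op_pow_osc:
  assumes erg: "geometrically_ergodic C lam \<rho> f" and C: "0 \<le> C" "0 \<le> lam" and n: "1 \<le> n"
    and u: "u \<in> borel_measurable borel" "\<And>x. 0 \<le> u x" "\<And>x. u x \<le> T"
  shows "(P' ^^ n) u y - (P' ^^ n) u z \<le> T * (C * lam ^ n)"
proof -
  have d: "return borel x \<in> borel_probs" for x :: "'m torus"
    by (simp add: borel_probs_def prob_space_return)
  have eq: "(P' ^^ n) u x = (\<integral>y. u y \<partial>(random_op \<rho> f ^^ n) (return borel x))" for x
    using dual_op_pow_integral[OF d[of x] u, of n] dual_op_pow_bounds(1)[OF u, of n]
    by (simp add: integral_return)
  have "(P' ^^ n) u y - (P' ^^ n) u z \<le>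
      T * tv_dist ((random_op \<rho> f ^^ n) (return borel y)) ((random_op \<rho> f ^^ n) (return borel z))"
    unfolding eq using dual_op_pow_integral[OF d u] u by (intro integral_diff_le_tv_dist) auto
  also have "\<dots> \<le> T * (C * lam ^ n * tv_dist (return borel y) (return borel z))"
    using erg n d u(2,3)[of y] unfolding geometrically_ergodic_def by (intro mult_left_mono) auto
  also have "\<dots> \<le> T * (C * lam ^ n * 1)"
    using tv_dist_le_1[OF d d, of y z] C u(2,3)[of y] by (intro mult_left_mono) auto
  finally show ?thesis by simp
qed

end

section \<open>Contraction of oscillations\<close>

text \<open>The last assumption lets a single transfer bring the kernel constant \<Lambda>, however
  large, down to at most \<open>2 * D\<close>.\<close>

locale skew_mixing = skew_kernel \<sigma> D g f L \<kappa> r \<tau> \<Lambda> + skew_acip \<sigma> D g f L \<rho>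
  for \<sigma> D :: real and g :: "('n::finite) torus \<Rightarrow> 'n torus"
    and f :: "'n torus \<times> ('m::finite) torus \<Rightarrow> 'm torus" and L :: real
    and \<kappa> :: "'n torus \<Rightarrow> 'n torus \<Rightarrow> real" and r \<tau> \<Lambda> :: real and \<rho> :: "'n torus \<Rightarrow> real" +
  assumes \<Lambda>_le: "\<Lambda> \<le> D * \<sigma>"
begin

text \<open>The transferred smearing density is at least \<open>exp (-2 D d)\<close>, and the invariant density at most \<open>exp (3 D d)\<close>,
  where \<open>d\<close> is the dimension of the base, which bounds the diameter of the torus.\<close>

definition minor :: real where
  "minor = exp (- (5 * D * real CARD('n)))"

lemma minor_pos: "0 < minor" and minor_le_1: "minor \<le> 1"
  using D_pos by (auto simp: minor_def)

definition base_avg :: "('n torus \<times> 'm torus \<Rightarrow> real) \<Rightarrow> 'm torus \<Rightarrow> real" where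
  "base_avg h y = (\<integral>\<omega>. \<rho> \<omega> * h (\<omega>, y) \<partial>lebesgue_torus)"

lemma base_avg_measurable:
  assumes [measurable]: "h \<in> borel_measurable (borel \<Otimes>\<^sub>M borel)"
  shows "base_avg h \<in> borel_measurable borel"
proof -
  have "(\<lambda>y. \<integral>\<omega>. \<rho> \<omega> * h (\<omega>, y) \<partial>lebesgue_torus) \<in> borel_measurable borel"
    by (rule leb_torus.borel_measurable_lebesgue_integral) measurable
  then show ?thesis by (simp add: base_avg_def[abs_def])
qed

lemma base_avg_bounds:
  assumes m [measurable]: "h \<in> borel_measurable (borel \<Otimes>\<^sub>M borel)" and b: "\<And>p. 0 \<le> h p" "\<And>p. h p \<le> T"
  shows "0 \<le> base_avg h y" "base_avg h y \<le> T" "base_avg (\<lambda>p. T - h p) y = T - base_avg h y"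
proof -
  have i: "integrable lebesgue_torus (\<lambda>\<omega>. \<rho> \<omega> * h (\<omega>, y))"
    using b by (intro \<rho>_mult_integrable[of _ T]) auto
  show "0 \<le> base_avg h y" unfolding base_avg_def using \<rho>_nonneg b by (intro Bochner_Integration.integral_nonneg) simp
  have "base_avg h y \<le> (\<integral>\<omega>. \<rho> \<omega> * T \<partial>lebesgue_torus)" unfolding base_avg_def
    using \<rho>_nonneg b \<rho>_integrable by (intro integral_mono i mult_left_mono) auto
  then show "base_avg h y \<le> T" by (simp add: \<rho>_integral)
  show "base_avg (\<lambda>p. T - h p) y = T - base_avg h y"
    unfolding base_avg_def right_diff_distrib using i \<rho>_integrable
    by (subst Bochner_Integration.integral_diff) (auto simp: \<rho>_integral)
qed

text \<open>A Doeblin condition, uniform in the starting point. The smear does not touch the fiber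
  value \<open>f p\<close>, so duality turns the step into an integral of \<open>h\<close> over the
  base with density \<open>transfer (\<kappa> \<omega>)\<close>, which has mass 1 and is
  log-Lipschitz with constant \<open>2 * D\<close>.\<close>

lemma smoothed_step_minorization:
  assumes m [measurable]: "h \<in> borel_measurable (borel \<Otimes>\<^sub>M borel)" and b: "\<And>p. 0 \<le> h p" "\<And>p. h p \<le> T"
  shows "minor * base_avg h (f p) \<le> smoothed_step h p"
proof -
  let ?M = "lebesgue_torus :: 'n torus measure"
  obtain \<omega> y where p: "p = (\<omega>, y)" by (cases p)
  define v where "v \<omega>' = h (\<omega>', f p)" for \<omega>'
  have [measurable]: "v \<in> borel_measurable borel" unfolding v_def by measurable
  have v: "0 \<le> v \<omega>'" "v \<omega>' \<le> T" for \<omega>' using b by (auto simp: v_def)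
  have km [measurable]: "\<kappa> \<omega> \<in> borel_measurable borel" using kernel_loglip by (rule loglip_measurable)
  have k0: "0 \<le> \<kappa> \<omega> \<omega>'" for \<omega>' using kernel_pos[of \<omega> \<omega>'] by simp
  have "loglip (D + \<Lambda> / \<sigma>) (transfer (\<kappa> \<omega>))" by (rule transfer_loglip[OF kernel_loglip \<Lambda>_nonneg])
  moreover have "D + \<Lambda> / \<sigma> \<le> 2 * D" using \<Lambda>_le \<sigma>_gt_1 by (simp add: field_simps)
  ultimately have ll: "loglip (2 * D) (transfer (\<kappa> \<omega>))" by (rule loglip_mono)
  have q1: "(\<integral>\<omega>'. transfer (\<kappa> \<omega>) \<omega>' \<partial>?M) = 1"
    using integral_transfer[OF km k0] kernel_integral by simp
  have q: "exp (- (2 * D * real CARD('n))) \<le> transfer (\<kappa> \<omega>) \<omega>'" for \<omega>'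
    using loglip_integral_bounds(2)[OF ll, of \<omega>'] D_pos q1 by simp
  have T: "0 \<le> T" using v[of undefined] by simp
  have "minor * base_avg h (f p) = (\<integral>\<omega>'. minor * (\<rho> \<omega>' * v \<omega>') \<partial>?M)" by (simp add: base_avg_def v_def)
  also have "\<dots> \<le> (\<integral>\<omega>'. transfer (\<kappa> \<omega>) \<omega>' * v \<omega>' \<partial>?M)"
  proof (rule integral_mono_AE)
    show "integrable ?M (\<lambda>\<omega>'. minor * (\<rho> \<omega>' * v \<omega>'))"
      using v by (intro integrable_mult_right \<rho>_mult_integrable[of _ T]) auto
    show "integrable ?M (\<lambda>\<omega>'. transfer (\<kappa> \<omega>) \<omega>' * v \<omega>')"
    proof (rule integrable_torus_bounded[of _ "exp (2 * D * real CARD('n)) * T"])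
      show "(\<lambda>\<omega>'. transfer (\<kappa> \<omega>) \<omega>' * v \<omega>') \<in> borel_measurable borel"
        using loglip_measurable[OF ll] by measurable
      show "\<bar>transfer (\<kappa> \<omega>) \<omega>' * v \<omega>'\<bar> \<le> exp (2 * D * real CARD('n)) * T" for \<omega>'
        unfolding abs_mult using loglip_integral_bounds(1)[OF ll, of \<omega>'] loglip_pos[OF ll, of \<omega>'] D_pos v[of \<omega>'] q1
        by (intro mult_mono) auto
    qed
    have "AE \<omega>' in ?M. \<rho> \<omega>' \<le> exp (3 * D * real CARD('n))" by (rule acip_density_le[OF \<rho> \<sigma>_ge_2])
    then show "AE \<omega>' in ?M. minor * (\<rho> \<omega>' * v \<omega>') \<le> transfer (\<kappa> \<omega>) \<omega>' * v \<omega>'"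
    proof eventually_elim
      case (elim \<omega>')
      have "minor * \<rho> \<omega>' \<le> minor * exp (3 * D * real CARD('n))"
        using elim minor_pos by (intro mult_left_mono) auto
      also have "\<dots> = exp (- (2 * D * real CARD('n)))" by (simp add: minor_def mult_exp_exp)
      also note q[of \<omega>']
      finally have "minor * \<rho> \<omega>' * v \<omega>' \<le> transfer (\<kappa> \<omega>) \<omega>' * v \<omega>'" using v by (intro mult_right_mono)
      then show ?case by (simp add: mult.assoc)
    qed
  qed
  also have "\<dots> = (\<integral>\<omega>'. transfer (\<lambda>p. \<kappa> \<omega> p * v (g p)) \<omega>' \<partial>?M)" by (simp add: transfer_mult_comp)
  also have "\<dots> = (\<integral>\<omega>'. \<kappa> \<omega> \<omega>' * v (g \<omega>') \<partial>?M)" using k0 v by (intro integral_transfer) auto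
  also have "\<dots> = smoothed_step h p" by (simp add: smoothed_step_def p v_def)
  finally show ?thesis .
qed

lemma smoothed_step_pow:
  assumes m: "h \<in> borel_measurable (borel \<Otimes>\<^sub>M borel)" and b: "\<And>p. i \<le> h p" "\<And>p. h p \<le> s"
  shows "(smoothed_step ^^ n) h \<in> borel_measurable (borel \<Otimes>\<^sub>M borel)"
    "i \<le> (smoothed_step ^^ n) h p" "(smoothed_step ^^ n) h p \<le> s"
proof -
  have *: "(smoothed_step ^^ n) h \<in> borel_measurable (borel \<Otimes>\<^sub>M borel) \<and>
    (\<forall>p. i \<le> (smoothed_step ^^ n) h p \<and> (smoothed_step ^^ n) h p \<le> s)"
  proof (induction n)
    case (Suc n)
    then have X: "(smoothed_step ^^ n) h \<in> borel_measurable (borel \<Otimes>\<^sub>M borel)"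
      and b: "\<And>p. i \<le> (smoothed_step ^^ n) h p" "\<And>p. (smoothed_step ^^ n) h p \<le> s" by blast+
    show ?case
      using smoothed_step_measurable[OF X] smoothed_step_bounds[OF X b] by auto
  qed (use m b in auto)
  show "(smoothed_step ^^ n) h \<in> borel_measurable (borel \<Otimes>\<^sub>M borel)"
    "i \<le> (smoothed_step ^^ n) h p" "(smoothed_step ^^ n) h p \<le> s" using * by blast+
qed

lemma smoothed_step_affine:
  assumes m: "h \<in> borel_measurable (borel \<Otimes>\<^sub>M borel)" and b: "\<And>p. i \<le> h p" "\<And>p. h p \<le> s"
  shows "smoothed_step (\<lambda>p. a + c * h p) p = a + c * smoothed_step h p"
proof -
  obtain \<omega> y where p: "p = (\<omega>, y)" by (cases p)
  have "\<bar>h q\<bar> \<le> max \<bar>i\<bar> \<bar>s\<bar>" for q using b[of q] by (simp add: abs_if max_def)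
  note int = smoothed_step_integrable[OF m this, of \<omega> "f (\<omega>, y)"]
  have "smoothed_step (\<lambda>p. a + c * h p) p =
      (\<integral>\<omega>'. \<kappa> \<omega> \<omega>' * a + c * (\<kappa> \<omega> \<omega>' * h (g \<omega>', f (\<omega>, y))) \<partial>lebesgue_torus)"
    by (simp add: smoothed_step_def p algebra_simps)
  also have "\<dots> = (\<integral>\<omega>'. \<kappa> \<omega> \<omega>' * a \<partial>lebesgue_torus) + (\<integral>\<omega>'. c * (\<kappa> \<omega> \<omega>' * h (g \<omega>', f (\<omega>, y))) \<partial>lebesgue_torus)"
    using int by (intro Bochner_Integration.integral_add integrable_mult_left integrable_mult_right kernel_integrable)
  finally show ?thesis by (simp add: kernel_integral smoothed_step_def p)
qed

lemma smoothed_step_pow_affine: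
  assumes m: "h \<in> borel_measurable (borel \<Otimes>\<^sub>M borel)" and b: "\<And>p. i \<le> h p" "\<And>p. h p \<le> s"
  shows "(smoothed_step ^^ n) (\<lambda>p. a + c * h p) p = a + c * (smoothed_step ^^ n) h p"
proof (induction n arbitrary: p)
  case (Suc n)
  then have "(smoothed_step ^^ n) (\<lambda>p. a + c * h p) = (\<lambda>p. a + c * (smoothed_step ^^ n) h p)" by blast
  then show ?case using smoothed_step_affine[OF smoothed_step_pow[OF m b, of n]] by simp
qed simp

text \<open>The first step moves the fiber by the given base point, hence the argument
  \<open>f p\<close>; beyond that it only supplies a new base point whose law dominates
  \<open>minor\<close> times that of \<rho>. Each further step spends such a point in
  \<open>f\<close>, which is one application of \<open>P'\<close>, and supplies another. The last
  one is averaged out by \<open>base_avg\<close>, so \<open>n + 1\<close> steps yield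
  \<open>n\<close> applications.\<close>

lemma smoothed_step_pow_minorization:
  assumes m: "h \<in> borel_measurable (borel \<Otimes>\<^sub>M borel)" and b: "\<And>p. 0 \<le> h p" "\<And>p. h p \<le> T"
  shows "minor ^ Suc n * (P' ^^ n) (base_avg h) (f p) \<le> (smoothed_step ^^ Suc n) h p"
proof (induction n arbitrary: p)
  case 0
  show ?case using smoothed_step_minorization[OF m b] by simp
next
  case (Suc n)
  let ?X = "(smoothed_step ^^ Suc n) h"
  let ?u = "(P' ^^ n) (base_avg h)"
  note X = smoothed_step_pow[OF m b, of "Suc n"]
  note u = dual_op_pow_bounds[OF base_avg_measurable[OF m] base_avg_bounds(1,2)[OF m b], of n]
  have um [measurable]: "?u \<in> borel_measurable borel" by (rule u(1))
  have Xm [measurable]: "?X \<in> borel_measurable (borel \<Otimes>\<^sub>M borel)" by (rule X(1))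
  have "minor ^ Suc n * P' ?u (f p) = (\<integral>\<omega>. minor ^ Suc n * (\<rho> \<omega> * ?u (f (\<omega>, f p))) \<partial>lebesgue_torus)"
    by (simp add: P'_def)
  also have "\<dots> \<le> base_avg ?X (f p)" unfolding base_avg_def[of ?X]
  proof (rule integral_mono)
    show "integrable lebesgue_torus (\<lambda>\<omega>. minor ^ Suc n * (\<rho> \<omega> * ?u (f (\<omega>, f p))))"
      using u(2,3) by (intro integrable_mult_right \<rho>_mult_integrable[of _ T]) auto
    show "integrable lebesgue_torus (\<lambda>\<omega>. \<rho> \<omega> * ?X (\<omega>, f p))"
    proof (rule \<rho>_mult_integrable)
      show "(\<lambda>\<omega>. ?X (\<omega>, f p)) \<in> borel_measurable borel" using Xm by measurable
      show "\<bar>?X (\<omega>, f p)\<bar> \<le> T" for \<omega> using X(2,3)[of "(\<omega>, f p)"] by (simp only: abs_of_nonneg)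
    qed
    show "minor ^ Suc n * (\<rho> \<omega> * ?u (f (\<omega>, f p))) \<le> \<rho> \<omega> * ?X (\<omega>, f p)" for \<omega>
      using mult_left_mono[OF Suc.IH[of "(\<omega>, f p)"] \<rho>_nonneg[of \<omega>]] by (simp only: mult.left_commute)
  qed
  finally have "minor * (minor ^ Suc n * P' ?u (f p)) \<le> minor * base_avg ?X (f p)"
    using minor_pos by (intro mult_left_mono) auto
  also have "\<dots> \<le> smoothed_step ?X p" by (rule smoothed_step_minorization[OF X])
  finally show ?case by (simp add: mult.assoc)
qed

text \<open>Put \<open>c = minor ^ Suc N\<close>. Minorization for \<open>h - i\<close> bounds the
  iterate below through \<open>c * w\<close>, and minorization for \<open>s - h\<close> bounds it
  above through \<open>c * (T - w)\<close>, with the same \<open>w\<close>. As \<open>w\<close>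
  oscillates by at most \<open>T / 2\<close>, an oscillation of \<open>T - c * T + c * T / 2\<close>
  is left.\<close>

lemma smoothed_step_contraction:
  assumes erg: "geometrically_ergodic C lam \<rho> f" and C: "0 \<le> C" "0 \<le> lam" and N: "1 \<le> N" "C * lam ^ N \<le> 1/2"
    and m: "h \<in> borel_measurable (borel \<Otimes>\<^sub>M borel)" and b: "\<And>p. i \<le> h p" "\<And>p. h p \<le> s"
  shows "\<exists>i' s'. (\<forall>p. i' \<le> (smoothed_step ^^ Suc N) h p \<and> (smoothed_step ^^ Suc N) h p \<le> s') \<and>
    s' - i' \<le> (1 - minor ^ Suc N / 2) * (s - i)"
proof -
  let ?X = "(smoothed_step ^^ Suc N) h"
  let ?c = "minor ^ Suc N"
  define T where "T = s - i"
  define h1 where "h1 p = h p - i" for p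
  have m1: "h1 \<in> borel_measurable (borel \<Otimes>\<^sub>M borel)" unfolding h1_def[abs_def] using m by measurable
  have b1: "0 \<le> h1 p" "h1 p \<le> T" for p using b[of p] by (auto simp: h1_def T_def)
  have m2: "(\<lambda>p. T - h1 p) \<in> borel_measurable (borel \<Otimes>\<^sub>M borel)" using m1 by measurable
  define w where "w = (P' ^^ N) (base_avg h1)"
  have lo: "i + ?c * w (f p) \<le> ?X p" for p
  proof -
    have "?c * w (f p) \<le> (smoothed_step ^^ Suc N) h1 p"
      unfolding w_def by (rule smoothed_step_pow_minorization[OF m1 b1])
    also have "\<dots> = - i + 1 * ?X p"
      using smoothed_step_pow_affine[OF m b, of "Suc N" "- i" 1 p] by (simp add: h1_def[abs_def])
    finally show ?thesis by simp
  qed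
  have hi: "?X p \<le> s - ?c * (T - w (f p))" for p
  proof -
    have "base_avg (\<lambda>p. T - h1 p) = (\<lambda>y. T - base_avg h1 y)" using base_avg_bounds(3)[OF m1 b1] by blast
    then have "(P' ^^ N) (base_avg (\<lambda>p. T - h1 p)) (f p) = T - w (f p)"
      using dual_op_pow_bounds(4)[OF base_avg_measurable[OF m1] base_avg_bounds(1,2)[OF m1 b1]] by (simp add: w_def)
    then have "?c * (T - w (f p)) \<le> (smoothed_step ^^ Suc N) (\<lambda>p. T - h1 p) p"
      using smoothed_step_pow_minorization[OF m2, of T N p] b1 by simp
    also have "\<dots> = s + - 1 * ?X p"
      using smoothed_step_pow_affine[OF m b, of "Suc N" s "- 1" p] by (simp add: h1_def T_def)
    finally show ?thesis by simp
  qed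
  have T0: "0 \<le> T" using b1[of undefined] by simp
  have diff: "?X p \<le> ?X q + (1 - ?c / 2) * T" for p q
  proof -
    have "w (f p) - w (f q) \<le> T * (C * lam ^ N)"
      unfolding w_def by (rule dual_op_pow_osc[OF erg C N(1) base_avg_measurable[OF m1] base_avg_bounds(1,2)[OF m1 b1]])
    also have "\<dots> \<le> T * (1/2)" using N(2) T0 by (intro mult_left_mono)
    finally have "?c * (w (f p) - w (f q)) \<le> ?c * (T * (1/2))" using minor_pos by (intro mult_left_mono) auto
    then have "?c * w (f p) - ?c * w (f q) \<le> ?c * T / 2" using right_diff_distrib[of ?c "w (f p)" "w (f q)"] by linarith
    moreover have "?X p \<le> s - ?c * T + ?c * w (f p)" using hi[of p] right_diff_distrib[of ?c T "w (f p)"] by linarith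
    moreover have "(1 - ?c / 2) * T = T - ?c * T / 2" by (simp only: left_diff_distrib)
    ultimately show ?thesis using lo[of q] T_def by linarith
  qed
  \<comment> \<open>The lower end will be \<open>s'\<close> minus the bound on the oscillation, not
    an infimum, so that the interval has the wanted length by definition.\<close>
  define s' where "s' = (SUP p. ?X p)"
  have bdd: "bdd_above (range ?X)" using smoothed_step_pow(3)[OF m b] by (intro bdd_aboveI2[of _ _ s])
  have "?X p \<le> s'" for p unfolding s'_def by (intro cSUP_upper bdd) simp
  moreover have "s' \<le> ?X q + (1 - ?c / 2) * T" for q unfolding s'_def using diff by (intro cSUP_least) auto
  ultimately show ?thesis
    by (intro exI[of _ "s' - (1 - ?c / 2) * T"] exI[of _ s']) (auto simp: T_def algebra_simps)
qed

lemma smoothed_step_contraction_pow: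
  assumes erg: "geometrically_ergodic C lam \<rho> f" and C: "0 \<le> C" "0 \<le> lam" and N: "1 \<le> N" "C * lam ^ N \<le> 1/2"
    and m: "h \<in> borel_measurable (borel \<Otimes>\<^sub>M borel)" and b: "\<And>p. i \<le> h p" "\<And>p. h p \<le> s"
  shows "\<exists>i' s'. (\<forall>p. i' \<le> (smoothed_step ^^ (n * Suc N)) h p \<and> (smoothed_step ^^ (n * Suc N)) h p \<le> s') \<and>
    s' - i' \<le> (1 - minor ^ Suc N / 2) ^ n * (s - i)"
proof (induction n)
  case 0
  show ?case using b by (intro exI[of _ i] exI[of _ s]) simp
next
  case (Suc n)
  let ?X = "(smoothed_step ^^ (n * Suc N)) h"
  let ?q = "1 - minor ^ Suc N / 2"
  have q: "0 \<le> ?q" using power_le_one[of minor "Suc N"] minor_pos minor_le_1 by simp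
  obtain i' s' where IH: "\<And>p. i' \<le> ?X p" "\<And>p. ?X p \<le> s'" "s' - i' \<le> ?q ^ n * (s - i)" using Suc by blast
  have Xm: "?X \<in> borel_measurable (borel \<Otimes>\<^sub>M borel)" by (rule smoothed_step_pow(1)[OF m b])
  have eq: "(smoothed_step ^^ (Suc n * Suc N)) h = (smoothed_step ^^ Suc N) ?X"
    by (metis comp_apply funpow_add mult_Suc)
  obtain i'' s'' where I: "\<forall>p. i'' \<le> (smoothed_step ^^ Suc N) ?X p \<and> (smoothed_step ^^ Suc N) ?X p \<le> s''"
    "s'' - i'' \<le> ?q * (s' - i')"
    using smoothed_step_contraction[OF erg C N Xm IH(1,2)] by blast
  have "?q * (s' - i') \<le> ?q * (?q ^ n * (s - i))" using IH(3) q by (rule mult_left_mono)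
  then show ?case using I unfolding eq by (intro exI[of _ i''] exI[of _ s'']) (simp add: mult.assoc)
qed

text \<open>Applications of \<open>F\<close> are replaced by smeared steps one at a time, starting
  from the last. Each replacement is thereby tested against a true image under an iterate of
  \<open>F\<close>, whose disintegration is regular, and not against a law of the chain. After
  \<open>j\<close> steps the observable has fiber constant \<open>L ^ j\<close>, at most
  \<open>max 1 L ^ M\<close>.\<close>

lemma smoothed_step_pow_error:
  assumes m: "\<Theta> \<in> borel_measurable (borel \<Otimes>\<^sub>M borel)" and b: "\<And>p. 1 \<le> \<Theta> p" "\<And>p. \<Theta> p \<le> 3"
    and ll: "\<And>\<omega>. loglip 1 (\<lambda>y. \<Theta> (\<omega>, y))" and j: "j \<le> M"
  shows "\<bar>(\<integral>\<omega>. \<Theta> ((F ^^ (k + j)) (\<omega>, x)) \<partial>lebesgue_torus) - (\<integral>\<omega>. (smoothed_step ^^ j) \<Theta> ((F ^^ k) (\<omega>, x)) \<partial>lebesgue_torus)\<bar>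
    \<le> real j * (3 * exp (2 * D * real CARD('n)) * (exp ((2 * D + 2 * L * max 1 L ^ M) * r) - 1 + \<tau>))"
  using j
proof (induction j arbitrary: k)
  case (Suc j)
  let ?X = "(smoothed_step ^^ j) \<Theta>"
  let ?d = "3 * exp (2 * D * real CARD('n)) * (exp ((2 * D + 2 * L * max 1 L ^ M) * r) - 1 + \<tau>)"
  let ?I = "\<lambda>h n. \<integral>\<omega>. h ((F ^^ n) (\<omega>, x)) \<partial>lebesgue_torus"
  note X = smoothed_step_pow[OF m b, of j]
  have l1: "loglip (L ^ j) (\<lambda>y. ?X (\<omega>, y))" for \<omega>
  proof (induction j arbitrary: \<omega>)
    case (Suc j)
    note X = smoothed_step_pow[OF m b, of j]
    have "loglip (L * L ^ j) (\<lambda>y. smoothed_step ((smoothed_step ^^ j) \<Theta>) (\<omega>, y))"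
      by (rule smoothed_step_loglip[OF X]) (use Suc L_nonneg in auto)
    then show ?case by simp
  qed (use ll in simp)
  have "L ^ j \<le> max 1 L ^ j" using L_nonneg by (intro power_mono) auto
  also have "\<dots> \<le> max 1 L ^ M" using Suc.prems by (intro power_increasing) auto
  finally have l2: "loglip (max 1 L ^ M) (\<lambda>y. ?X (\<omega>, y))" for \<omega> using l1 loglip_mono by blast
  have Xp: "0 < ?X p" for p using X(2)[of p] by simp
  have "\<bar>?I \<Theta> (Suc k + j) - ?I ?X (Suc k)\<bar> \<le> real j * ?d" using Suc.IH[of "Suc k"] Suc.prems by simp
  moreover have "\<bar>?I ?X (Suc k) - ?I (smoothed_step ?X) k\<bar> \<le> ?d"
    by (rule smoothed_step_error[OF X(1) Xp X(3) l2]) simp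
  ultimately have "\<bar>?I \<Theta> (Suc k + j) - ?I (smoothed_step ?X) k\<bar> \<le> real j * ?d + ?d" by linarith
  also have "\<dots> = real (Suc j) * ?d" by (simp add: algebra_simps)
  finally show ?case by simp
qed simp

text \<open>After \<open>M\<close> smeared steps the observable takes values in an interval of
  length at most \<open>2 * (1 - minor ^ Suc N / 2) ^ b\<close>, where 2 is its initial range
  \<open>3 - 1\<close>. Every law integrates it into that interval: the law at time
  \<open>n - M\<close> started from \<open>x\<close> as well as the law at time 0 started from
  \<open>x0\<close>. The smearing error is paid on both sides.\<close>

lemma fiber_mixing:
  assumes erg: "geometrically_ergodic C lam \<rho> f" and C: "0 \<le> C" "0 \<le> lam" and N: "1 \<le> N" "C * lam ^ N \<le> 1/2"
    and \<phi>: "loglip 1 \<phi>" "\<And>y. 1 \<le> \<phi> y" "\<And>y. \<phi> y \<le> 3" and M: "M = b * Suc N" and n: "M \<le> n"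
  shows "\<bar>(\<integral>\<omega>. \<phi> (snd ((F ^^ n) (\<omega>, x))) \<partial>lebesgue_torus) - (\<integral>\<omega>. \<phi> (snd ((F ^^ M) (\<omega>, x0))) \<partial>lebesgue_torus)\<bar>
    \<le> 2 * (1 - minor ^ Suc N / 2) ^ b
      + 2 * (real M * (3 * exp (2 * D * real CARD('n)) * (exp ((2 * D + 2 * L * max 1 L ^ M) * r) - 1 + \<tau>)))"
proof -
  define \<Theta> where "\<Theta> = (\<lambda>p :: 'n torus \<times> 'm torus. \<phi> (snd p))"
  let ?d = "real M * (3 * exp (2 * D * real CARD('n)) * (exp ((2 * D + 2 * L * max 1 L ^ M) * r) - 1 + \<tau>))"
  have [measurable]: "\<phi> \<in> borel_measurable borel" using \<phi>(1) by (rule loglip_measurable)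
  have m: "\<Theta> \<in> borel_measurable (borel \<Otimes>\<^sub>M borel)" unfolding \<Theta>_def by measurable
  have bd: "1 \<le> \<Theta> p" "\<Theta> p \<le> 3" for p using \<phi> by (auto simp: \<Theta>_def)
  obtain i s where ab: "\<And>p. i \<le> (smoothed_step ^^ M) \<Theta> p" "\<And>p. (smoothed_step ^^ M) \<Theta> p \<le> s"
    "s - i \<le> (1 - minor ^ Suc N / 2) ^ b * (3 - 1)"
    using smoothed_step_contraction_pow[OF erg C N m bd, of b] M by blast
  have X [measurable]: "(smoothed_step ^^ M) \<Theta> \<in> borel_measurable (borel \<Otimes>\<^sub>M borel)" by (rule smoothed_step_pow(1)[OF m bd])
  have Fk: "(\<lambda>\<omega>. (smoothed_step ^^ M) \<Theta> ((F ^^ k) (\<omega>, x))) \<in> borel_measurable borel" for k x by measurable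
  have btw: "i \<le> (\<integral>\<omega>. (smoothed_step ^^ M) \<Theta> ((F ^^ k) (\<omega>, x)) \<partial>lebesgue_torus) \<and>
      (\<integral>\<omega>. (smoothed_step ^^ M) \<Theta> ((F ^^ k) (\<omega>, x)) \<partial>lebesgue_torus) \<le> s" for k x
  proof -
    have int: "integrable lebesgue_torus (\<lambda>\<omega>. (smoothed_step ^^ M) \<Theta> ((F ^^ k) (\<omega>, x)))"
    proof (rule integrable_torus_bounded[OF Fk])
      show "\<bar>(smoothed_step ^^ M) \<Theta> ((F ^^ k) (\<omega>, x))\<bar> \<le> 3" for \<omega>
        using smoothed_step_pow(2,3)[OF m bd, of M "(F ^^ k) (\<omega>, x)"] by simp
    qed
    show ?thesis
      using integral_mono[OF _ int, of "\<lambda>_. i"] integral_mono[OF int, of "\<lambda>_. s"] ab(1,2)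
      by (simp add: leb_torus.prob_space[simplified])
  qed
  have err: "\<bar>(\<integral>\<omega>. \<phi> (snd ((F ^^ (k + M)) (\<omega>, x))) \<partial>lebesgue_torus) -
      (\<integral>\<omega>. (smoothed_step ^^ M) \<Theta> ((F ^^ k) (\<omega>, x)) \<partial>lebesgue_torus)\<bar> \<le> ?d" for k x
    using smoothed_step_pow_error[OF m bd, of M M k x] \<phi>(1) by (simp add: \<Theta>_def)
  have nM: "n - M + M = n" using n by simp
  have "s - i \<le> 2 * (1 - minor ^ Suc N / 2) ^ b" using ab(3) by simp
  then show ?thesis
    using err[of "n - M" x, unfolded nM] err[of 0 x0, unfolded add_0] btw[of "n - M" x] btw[of 0 x0] by linarith
qed

end

section \<open>The theorem\<close>

text \<open>If \<open>\<phi>\<close> is not Lipschitz and bounded, the value is arbitrary but still positive.\<close>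

definition lipschitz_bound :: "('a::metric_space \<Rightarrow> real) \<Rightarrow> real" where
  "lipschitz_bound \<phi> = 1 + \<bar>SOME B. B-lipschitz_on UNIV \<phi> \<and> (\<forall>x. \<bar>\<phi> x\<bar> \<le> B)\<bar>"

lemma lipschitz_bound_pos: "0 < lipschitz_bound \<phi>"
  by (simp add: lipschitz_bound_def add_pos_nonneg)

lemma lipschitz_bound:
  fixes \<phi> :: "('m::finite) torus \<Rightarrow> real"
  assumes "lipschitz_map \<phi>"
  shows "\<bar>\<phi> x\<bar> \<le> lipschitz_bound \<phi>" "\<bar>\<phi> x - \<phi> y\<bar> \<le> lipschitz_bound \<phi> * dist x y"
proof -
  obtain B where B: "B-lipschitz_on UNIV \<phi>" using assms by (auto simp: lipschitz_map_def)
  have "bounded (\<phi> ` UNIV)"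
    using compact_imp_bounded[OF compact_continuous_image[OF lipschitz_on_continuous_on[OF B] compact_torus_UNIV]] .
  then obtain K where K: "\<And>x. \<bar>\<phi> x\<bar> \<le> K" unfolding bounded_iff by auto
  have "(max B K)-lipschitz_on UNIV \<phi>" using B by (rule lipschitz_on_mono) auto
  moreover have "\<forall>x. \<bar>\<phi> x\<bar> \<le> max B K" using K by (auto simp: le_max_iff_disj)
  ultimately have "\<exists>B. B-lipschitz_on UNIV \<phi> \<and> (\<forall>x. \<bar>\<phi> x\<bar> \<le> B)" by blast
  from someI_ex[OF this] obtain A where A: "A = (SOME B. B-lipschitz_on UNIV \<phi> \<and> (\<forall>x. \<bar>\<phi> x\<bar> \<le> B))"
    "A-lipschitz_on UNIV \<phi>" "\<And>x. \<bar>\<phi> x\<bar> \<le> A" by blast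
  have le: "A \<le> lipschitz_bound \<phi>" by (simp add: lipschitz_bound_def A(1)[symmetric])
  show "\<bar>\<phi> x\<bar> \<le> lipschitz_bound \<phi>" using A(3)[of x] le by linarith
  have "\<bar>\<phi> x - \<phi> y\<bar> \<le> A * dist x y" using lipschitz_onD[OF A(2), of x y] by (simp add: dist_real_def)
  also have "\<dots> \<le> lipschitz_bound \<phi> * dist x y" using le by (intro mult_right_mono) auto
  finally show "\<bar>\<phi> x - \<phi> y\<bar> \<le> lipschitz_bound \<phi> * dist x y" .
qed

lemma lipschitz_const_lipschitz_on:
  assumes "lipschitz_map f" "0 \<le> lipschitz_const f"
  shows "(lipschitz_const f)-lipschitz_on UNIV f"
proof (rule lipschitz_onI)
  fix p q
  obtain B where B: "B-lipschitz_on UNIV f" using assms by (auto simp: lipschitz_map_def)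
  have bdd: "bdd_above ((\<lambda>(p, q). dist (f p) (f q) / dist p q) ` {(p, q). p \<noteq> q})"
  proof (rule bdd_aboveI2[of _ _ B])
    fix z :: "'a \<times> 'a" assume "z \<in> {(p, q). p \<noteq> q}"
    then show "(case z of (p, q) \<Rightarrow> dist (f p) (f q) / dist p q) \<le> B"
      using lipschitz_onD[OF B, of "fst z" "snd z"] by (auto simp: field_simps split: prod.splits)
  qed
  show "dist (f p) (f q) \<le> lipschitz_const f * dist p q"
  proof (cases "p = q")
    case False
    then have "dist (f p) (f q) / dist p q \<le> lipschitz_const f"
      using cSUP_upper[OF _ bdd, of "(p, q)"] unfolding lipschitz_const_def by simp
    then show ?thesis using False by (simp add: field_simps)
  qed simp
qed (rule assms(2))

text \<open>Rescaling to \<open>2 + \<phi> / H\<close> puts the observable into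
  \<open>[1, 3]\<close>, where a 1-Lipschitz function is log-Lipschitz with constant 1. Before time
  \<open>M\<close> only the trivial bound \<open>2 * H\<close> is available, and the exponential
  term is there to cover it.\<close>

lemma (in skew_mixing) lipschitz_mixing:
  assumes erg: "geometrically_ergodic C lam \<rho> f" and C: "0 \<le> C" "0 \<le> lam" and N: "1 \<le> N" "C * lam ^ N \<le> 1/2"
    and M: "M = b * Suc N"
    and \<epsilon>: "2 * (1 - minor ^ Suc N / 2) ^ b
      + 2 * (real M * (3 * exp (2 * D * real CARD('n)) * (exp ((2 * D + 2 * L * max 1 L ^ M) * r) - 1 + \<tau>))) \<le> \<epsilon>" "0 \<le> \<epsilon>"
    and \<phi>: "lipschitz_map \<phi>"
  shows "\<bar>(\<integral>\<omega>. \<phi> (snd ((F ^^ n) (\<omega>, x))) \<partial>lebesgue_torus) - (\<integral>\<omega>. \<phi> (snd ((F ^^ M) (\<omega>, x0))) \<partial>lebesgue_torus)\<bar>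
    \<le> lipschitz_bound \<phi> * (2 ^ Suc M * (1/2) ^ n + \<epsilon>)"
proof -
  define H where "H = lipschitz_bound \<phi>"
  have H: "0 < H" unfolding H_def by (rule lipschitz_bound_pos)
  note \<phi>H = lipschitz_bound[OF \<phi>, folded H_def]
  have [measurable]: "\<phi> \<in> borel_measurable borel"
    using \<phi> by (auto simp: lipschitz_map_def intro: borel_measurable_continuous_onI lipschitz_on_continuous_on)
  have [measurable]: "(\<lambda>\<omega>. \<phi> (snd ((F ^^ n) (\<omega>, x)))) \<in> borel_measurable borel" for n x by measurable
  have int: "integrable lebesgue_torus (\<lambda>\<omega>. \<phi> (snd ((F ^^ n) (\<omega>, x))))" for n x
    using \<phi>H(1) by (intro integrable_torus_bounded[of _ H]) auto
  show ?thesis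
  proof (cases "M \<le> n")
    case True
    define \<phi>' where "\<phi>' y = 2 + \<phi> y / H" for y
    have b: "1 \<le> \<phi>' y" "\<phi>' y \<le> 3" for y
    proof -
      have "\<bar>\<phi> y / H\<bar> \<le> 1" using \<phi>H(1)[of y] H by (simp add: abs_divide)
      then show "1 \<le> \<phi>' y" "\<phi>' y \<le> 3" unfolding \<phi>'_def by linarith+
    qed
    have "loglip 1 \<phi>'"
      unfolding loglip_def
    proof (intro conjI allI)
      fix p q
      show "0 < \<phi>' p" using b(1)[of p] by linarith
      have "(\<phi> p - \<phi> q) / H \<le> dist p q" using \<phi>H(2)[of p q] H by (simp add: field_simps)
      then have "\<phi>' p \<le> \<phi>' q + dist p q" by (simp add: \<phi>'_def diff_divide_distrib)
      also have "\<dots> \<le> \<phi>' q + dist p q * \<phi>' q" using mult_left_mono[OF b(1)[of q], of "dist p q"] by simp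
      also have "\<dots> = (1 + dist p q) * \<phi>' q" by (simp add: algebra_simps)
      also have "\<dots> \<le> exp (1 * dist p q) * \<phi>' q"
        using b(1)[of q] by (intro mult_right_mono) auto
      finally show "\<phi>' p \<le> exp (1 * dist p q) * \<phi>' q" .
    qed
    note mix = fiber_mixing[OF erg C N this b M True, of x x0]
    have eq: "(\<integral>\<omega>. \<phi>' (snd ((F ^^ n) (\<omega>, x))) \<partial>lebesgue_torus) = 2 + (\<integral>\<omega>. \<phi> (snd ((F ^^ n) (\<omega>, x))) \<partial>lebesgue_torus) / H" for n x
      unfolding \<phi>'_def using int by (subst Bochner_Integration.integral_add) (auto simp: leb_torus.prob_space[simplified])
    have "\<bar>(\<integral>\<omega>. \<phi> (snd ((F ^^ n) (\<omega>, x))) \<partial>lebesgue_torus) / H - (\<integral>\<omega>. \<phi> (snd ((F ^^ M) (\<omega>, x0))) \<partial>lebesgue_torus) / H\<bar> \<le> \<epsilon>"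
      using mix \<epsilon>(1) unfolding eq by linarith
    then have "\<bar>(\<integral>\<omega>. \<phi> (snd ((F ^^ n) (\<omega>, x))) \<partial>lebesgue_torus) - (\<integral>\<omega>. \<phi> (snd ((F ^^ M) (\<omega>, x0))) \<partial>lebesgue_torus)\<bar> \<le> H * \<epsilon>"
      using H by (simp add: diff_divide_distrib[symmetric] abs_divide field_simps)
    also have "\<dots> \<le> H * (2 ^ Suc M * (1/2) ^ n + \<epsilon>)" using H by (intro mult_left_mono) auto
    finally show ?thesis by (simp add: H_def)
  next
    case False
    have bd: "\<bar>\<integral>\<omega>. \<phi> (snd ((F ^^ n) (\<omega>, x))) \<partial>lebesgue_torus\<bar> \<le> H" for n x
    proof -
      have "\<bar>\<integral>\<omega>. \<phi> (snd ((F ^^ n) (\<omega>, x))) \<partial>lebesgue_torus\<bar> \<le> (\<integral>\<omega>. \<bar>\<phi> (snd ((F ^^ n) (\<omega>, x)))\<bar> \<partial>lebesgue_torus)"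
        by (rule integral_abs_bound)
      also have "\<dots> \<le> (\<integral>\<omega>. H \<partial>(lebesgue_torus :: 'n torus measure))"
        using int \<phi>H(1) by (intro integral_mono) auto
      finally show ?thesis by (simp add: leb_torus.prob_space[simplified])
    qed
    \<comment> \<open>The prefactor \<open>2 ^ Suc M\<close> makes the exponential term at least 2
      for every \<open>n < M\<close>.\<close>
    have "1 \<le> (2::real) ^ M * (1/2) ^ n"
    proof -
      have "(2::real) ^ n \<le> 2 ^ M" using False by (intro power_increasing) auto
      then show ?thesis by (simp add: power_one_over field_simps)
    qed
    then have "2 \<le> 2 ^ Suc M * (1/2) ^ n + \<epsilon>" using \<epsilon>(2) by simp
    then have "H * 2 \<le> H * (2 ^ Suc M * (1/2) ^ n + \<epsilon>)" using H by (intro mult_left_mono) auto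
    then show ?thesis using bd[of n x] bd[of M x0] unfolding H_def by linarith
  qed
qed

text \<open>The estimate on \<open>h\<close> is uniform in the fiber point \<open>x\<close>, so
  \<psi> enters merely as an integrable weight. This is the benefit of starting from point masses in
  the fiber.\<close>

lemma integral_pair_weight:
  fixes h :: "('n::finite) torus \<times> ('m::finite) torus \<Rightarrow> real"
  assumes h [measurable]: "h \<in> borel_measurable (borel \<Otimes>\<^sub>M borel)" and b: "\<And>p. \<bar>h p\<bar> \<le> B"
    and \<psi>: "integrable lebesgue_torus \<psi>"
    and c: "\<And>x. \<bar>(\<integral>\<omega>. h (\<omega>, x) \<partial>lebesgue_torus) - c\<bar> \<le> e"
  shows "\<bar>(\<integral>p. h p * \<psi> (snd p) \<partial>(lebesgue_torus \<Otimes>\<^sub>M lebesgue_torus)) - c * (\<integral>x. \<psi> x \<partial>lebesgue_torus)\<bar>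
    \<le> e * (\<integral>x. \<bar>\<psi> x\<bar> \<partial>lebesgue_torus)"
proof -
  let ?M = "lebesgue_torus :: 'n torus measure" and ?N = "lebesgue_torus :: 'm torus measure"
  interpret P: pair_sigma_finite ?M ?N ..
  have \<psi>m [measurable]: "\<psi> \<in> borel_measurable borel"
    using borel_measurable_integrable[OF \<psi>] by (simp cong: measurable_cong_sets)
  have hx: "integrable ?M (\<lambda>\<omega>. h (\<omega>, x))" for x using b by (intro integrable_torus_bounded[of _ B]) auto
  have i1: "integrable (?M \<Otimes>\<^sub>M ?N) (\<lambda>p. \<psi> (snd p))"
    by (rule P.Fubini_integrable) (use \<psi> in auto)
  have i2: "integrable (?M \<Otimes>\<^sub>M ?N) (\<lambda>p. h p * \<psi> (snd p))"
  proof (rule Bochner_Integration.integrable_bound[OF integrable_mult_right[OF i1, of B]])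
    show "AE p in ?M \<Otimes>\<^sub>M ?N. norm (h p * \<psi> (snd p)) \<le> norm (B * \<psi> (snd p))"
    proof (rule AE_I2)
      fix p
      have "\<bar>h p\<bar> \<le> \<bar>B\<bar>" using b[of p] by simp
      then show "norm (h p * \<psi> (snd p)) \<le> norm (B * \<psi> (snd p))" by (simp add: abs_mult mult_right_mono)
    qed
  qed simp
  define a where "a x = (\<integral>\<omega>. h (\<omega>, x) \<partial>?M)" for x
  have i3: "integrable ?N (\<lambda>x. a x * \<psi> x)"
    using P.integrable_snd[of "\<lambda>\<omega> x. h (\<omega>, x) * \<psi> x"] i2 by (simp add: case_prod_beta' a_def)
  have "(\<integral>p. h p * \<psi> (snd p) \<partial>(?M \<Otimes>\<^sub>M ?N)) = (\<integral>x. a x * \<psi> x \<partial>?N)"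
    using P.integral_snd[of "\<lambda>\<omega> x. h (\<omega>, x) * \<psi> x"] i2 by (simp add: case_prod_beta' a_def)
  then have "(\<integral>p. h p * \<psi> (snd p) \<partial>(?M \<Otimes>\<^sub>M ?N)) - c * (\<integral>x. \<psi> x \<partial>?N) = (\<integral>x. (a x - c) * \<psi> x \<partial>?N)"
    using i3 \<psi> by (simp add: left_diff_distrib)
  also have "\<bar>\<dots>\<bar> \<le> (\<integral>x. \<bar>(a x - c) * \<psi> x\<bar> \<partial>?N)" by (rule integral_abs_bound)
  also have "\<dots> \<le> (\<integral>x. e * \<bar>\<psi> x\<bar> \<partial>?N)"
  proof (rule integral_mono)
    show "integrable ?N (\<lambda>x. \<bar>(a x - c) * \<psi> x\<bar>)" using i3 \<psi> by (simp add: left_diff_distrib)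
    show "integrable ?N (\<lambda>x. e * \<bar>\<psi> x\<bar>)" using \<psi> by simp
    show "\<bar>(a x - c) * \<psi> x\<bar> \<le> e * \<bar>\<psi> x\<bar>" for x
      using c[of x] by (simp add: a_def abs_mult mult_right_mono)
  qed
  finally show ?thesis by simp
qed

theorem theorem2p1:
  fixes D L C lam :: real
  assumes "D > 0" and "L > 0" and "C > 0" and "0 < lam" and "lam < 1"
  shows "\<exists>K :: (('m2::finite) torus \<Rightarrow> real) \<Rightarrow> ('m2 torus \<Rightarrow> real) \<Rightarrow> real.
    (\<forall>\<phi> \<psi>. K \<phi> \<psi> > 0) \<and>
    (\<forall>\<epsilon>>0. \<exists>\<sigma>\<^sub>0. \<sigma>\<^sub>0 > max 1 L \<and>
      (\<forall>\<sigma> (g :: ('m1::finite) torus \<Rightarrow> 'm1 torus) (\<rho> :: 'm1 torus \<Rightarrow> real)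
          (f :: 'm1 torus \<times> 'm2 torus \<Rightarrow> 'm2 torus).
        expanding_base \<sigma> D g \<longrightarrow> acip_density g \<rho> \<longrightarrow>
        lipschitz_map f \<longrightarrow> lipschitz_const f = L \<longrightarrow>
        geometrically_ergodic C lam \<rho> f \<longrightarrow> \<sigma> > \<sigma>\<^sub>0 \<longrightarrow>
        (\<exists>lam' C' \<eta>. 0 < lam' \<and> lam' < 1 \<and> C' > 0 \<and> \<eta> \<in> borel_probs \<and>
          (\<forall>n \<phi> \<psi>. integrable lebesgue_torus \<psi> \<longrightarrow> lipschitz_map \<phi> \<longrightarrow>
            \<bar>(\<integral>p. \<phi> (snd ((skew_product g f ^^ n) p)) * \<psi> (snd p)
                 \<partial>(lebesgue_torus \<Otimes>\<^sub>M lebesgue_torus))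
              - (\<integral>x. \<phi> x \<partial>\<eta>) * (\<integral>x. \<psi> x \<partial>lebesgue_torus)\<bar>
            \<le> K \<phi> \<psi> * (C' * lam' ^ n + \<epsilon>)))))"
proof (intro exI[of _ "\<lambda>\<phi> \<psi>. lipschitz_bound \<phi> * (1 + (\<integral>x. \<bar>\<psi> x\<bar> \<partial>lebesgue_torus))"] conjI allI impI)
  fix \<phi> \<psi> :: "'m2 torus \<Rightarrow> real"
  \<comment> \<open>The constant is chosen before \<epsilon>, and the summand 1 keeps it positive
    for \<open>\<psi> = 0\<close>.\<close>
  have "0 \<le> (\<integral>x. \<bar>\<psi> x\<bar> \<partial>lebesgue_torus)" by (rule Bochner_Integration.integral_nonneg) simp
  then show "0 < lipschitz_bound \<phi> * (1 + (\<integral>x. \<bar>\<psi> x\<bar> \<partial>lebesgue_torus))"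
    using lipschitz_bound_pos[of \<phi>] by (intro mult_pos_pos) linarith+
next
  fix \<epsilon> :: real assume \<epsilon>: "0 < \<epsilon>"
  let ?m = "real CARD('m1)"
  \<comment> \<open>The value of \<open>minor\<close>, available before \<open>g\<close> and
    \<open>f\<close> are given.\<close>
  define c where "c = exp (- (5 * D * ?m))"
  have c: "0 < c" "c \<le> 1" using assms(1) by (auto simp: c_def)
  obtain N where N: "1 \<le> N" "C * lam ^ N \<le> 1/2"
  proof -
    obtain n where n: "lam ^ n < 1 / (2 * C)"
      using real_arch_pow_inv[of "1 / (2 * C)" lam] assms by auto
    have "lam ^ Suc n \<le> lam ^ n" using assms by (intro power_decreasing) auto
    then have "C * lam ^ Suc n \<le> C * (1 / (2 * C))" using n assms(3) by (intro mult_left_mono) linarith+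
    then show ?thesis using assms by (intro that[of "Suc n"]) auto
  qed
  define q where "q = 1 - c ^ Suc N / 2"
  have q: "0 \<le> q" "q < 1" using c power_le_one[of c "Suc N"] zero_less_power[of c "Suc N"] by (auto simp: q_def)
  \<comment> \<open>Contraction receives half of the tolerance:
    \<open>2 * q ^ b < \<epsilon> / 2\<close>.\<close>
  obtain b where b: "q ^ b < \<epsilon> / 4" using real_arch_pow_inv[of "\<epsilon> / 4" q] q \<epsilon> by auto
  define M where "M = b * Suc N"
  define G where "G = 2 * D + 2 * L * max 1 L ^ M"
  have G: "0 < G" unfolding G_def using assms(1,2) by (intro add_pos_nonneg) auto
  \<comment> \<open>Near and far pairs will contribute \<open>e\<close> each, so the smearing error
    is \<open>12 * M * exp (2 * D * ?m) * e\<close>. The constant 24 makes this at most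
    \<open>\<epsilon> / 2\<close>, and \<open>Suc M\<close> covers the case
    \<open>M = 0\<close>.\<close>
  define e where "e = \<epsilon> / (24 * real (Suc M) * exp (2 * D * ?m))"
  have e: "0 < e" using \<epsilon> by (simp add: e_def)
  define r where "r = ln (1 + e) / G"
  have r: "0 < r" "exp (G * r) = 1 + e" using e G by (auto simp: r_def)
  \<comment> \<open>The kernel depends only on \<open>r\<close>, \<open>e\<close> and the dimension,
    so its constant \<Lambda> may enter the threshold for \<sigma>.\<close>
  obtain \<kappa> :: "'m1 torus \<Rightarrow> 'm1 torus \<Rightarrow> real" and \<Lambda> where \<kappa>: "smoothing_kernel \<kappa> r e \<Lambda>"
    using smoothing_kernel_exists[OF r(1) e] by blast
  have small: "2 * q ^ b + 2 * (real M * (3 * exp (2 * D * ?m) * (exp (G * r) - 1 + e))) \<le> \<epsilon>"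
  proof -
    have "2 * (real M * (3 * exp (2 * D * ?m) * (exp (G * r) - 1 + e))) = 12 * real M * exp (2 * D * ?m) * e"
      by (simp add: r(2))
    also have "\<dots> \<le> 12 * real (Suc M) * exp (2 * D * ?m) * e"
      using e by (intro mult_right_mono) auto
    also have "\<dots> = \<epsilon> / 2" unfolding e_def by (simp add: divide_simps)
    finally show ?thesis using b by simp
  qed
  \<comment> \<open>The three summands secure \<open>2 \<le> \<sigma>\<close>,
    \<open>2 * L \<le> \<sigma>\<close> and \<open>\<Lambda> \<le> D * \<sigma>\<close>.\<close>
  define \<sigma>0 where "\<sigma>0 = 2 + 2 * L + \<bar>\<Lambda> / D\<bar>"
  show "\<exists>\<sigma>\<^sub>0. \<sigma>\<^sub>0 > max 1 L \<and>
      (\<forall>\<sigma> (g :: 'm1 torus \<Rightarrow> 'm1 torus) (\<rho> :: 'm1 torus \<Rightarrow> real)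
          (f :: 'm1 torus \<times> 'm2 torus \<Rightarrow> 'm2 torus).
        expanding_base \<sigma> D g \<longrightarrow> acip_density g \<rho> \<longrightarrow>
        lipschitz_map f \<longrightarrow> lipschitz_const f = L \<longrightarrow>
        geometrically_ergodic C lam \<rho> f \<longrightarrow> \<sigma> > \<sigma>\<^sub>0 \<longrightarrow>
        (\<exists>lam' C' \<eta>. 0 < lam' \<and> lam' < 1 \<and> C' > 0 \<and> \<eta> \<in> borel_probs \<and>
          (\<forall>n \<phi> \<psi>. integrable lebesgue_torus \<psi> \<longrightarrow> lipschitz_map \<phi> \<longrightarrow>
            \<bar>(\<integral>p. \<phi> (snd ((skew_product g f ^^ n) p)) * \<psi> (snd p)
                 \<partial>(lebesgue_torus \<Otimes>\<^sub>M lebesgue_torus))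
              - (\<integral>x. \<phi> x \<partial>\<eta>) * (\<integral>x. \<psi> x \<partial>lebesgue_torus)\<bar>
            \<le> lipschitz_bound \<phi> * (1 + (\<integral>x. \<bar>\<psi> x\<bar> \<partial>lebesgue_torus)) * (C' * lam' ^ n + \<epsilon>))))"
  proof (rule exI[of _ \<sigma>0], intro conjI allI impI)
    show "max 1 L < \<sigma>0" using assms(2) abs_ge_zero[of "\<Lambda> / D"] unfolding \<sigma>0_def by linarith
    fix \<sigma> :: real and g :: "'m1 torus \<Rightarrow> 'm1 torus" and \<rho> :: "'m1 torus \<Rightarrow> real"
      and f :: "'m1 torus \<times> 'm2 torus \<Rightarrow> 'm2 torus"
    assume base: "expanding_base \<sigma> D g" and \<rho>: "acip_density g \<rho>" and f: "lipschitz_map f" "lipschitz_const f = L"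
      and erg: "geometrically_ergodic C lam \<rho> f" and \<sigma>: "\<sigma>0 < \<sigma>"
    have fL: "L-lipschitz_on UNIV f" using lipschitz_const_lipschitz_on[OF f(1)] f(2) assms(2) by simp
    have s: "2 \<le> \<sigma>" "2 * L \<le> \<sigma>" using \<sigma> assms(2) abs_ge_zero[of "\<Lambda> / D"] unfolding \<sigma>0_def by linarith+
    have "\<Lambda> / D \<le> \<sigma>" using \<sigma> assms(2) abs_ge_self[of "\<Lambda> / D"] unfolding \<sigma>0_def by linarith
    then have \<Lambda>: "\<Lambda> \<le> D * \<sigma>" using assms(1) by (simp add: field_simps)
    interpret smoothing_kernel \<kappa> r e \<Lambda> by (rule \<kappa>)
    interpret skew_mixing \<sigma> D g f L \<kappa> r e \<Lambda> \<rho>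
      by unfold_locales (use base assms(1) fL s \<rho> \<Lambda> in auto)
    \<comment> \<open>Any reference point serves, since \<open>fiber_mixing\<close> compares
      arbitrary starting points in the fiber.\<close>
    define x0 :: "'m2 torus" where "x0 = undefined"
    let ?T = "\<lambda>\<omega>. snd ((F ^^ M) (\<omega>, x0))"
    define \<eta> where "\<eta> = distr (lebesgue_torus :: 'm1 torus measure) borel ?T"
    have Tm [measurable]: "?T \<in> lebesgue_torus \<rightarrow>\<^sub>M borel" by measurable
    have "\<eta> \<in> borel_probs" unfolding \<eta>_def borel_probs_def
      using leb_torus.prob_space_distr[OF Tm] by simp
    moreover have "\<bar>(\<integral>p. \<phi> (snd ((F ^^ n) p)) * \<psi> (snd p) \<partial>(lebesgue_torus \<Otimes>\<^sub>M lebesgue_torus))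
              - (\<integral>x. \<phi> x \<partial>\<eta>) * (\<integral>x. \<psi> x \<partial>lebesgue_torus)\<bar>
            \<le> lipschitz_bound \<phi> * (1 + (\<integral>x. \<bar>\<psi> x\<bar> \<partial>lebesgue_torus)) * (2 ^ Suc M * (1/2) ^ n + \<epsilon>)"
      if \<psi>: "integrable lebesgue_torus \<psi>" and \<phi>: "lipschitz_map \<phi>" for n \<phi> \<psi>
    proof -
      have [measurable]: "\<phi> \<in> borel_measurable borel"
        using \<phi> by (auto simp: lipschitz_map_def intro: borel_measurable_continuous_onI lipschitz_on_continuous_on)
      have \<eta>: "(\<integral>x. \<phi> x \<partial>\<eta>) = (\<integral>\<omega>. \<phi> (?T \<omega>) \<partial>lebesgue_torus)"
        unfolding \<eta>_def by (rule integral_distr) auto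
      let ?e = "lipschitz_bound \<phi> * (2 ^ Suc M * (1/2) ^ n + \<epsilon>)"
      have e0: "0 \<le> ?e" using lipschitz_bound_pos[of \<phi>] \<epsilon> by (intro mult_nonneg_nonneg) auto
      have "\<bar>(\<integral>p. \<phi> (snd ((F ^^ n) p)) * \<psi> (snd p) \<partial>(lebesgue_torus \<Otimes>\<^sub>M lebesgue_torus))
              - (\<integral>x. \<phi> x \<partial>\<eta>) * (\<integral>x. \<psi> x \<partial>lebesgue_torus)\<bar> \<le> ?e * (\<integral>x. \<bar>\<psi> x\<bar> \<partial>lebesgue_torus)"
      proof (rule integral_pair_weight[OF _ _ \<psi>])
        show "(\<lambda>p. \<phi> (snd ((F ^^ n) p))) \<in> borel_measurable (borel \<Otimes>\<^sub>M borel)" by measurable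
        show "\<bar>\<phi> (snd ((F ^^ n) p))\<bar> \<le> lipschitz_bound \<phi>" for p by (rule lipschitz_bound(1)[OF \<phi>])
        show "\<bar>(\<integral>\<omega>. \<phi> (snd ((F ^^ n) (\<omega>, x))) \<partial>lebesgue_torus) - (\<integral>x. \<phi> x \<partial>\<eta>)\<bar> \<le> ?e" for x
          unfolding \<eta>
          by (rule lipschitz_mixing[OF erg _ _ N M_def _ _ \<phi>])
             (use assms small \<epsilon> in \<open>auto simp: minor_def q_def c_def G_def\<close>)
      qed
      also have "\<dots> \<le> ?e * (1 + (\<integral>x. \<bar>\<psi> x\<bar> \<partial>lebesgue_torus))" using e0 by (intro mult_left_mono) auto
      finally show ?thesis by (simp only: mult_ac)
    qed
    ultimately show "\<exists>lam' C' \<eta>. 0 < lam' \<and> lam' < 1 \<and> C' > 0 \<and> \<eta> \<in> borel_probs \<and>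
          (\<forall>n \<phi> \<psi>. integrable lebesgue_torus \<psi> \<longrightarrow> lipschitz_map \<phi> \<longrightarrow>
            \<bar>(\<integral>p. \<phi> (snd ((F ^^ n) p)) * \<psi> (snd p) \<partial>(lebesgue_torus \<Otimes>\<^sub>M lebesgue_torus))
              - (\<integral>x. \<phi> x \<partial>\<eta>) * (\<integral>x. \<psi> x \<partial>lebesgue_torus)\<bar>
            \<le> lipschitz_bound \<phi> * (1 + (\<integral>x. \<bar>\<psi> x\<bar> \<partial>lebesgue_torus)) * (C' * lam' ^ n + \<epsilon>))"
      by (intro exI[of _ "1/2"] exI[of _ "2 ^ Suc M"] exI[of _ \<eta>]) auto
  qed
qed

end
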